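(* The column sum optimization problem (defined in the context) can be solved in polynomial time in each of the following two cases: 1. All functions are the same. That is, there is an algorithm running in time polynomial in the input size which, given positive integers $m,n$, positive integers $r_1,\dots,r_m\leq n$, and a single function $f:\{0,1,\dots,m\}\rightarrow\mathbb{Z}$, finds a matrix $A\in\{0,1\}^{m\times n}$ with $r_i(A)=r_i$ for all $i=1,\dots,m$ which minimizes $\sum_{j=1}^n f(c_j(A))$ among all such matrices (i.e. the case $f_1=\cdots=f_n=f$). 2. All row sums are bounded by a fixed integer. That is, for every fixed integer $b$ there is an algorithm running in time polynomial in the input size (where $b$ is regarded as a constant) which, given positive integers $m,n$, positive integers $r_1,\dots,r_m\leq n$ with $r_1,\dots,r_m\leq b$, and arbitrary (possibly distinct) functions $f_j:\{0,1,\dots,m\}\rightarrow\mathbb{Z}$ for $j=1,\dots,n$, finds a matrix $A\in\{0,1\}^{m\times n}$ with $r_i(A)=r_i$ for all $i=1,\dots,m$ which minimizes $\sum_{j=1}^n f_j(c_j(A))$ among all such matrices.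
   Context: For an $m\times n$ matrix $A$, its row sums are $r_i(A):=\sum_{j=1}^n A_{i,j}$ for $i=1,\dots,m$ and its column sums are $c_j(A):=\sum_{i=1}^m A_{i,j}$ for $j=1,\dots,n$. Column Sum Optimization Problem: given positive integers $m,n$ and positive integers $r_1,\dots,r_m\leq n$, and functions $f_j:\{0,1,\dots,m\}\rightarrow\mathbb{Z}$ for $j=1,\dots,n$, find an $m\times n$ matrix $A$, each of whose entries is $0$ or $1$, with row sums $r_i(A)=r_i$ for $i=1,\dots,m$, which minimizes $\sum_{j=1}^n f_j(c_j(A))$. Input convention: each function $f_j$ is given by the list of its $m+1$ integer values $f_j(0),f_j(1),\dots,f_j(m)$ (integers encoded in binary), so the input size is at least of the order of $m+n$; "polynomial time" means that the running time is bounded by a polynomial in the size of the input. *)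

theory Defs
  imports
    "HOL-Library.Log_Nat"
    "HOL-Computational_Algebra.Polynomial"
    "Jordan_Normal_Form.Matrix"
begin

section \<open>Polynomial-time computation\<close>

text \<open>
  The model is a random access machine with structured control flow and logarithmic cost. A program
  works on finitely many arrays of integers (a scalar is an array used only at index 0) and on a
  write-only output tape. Every elementary operation is charged at least the total number of bits
  of the addresses and values it touches, and a multiplication is charged the product of the bit
  sizes of its factors; hence running time is polynomially equivalent to Turing machine time.
\<close>

text \<open>Number of bits of an integer in binary, including one for the sign.\<close>

definition int_size :: "int \<Rightarrow> nat" where
  "int_size k = floorlog 2 (nat \<bar>k\<bar>) + 1"

datatype expr =
    Lit int
  | Get nat expr
  | Plus expr expr
  | Minus expr expr
  | Times expr expr

datatype prog =
    Skip
  | Put nat expr expr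
  | Write expr
  | Seq prog prog
  | Cond expr prog prog
  | While expr prog

type_synonym memory = "nat \<Rightarrow> int \<Rightarrow> int"
type_synonym config = "memory \<times> int list"

fun eval :: "expr \<Rightarrow> memory \<Rightarrow> int" where
  "eval (Lit k) M = k"
| "eval (Get a e) M = M a (eval e M)"
| "eval (Plus d e) M = eval d M + eval e M"
| "eval (Minus d e) M = eval d M - eval e M"
| "eval (Times d e) M = eval d M * eval e M"

fun expr_cost :: "expr \<Rightarrow> memory \<Rightarrow> nat" where
  "expr_cost (Lit k) M = int_size k"
| "expr_cost (Get a e) M = expr_cost e M + int_size (eval e M) + int_size (M a (eval e M))"
| "expr_cost (Plus d e) M =
     expr_cost d M + expr_cost e M + int_size (eval d M) + int_size (eval e M)"
| "expr_cost (Minus d e) M =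
     expr_cost d M + expr_cost e M + int_size (eval d M) + int_size (eval e M)"
| "expr_cost (Times d e) M =
     expr_cost d M + expr_cost e M + int_size (eval d M) * int_size (eval e M)"

text \<open>
  \<open>exec c s t s'\<close>: started in \<open>s\<close>, the program \<open>c\<close> halts in \<open>s'\<close> after time \<open>t\<close>. A test succeeds iff
  its value is positive. \<open>Put a d e\<close> is the assignment \<open>a[d] := e\<close>.
\<close>

inductive exec :: "prog \<Rightarrow> config \<Rightarrow> nat \<Rightarrow> config \<Rightarrow> bool" where
  Skip: "exec Skip s 1 s"
| Put: "exec (Put a d e) (M, out)
          (expr_cost d M + expr_cost e M + int_size (eval d M) + int_size (eval e M))
          (M(a := (M a)(eval d M := eval e M)), out)"
| Write: "exec (Write e) (M, out) (expr_cost e M + int_size (eval e M)) (M, out @ [eval e M])"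
| Seq: "exec c s t s' \<Longrightarrow> exec d s' t' s'' \<Longrightarrow> exec (Seq c d) s (t + t') s''"
| Cond_true: "eval e M > 0 \<Longrightarrow> exec c (M, out) t s \<Longrightarrow>
    exec (Cond e c d) (M, out) (expr_cost e M + int_size (eval e M) + t) s"
| Cond_false: "eval e M \<le> 0 \<Longrightarrow> exec d (M, out) t s \<Longrightarrow>
    exec (Cond e c d) (M, out) (expr_cost e M + int_size (eval e M) + t) s"
| While_true: "eval e M > 0 \<Longrightarrow> exec c (M, out) t s \<Longrightarrow> exec (While e c) s t' s' \<Longrightarrow>
    exec (While e c) (M, out) (expr_cost e M + int_size (eval e M) + t + t') s'"
| While_false: "eval e M \<le> 0 \<Longrightarrow>
    exec (While e c) (M, out) (expr_cost e M + int_size (eval e M)) (M, out)"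

inductive_cases exec_SkipE: "exec Skip s t s'"
  and exec_PutE: "exec (Put a d e) s t s'"
  and exec_WriteE: "exec (Write e) s t s'"
  and exec_SeqE: "exec (Seq c d) s t s'"
  and exec_CondE: "exec (Cond e c d) s t s'"
  and exec_WhileE: "exec (While e c) s t s'"

lemma exec_deterministic:
  "exec c s t s' \<Longrightarrow> exec c s u s'' \<Longrightarrow> u = t \<and> s'' = s'"
proof (induction arbitrary: u s'' rule: exec.induct)
  case Skip
  then show ?case by (auto elim: exec_SkipE)
next
  case Put
  then show ?case by (auto elim: exec_PutE)
next
  case Write
  then show ?case by (auto elim: exec_WriteE)
next
  case Seq
  from Seq.prems show ?case by (rule exec_SeqE) (use Seq.IH in blast)
next
  case (Cond_true e M c out t s d)
  from Cond_true.prems show ?case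
  proof (rule exec_CondE)
    fix M' out' t'
    assume "(M, out) = (M', out')" "u = expr_cost e M' + int_size (eval e M') + t'"
      "exec c (M', out') t' s''"
    then show ?thesis using Cond_true.IH by simp
  qed (use Cond_true.hyps in simp)
next
  case (Cond_false e M d out t s c)
  from Cond_false.prems show ?case
  proof (rule exec_CondE)
    fix M' out' t'
    assume "(M, out) = (M', out')" "u = expr_cost e M' + int_size (eval e M') + t'"
      "exec d (M', out') t' s''"
    then show ?thesis using Cond_false.IH by simp
  qed (use Cond_false.hyps in simp)
next
  case (While_true e M c out t s t' s')
  from While_true.prems show ?case
  proof (rule exec_WhileE)
    fix M' out' v s1 v'
    assume eq: "(M, out) = (M', out')" "u = expr_cost e M' + int_size (eval e M') + v + v'"
      and c: "exec c (M', out') v s1" and w: "exec (While e c) s1 v' s''"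
    from eq c While_true.IH(1) have 1: "v = t" "s1 = s" by simp_all
    with w While_true.IH(2) have "v' = t'" "s'' = s'" by simp_all
    with eq 1 show ?thesis by simp
  qed (use While_true.hyps in simp)
next
  case (While_false e M c out)
  from While_false.prems show ?case
    by (rule exec_WhileE) (use While_false.hyps in simp_all)
qed

text \<open>The input is placed in array 0; everything else is 0 initially.\<close>

definition input_memory :: "int list \<Rightarrow> memory" where
  "input_memory xs =
     (\<lambda>a k. if a = 0 \<and> 0 \<le> k \<and> k < int (length xs) then xs ! nat k else 0)"

text \<open>
  One program solves all instances in \<open>I\<close>: given the encoding of \<open>x\<close>, it writes a list related to \<open>x\<close>
  by \<open>sol\<close>, in time bounded by a fixed polynomial in the size of \<open>x\<close>.
\<close>

definition poly_time_solvable ::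
  "'i set \<Rightarrow> ('i \<Rightarrow> int list) \<Rightarrow> ('i \<Rightarrow> nat) \<Rightarrow> ('i \<Rightarrow> int list \<Rightarrow> bool) \<Rightarrow> bool" where
  "poly_time_solvable I enc isize sol \<longleftrightarrow>
     (\<exists>(c :: prog) (p :: nat poly). \<forall>x\<in>I. \<exists>t M out.
        exec c (input_memory (enc x), []) t (M, out) \<and> t \<le> poly p (isize x) \<and> sol x out)"


section \<open>Column sum optimization\<close>

text \<open>Rows, columns and functions are indexed from 0.\<close>

definition row_sum :: "nat mat \<Rightarrow> nat \<Rightarrow> nat" where
  "row_sum A i = (\<Sum>j<dim_col A. A $$ (i, j))"

definition col_sum :: "nat mat \<Rightarrow> nat \<Rightarrow> nat" where
  "col_sum A j = (\<Sum>i<dim_row A. A $$ (i, j))"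

definition row_data :: "nat \<Rightarrow> nat \<Rightarrow> (nat \<Rightarrow> nat) \<Rightarrow> bool" where
  "row_data m n r \<longleftrightarrow> 0 < m \<and> 0 < n \<and> (\<forall>i<m. 0 < r i \<and> r i \<le> n)"

definition feasible :: "nat \<Rightarrow> nat \<Rightarrow> (nat \<Rightarrow> nat) \<Rightarrow> nat mat \<Rightarrow> bool" where
  "feasible m n r A \<longleftrightarrow>
     A \<in> carrier_mat m n \<and> elements_mat A \<subseteq> {0, 1} \<and> (\<forall>i<m. row_sum A i = r i)"

definition objective :: "(nat \<Rightarrow> nat \<Rightarrow> int) \<Rightarrow> nat mat \<Rightarrow> int" where
  "objective f A = (\<Sum>j<dim_col A. f j (col_sum A j))"

definition optimal :: "nat \<Rightarrow> nat \<Rightarrow> (nat \<Rightarrow> nat) \<Rightarrow> (nat \<Rightarrow> nat \<Rightarrow> int) \<Rightarrow> nat mat \<Rightarrow> bool" where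
  "optimal m n r f A \<longleftrightarrow>
     feasible m n r A \<and> (\<forall>B. feasible m n r B \<longrightarrow> objective f A \<le> objective f B)"

text \<open>
  An instance is the list of \<open>m\<close>, \<open>n\<close>, the row sums, and the values \<open>g 0, \<dots>, g m\<close> of each listed
  function \<open>g\<close>; a matrix is output row by row.
\<close>

definition instance_list :: "nat \<Rightarrow> nat \<Rightarrow> (nat \<Rightarrow> nat) \<Rightarrow> (nat \<Rightarrow> int) list \<Rightarrow> int list" where
  "instance_list m n r gs =
     int m # int n # map (\<lambda>i. int (r i)) [0..<m] @ concat (map (\<lambda>g. map g [0..<Suc m]) gs)"

definition matrix_list :: "nat mat \<Rightarrow> int list" where
  "matrix_list A =
     concat (map (\<lambda>i. map (\<lambda>j. int (A $$ (i, j))) [0..<dim_col A]) [0..<dim_row A])"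

text \<open>
  The size is the bit length of the instance, with \<open>m\<close> and \<open>n\<close> counted in unary. If all \<open>n\<close> functions
  are listed, then the bit length alone exceeds \<open>m + n\<close> and the extra term is immaterial. If a
  single function is listed for all columns, the term keeps the size at least of order \<open>m + n\<close>;
  the bit length alone would be logarithmic in \<open>n\<close>, while the output has \<open>m * n\<close> entries.
\<close>

definition instance_size :: "nat \<Rightarrow> nat \<Rightarrow> (nat \<Rightarrow> nat) \<Rightarrow> (nat \<Rightarrow> int) list \<Rightarrow> nat" where
  "instance_size m n r gs = m + n + (\<Sum>x\<leftarrow>instance_list m n r gs. int_size x)"

end

theory Submission
  imports Defs
begin

text \<open>
  A cheapest path in an acyclic graph with polynomially many nodes and two moves per node is found by
  dynamic programming, and both cases reduce to such a path. If all functions agree, then by the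
  Gale--Ryser theorem the column sums are exactly the sequences whose \<open>q\<close> largest members never sum to
  more than \<open>\<Sum>i. min (r i) q\<close>, with equality for \<open>q = n\<close>. It suffices to choose them in sorted order, and
  then the condition only depends on the number and the total of the columns still to be chosen; the
  matrix is filled in greedily. If the row sums are at most \<open>d\<close>, the columns are chosen one after the
  other, and all that matters about the rows is how many of them have remaining sum \<open>0, \<dots>, d\<close>.

  Polynomial running time is shown by closure rules: a table is computable if its entries are given by
  sums, comparisons and lookups in terms of earlier entries and tables.
\<close>

section \<open>Programs without multiplication\<close>

text \<open>The loop bound \<open>N\<close> depends on \<open>m\<close>, \<open>n\<close> and fixed
  exponents only. Function values are never iterated over and enter the running time through their
  bit length \<open>L\<close> alone, so the analysis separates the number of executed commands from
  the length of the stored integers. Repeated squaring would double lengths in each round; therefore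
  multiplication is excluded, and products and quotients are recovered as sums of at most
  \<open>N\<close> terms. Nodes must then be numbers below a polynomial in \<open>m + n\<close> with
  few moves each, so larger choices are cut into unit steps: a column sum is found by raising a
  lower bound by one or using it, a set of rows by serving one row at a time. Optimality has two
  halves. Every feasible matrix yields a walk of the same cost, so \<open>best\<close> at the start
  is a lower bound; and the computed path is turned back into a matrix attaining it. The second half
  has to recover what nodes forget, namely which rows are meant: by the greedy filling in one case,
  by picking the first row with the required remaining sum in the other.\<close>

fun lin :: "expr \<Rightarrow> bool" where
  "lin (Lit k) = True"
| "lin (Get a e) = lin e"
| "lin (Plus d e) = (lin d \<and> lin e)"
| "lin (Minus d e) = (lin d \<and> lin e)"
| "lin (Times d e) = False"

fun weight :: "expr \<Rightarrow> nat" where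
  "weight (Lit k) = int_size k"
| "weight (Get a e) = weight e + 1"
| "weight (Plus d e) = weight d + weight e + 1"
| "weight (Minus d e) = weight d + weight e + 1"
| "weight (Times d e) = 0"

definition mem_bd :: "nat \<Rightarrow> memory \<Rightarrow> bool" where
  "mem_bd L M \<longleftrightarrow> (\<forall>a i. \<bar>M a i\<bar> < 2 ^ L)"

lemma abs_less_int_size: "\<bar>k\<bar> < 2 ^ int_size k"
proof -
  have "nat \<bar>k\<bar> < 2 ^ floorlog 2 (nat \<bar>k\<bar>)"
    by (rule floorlog_leD[OF order_refl]) simp
  then have "\<bar>k\<bar> < 2 ^ floorlog 2 (nat \<bar>k\<bar>)" by (simp add: nat_less_iff)
  also have "\<dots> \<le> 2 ^ int_size k" by (simp add: int_size_def)
  finally show ?thesis .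
qed

lemma int_size_le: "\<bar>k\<bar> < 2 ^ L \<Longrightarrow> int_size k \<le> L + 1"
  by (simp add: int_size_def floorlog_le_iff nat_less_iff)

lemma abs_add_bd:
  fixes x y :: int
  assumes "\<bar>x\<bar> < 2 ^ (L + k)" "\<bar>y\<bar> < 2 ^ (L + l)"
  shows "\<bar>x + y\<bar> < 2 ^ Suc (L + (k + l))" "\<bar>x - y\<bar> < 2 ^ Suc (L + (k + l))"
proof -
  have "(2::int) ^ (L + k) \<le> 2 ^ (L + (k + l))" "(2::int) ^ (L + l) \<le> 2 ^ (L + (k + l))"
    by (rule power_increasing; simp)+
  then show "\<bar>x + y\<bar> < 2 ^ Suc (L + (k + l))" "\<bar>x - y\<bar> < 2 ^ Suc (L + (k + l))"
    using assms unfolding power_Suc by linarith+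
qed

lemma eval_bd: "lin e \<Longrightarrow> mem_bd L M \<Longrightarrow> \<bar>eval e M\<bar> < 2 ^ (L + weight e)"
proof (induction e)
  case (Lit k)
  have "(2::int) ^ int_size k \<le> 2 ^ (L + int_size k)" by (rule power_increasing) simp_all
  then show ?case using abs_less_int_size[of k] by (simp only: eval.simps weight.simps)
next
  case (Get a e)
  have "(2::int) ^ L \<le> 2 ^ (L + (weight e + 1))" by (rule power_increasing) simp_all
  moreover have "\<bar>M a (eval e M)\<bar> < 2 ^ L" using Get.prems by (simp add: mem_bd_def)
  ultimately show ?case by (simp only: eval.simps weight.simps)
next
  case (Plus d e)
  then show ?case using abs_add_bd[of "eval d M" L "weight d" "eval e M" "weight e"] by simp
next
  case (Minus d e)
  then show ?case using abs_add_bd[of "eval d M" L "weight d" "eval e M" "weight e"] by simp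
qed simp

lemma int_size_eval:
  "lin e \<Longrightarrow> mem_bd L M \<Longrightarrow> L + weight e < Z \<Longrightarrow> int_size (eval e M) \<le> Z"
  using int_size_le[OF eval_bd] by fastforce

text \<open>Each node of an expression is charged at most two integers of at most \<open>Z\<close>
  bits, and \<open>weight\<close> counts nodes, literals by their length. A product would be charged
  a product of lengths.\<close>

lemma expr_cost_bd:
  "lin e \<Longrightarrow> mem_bd L M \<Longrightarrow> L + weight e < Z \<Longrightarrow> expr_cost e M \<le> 3 * weight e * Z"
proof (induction e)
  case (Lit k)
  then show ?case by (cases Z) (simp_all add: algebra_simps)
next
  case (Get a e)
  have "int_size (M a (eval e M)) \<le> Z"
    using Get.prems int_size_le[of "M a (eval e M)" L] by (auto simp: mem_bd_def)
  moreover have "int_size (eval e M) \<le> Z"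
    using Get.prems by (intro int_size_eval[of e L]) simp_all
  ultimately show ?case using Get by (simp add: algebra_simps)
next
  case (Plus d e)
  have "int_size (eval d M) \<le> Z" "int_size (eval e M) \<le> Z"
    using Plus.prems by (auto intro!: int_size_eval[of d L] int_size_eval[of e L])
  moreover have "expr_cost d M \<le> 3 * weight d * Z" "expr_cost e M \<le> 3 * weight e * Z"
    using Plus by simp_all
  ultimately show ?case by (simp add: add_mult_distrib add_mult_distrib2)
next
  case (Minus d e)
  have "int_size (eval d M) \<le> Z" "int_size (eval e M) \<le> Z"
    using Minus.prems by (auto intro!: int_size_eval[of d L] int_size_eval[of e L])
  moreover have "expr_cost d M \<le> 3 * weight d * Z" "expr_cost e M \<le> 3 * weight e * Z"
    using Minus by simp_all
  ultimately show ?case by (simp add: add_mult_distrib add_mult_distrib2)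
qed simp

text \<open>
  Without multiplication, executing commands of total weight \<open>k\<close> lengthens the stored values by at
  most \<open>k\<close> bits, so the logarithmic cost is controlled by the weight alone.
\<close>

definition runs :: "prog \<Rightarrow> config \<Rightarrow> nat \<Rightarrow> config \<Rightarrow> bool" where
  "runs c s k s' \<longleftrightarrow> (\<forall>L. mem_bd L (fst s) \<longrightarrow> mem_bd (L + k) (fst s') \<and>
     (\<exists>t. exec c s t s' \<and> t \<le> 3 * k * (L + k + 1)))"

lemma mem_bd_mono: "mem_bd L M \<Longrightarrow> L \<le> L' \<Longrightarrow> mem_bd L' M"
  unfolding mem_bd_def by (meson less_le_trans one_le_numeral power_increasing)

lemma runs_mono: "runs c s k s' \<Longrightarrow> k \<le> k' \<Longrightarrow> runs c s k' s'"
  unfolding runs_def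
proof (intro allI impI)
  fix L assume *: "\<forall>L. mem_bd L (fst s) \<longrightarrow> mem_bd (L + k) (fst s') \<and>
     (\<exists>t. exec c s t s' \<and> t \<le> 3 * k * (L + k + 1))" and k: "k \<le> k'" and L: "mem_bd L (fst s)"
  from * L obtain t where t: "mem_bd (L + k) (fst s')" "exec c s t s'" "t \<le> 3 * k * (L + k + 1)"
    by blast
  have "3 * k * (L + k + 1) \<le> 3 * k' * (L + k' + 1)" using k by (intro mult_mono) auto
  with t k show "mem_bd (L + k') (fst s') \<and> (\<exists>t. exec c s t s' \<and> t \<le> 3 * k' * (L + k' + 1))"
    using mem_bd_mono[OF t(1), of "L + k'"] by auto
qed

lemma runs_Put:
  assumes "lin d" "lin e"
  shows "runs (Put a d e) (M, out) (weight d + weight e + 1)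
    (M(a := (M a)(eval d M := eval e M)), out)"
  unfolding runs_def fst_conv
proof (intro allI impI conjI)
  fix L assume L: "mem_bd L M"
  let ?Z = "L + (weight d + weight e + 1)"
  have "\<bar>M x i\<bar> < 2 ^ ?Z" for x i
    using L mem_bd_mono[OF L, of ?Z] by (auto simp: mem_bd_def)
  moreover have "\<bar>eval e M\<bar> < 2 ^ ?Z"
    by (rule less_le_trans[OF eval_bd[OF assms(2) L]]) (rule power_increasing; simp)
  ultimately show "mem_bd (L + (weight d + weight e + 1)) (M(a := (M a)(eval d M := eval e M)))"
    by (auto simp: mem_bd_def)
  define Z where "Z = L + (weight d + weight e + 1) + 1"
  have "int_size (eval d M) \<le> Z" "int_size (eval e M) \<le> Z"
    using L assms by (auto intro!: int_size_eval[of d L] int_size_eval[of e L] simp: Z_def)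
  moreover have "expr_cost d M \<le> 3 * weight d * Z"
    using assms(1) L by (rule expr_cost_bd) (simp add: Z_def)
  moreover have "expr_cost e M \<le> 3 * weight e * Z"
    using assms(2) L by (rule expr_cost_bd) (simp add: Z_def)
  ultimately have "expr_cost d M + expr_cost e M + int_size (eval d M) + int_size (eval e M)
      \<le> 3 * (weight d + weight e + 1) * Z" by (simp add: add_mult_distrib add_mult_distrib2)
  then show "\<exists>t. exec (Put a d e) (M, out) t (M(a := (M a)(eval d M := eval e M)), out) \<and>
      t \<le> 3 * (weight d + weight e + 1) * (L + (weight d + weight e + 1) + 1)"
    unfolding Z_def using exec.Put by blast
qed

lemma test_cost:
  assumes "lin e" "mem_bd L M"
  shows "expr_cost e M + int_size (eval e M) \<le> 3 * (weight e + 1) * (L + (weight e + 1) + 1)"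
proof -
  define Z where "Z = L + (weight e + 1) + 1"
  have "int_size (eval e M) \<le> Z" using assms by (rule int_size_eval) (simp add: Z_def)
  moreover have "expr_cost e M \<le> 3 * weight e * Z"
    using assms by (rule expr_cost_bd) (simp add: Z_def)
  ultimately show ?thesis unfolding Z_def[symmetric] by (simp add: add_mult_distrib)
qed

lemma runs_Write: "lin e \<Longrightarrow> runs (Write e) (M, out) (weight e + 1) (M, out @ [eval e M])"
  unfolding runs_def fst_conv
proof (intro allI impI conjI)
  fix L assume e: "lin e" and L: "mem_bd L M"
  show "mem_bd (L + (weight e + 1)) M" using mem_bd_mono[OF L] by simp
  have "expr_cost e M + int_size (eval e M) \<le> 3 * (weight e + 1) * (L + (weight e + 1) + 1)"
    using e L by (rule test_cost)
  then show "\<exists>t. exec (Write e) (M, out) t (M, out @ [eval e M]) \<and>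
      t \<le> 3 * (weight e + 1) * (L + (weight e + 1) + 1)"
    using exec.Write by blast
qed

text \<open>The second program starts with values up to \<open>k\<close> bits longer, so its bound
  contains \<open>L + k\<close>; the quadratic form absorbs this.\<close>

lemma time_add:
  fixes k k' L :: nat
  assumes "t \<le> 3 * k * (L + k + 1)" "t' \<le> 3 * k' * (L + k + k' + 1)"
  shows "t + t' \<le> 3 * (k + k') * (L + (k + k') + 1)"
proof -
  have "3 * k * (L + k + 1) \<le> 3 * k * (L + k + k' + 1)" by simp
  then have "t + t' \<le> 3 * k * (L + k + k' + 1) + 3 * k' * (L + k + k' + 1)"
    using assms by linarith
  also have "\<dots> = 3 * (k + k') * (L + k + k' + 1)" by (simp only: add_mult_distrib add_mult_distrib2)
  finally show ?thesis by (simp only: add.assoc)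
qed

lemma runs_Seq: "runs c s k s' \<Longrightarrow> runs d s' k' s'' \<Longrightarrow> runs (Seq c d) s (k + k') s''"
  unfolding runs_def
proof (intro allI impI)
  fix L
  assume 1: "\<forall>L. mem_bd L (fst s) \<longrightarrow> mem_bd (L + k) (fst s') \<and>
      (\<exists>t. exec c s t s' \<and> t \<le> 3 * k * (L + k + 1))"
    and 2: "\<forall>L. mem_bd L (fst s') \<longrightarrow> mem_bd (L + k') (fst s'') \<and>
      (\<exists>t. exec d s' t s'' \<and> t \<le> 3 * k' * (L + k' + 1))"
    and L: "mem_bd L (fst s)"
  from 1 L obtain t where t: "mem_bd (L + k) (fst s')" "exec c s t s'" "t \<le> 3 * k * (L + k + 1)"
    by blast
  with 2 obtain t' where t': "mem_bd (L + k + k') (fst s'')" "exec d s' t' s''"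
    "t' \<le> 3 * k' * (L + k + k' + 1)" by blast
  show "mem_bd (L + (k + k')) (fst s'') \<and>
      (\<exists>t. exec (Seq c d) s t s'' \<and> t \<le> 3 * (k + k') * (L + (k + k') + 1))"
    using t'(1) exec.Seq[OF t(2) t'(2)] time_add[OF t(3) t'(3)] by (auto simp only: add.assoc)
qed

text \<open>Shared by branching and looping: a test leaves the memory unchanged and counts like a
  command of weight \<open>weight e + 1\<close> run before \<open>c\<close>.\<close>

lemma runs_test:
  assumes "runs c (M, out) k s" "lin e"
    and ex: "\<And>t. exec c (M, out) t s \<Longrightarrow>
      exec d (M, out) (expr_cost e M + int_size (eval e M) + t) s"
  shows "runs d (M, out) (weight e + 1 + k) s"
  unfolding runs_def
proof (intro allI impI)
  fix L assume L: "mem_bd L (fst (M, out))"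
  then have "mem_bd (L + (weight e + 1)) (fst (M, out))" by (rule mem_bd_mono) simp
  with assms(1) obtain t where t: "mem_bd (L + (weight e + 1) + k) (fst s)"
    "exec c (M, out) t s" "t \<le> 3 * k * (L + (weight e + 1) + k + 1)"
    unfolding runs_def by blast
  from L have "expr_cost e M + int_size (eval e M) \<le> 3 * (weight e + 1) * (L + (weight e + 1) + 1)"
    using assms(2) by (intro test_cost) simp_all
  from time_add[OF this t(3)] ex[OF t(2)] t(1)
  show "mem_bd (L + (weight e + 1 + k)) (fst s) \<and> (\<exists>t. exec d (M, out) t s \<and>
      t \<le> 3 * (weight e + 1 + k) * (L + (weight e + 1 + k) + 1))"
    by (auto simp only: add.assoc)
qed

lemma runs_Cond:
  assumes "lin e" "runs (if eval e M > 0 then c else d) (M, out) k s"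
  shows "runs (Cond e c d) (M, out) (weight e + 1 + k) s"
  using assms by (intro runs_test[of "if eval e M > 0 then c else d"])
    (auto intro: exec.Cond_true exec.Cond_false split: if_splits)

lemma runs_While_false:
  assumes "lin e" "eval e M \<le> 0"
  shows "runs (While e c) (M, out) (weight e + 1) (M, out)"
  unfolding runs_def
proof (intro allI impI conjI)
  fix L assume L: "mem_bd L (fst (M, out))"
  show "mem_bd (L + (weight e + 1)) (fst (M, out))" using L by (rule mem_bd_mono) simp
  show "\<exists>t. exec (While e c) (M, out) t (M, out) \<and> t \<le> 3 * (weight e + 1) * (L + (weight e + 1) + 1)"
    using exec.While_false[OF assms(2)] test_cost[OF assms(1)] L unfolding fst_conv by blast
qed

lemma runs_While_true:
  assumes e: "lin e" "eval e M > 0" and c: "runs c (M, out) k s" and w: "runs (While e c) s k' s'"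
  shows "runs (While e c) (M, out) (weight e + 1 + (k + k')) s'"
\<comment> \<open>A successful round is the test followed by the unfolded program
  \<open>Seq c (While e c)\<close>, so the rule for tests applies.\<close>
proof (rule runs_test[where c = "Seq c (While e c)"])
  show "runs (Seq c (While e c)) (M, out) (k + k') s'" using c w by (rule runs_Seq)
next
  fix t assume "exec (Seq c (While e c)) (M, out) t s'"
  then show "exec (While e c) (M, out) (expr_cost e M + int_size (eval e M) + t) s'"
  proof (rule exec_SeqE)
    fix t1 s1 t2
    assume "exec c (M, out) t1 s1" "exec (While e c) s1 t2 s'" "t = t1 + t2"
    then show ?thesis using exec.While_true[OF e(2)] by (metis add.assoc)
  qed
qed (fact e(1))

abbreviation loop_cost :: "expr \<Rightarrow> nat \<Rightarrow> nat \<Rightarrow> nat" where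
  "loop_cost e k n \<equiv> n * (k + (weight e + 1)) + (weight e + 1)"

text \<open>Weights add up under sequencing, so the total is linear in the number of rounds; a rule
  about time would have to follow the growing lengths from round to round.\<close>

lemma runs_for:
  assumes e: "lin e"
    and test: "\<And>i M out. J i M out \<Longrightarrow> i \<le> n \<Longrightarrow> (eval e M > 0 \<longleftrightarrow> i < n)"
    and body: "\<And>i M out. J i M out \<Longrightarrow> i < n \<Longrightarrow>
      \<exists>M' out'. runs c (M, out) k (M', out') \<and> J (Suc i) M' out'"
    and init: "J 0 M out"
  shows "\<exists>M' out'. runs (While e c) (M, out) (loop_cost e k n) (M', out')
    \<and> J n M' out'"
proof -
  have "J i M out \<Longrightarrow> i \<le> n \<Longrightarrow> \<exists>M' out'. runs (While e c) (M, out)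
     (loop_cost e k (n - i)) (M', out') \<and> J n M' out'" for i M out
  proof (induction "n - i" arbitrary: i M out)
    case 0
    then have "\<not> eval e M > 0" using test by fastforce
    then have "runs (While e c) (M, out) (weight e + 1) (M, out)"
      by (intro runs_While_false[OF e]) simp
    moreover have "i = n" using 0 by simp
    ultimately show ?case using 0 by (intro exI[of _ M] exI[of _ out]) simp
  next
    case (Suc d)
    then have i: "i < n" by simp
    then have pos: "eval e M > 0" using test Suc.prems by simp
    obtain M1 out1 where 1: "runs c (M, out) k (M1, out1)" "J (Suc i) M1 out1"
      using body[OF Suc.prems(1) i] by blast
    have "d = n - Suc i" "Suc i \<le> n" using Suc.hyps(2) i by simp_all
    then obtain M2 out2 where 2: "runs (While e c) (M1, out1)
       (loop_cost e k (n - Suc i)) (M2, out2)" "J n M2 out2"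
      using Suc.hyps(1)[of "Suc i"] 1(2) by blast
    have "n - i = Suc (n - Suc i)" using i by simp
    then have "weight e + 1 + (k + (loop_cost e k (n - Suc i)))
       = loop_cost e k (n - i)" by (simp add: algebra_simps)
    then have "runs (While e c) (M, out) (loop_cost e k (n - i)) (M2, out2)"
      using runs_While_true[OF e pos 1(1) 2(1)] by metis
    with 2(2) show ?case by blast
  qed
  from this[OF init le0] show ?thesis by (simp only: diff_zero)
qed

section \<open>Functions computable in polynomial time\<close>

definition pb :: "(nat \<Rightarrow> nat) \<Rightarrow> bool" where
  "pb g \<longleftrightarrow> (\<exists>p :: nat poly. \<forall>x. g x \<le> poly p x)"

lemma pb_poly: "pb (poly p)"
  unfolding pb_def by blast

lemma pb_const: "pb (\<lambda>x. k)"
  unfolding pb_def by (rule exI[of _ "[:k:]"]) simp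

lemma pb_id: "pb (\<lambda>x. x)"
  unfolding pb_def by (rule exI[of _ "[:0, 1:]"]) simp

lemma pb_add:
  assumes "pb g" "pb h"
  shows "pb (\<lambda>x. g x + h x)"
proof -
  from assms obtain p q where "\<And>x. g x \<le> poly p x" "\<And>x. h x \<le> poly q x" unfolding pb_def by blast
  then show ?thesis unfolding pb_def by (intro exI[of _ "p + q"]) (simp add: add_mono)
qed

lemma pb_mult:
  assumes "pb g" "pb h"
  shows "pb (\<lambda>x. g x * h x)"
proof -
  from assms obtain p q where "\<And>x. g x \<le> poly p x" "\<And>x. h x \<le> poly q x" unfolding pb_def by blast
  then show ?thesis unfolding pb_def by (intro exI[of _ "p * q"]) (simp add: mult_le_mono)
qed

lemmas pb_intros = pb_poly pb_const pb_id pb_add pb_mult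

text \<open>
  Array 1 serves as a stack: an expression evaluated at depth \<open>d\<close> leaves its value in slot \<open>d\<close> and
  may only change the slots from \<open>d\<close> on. Slot 0 holds the bound \<open>N\<close> on the number of rounds of every
  loop; running times are polynomial in \<open>N\<close>. A relation \<open>rep\<close> describes how an environment is
  represented in the memory.
\<close>

type_synonym table = "int \<Rightarrow> int"
type_synonym 'e rep = "'e \<Rightarrow> memory \<Rightarrow> bool"

definition agree :: "nat \<Rightarrow> memory \<Rightarrow> memory \<Rightarrow> bool" where
  "agree d M M' \<longleftrightarrow> (\<forall>i < int d. M' 1 i = M 1 i) \<and> (\<forall>a. a \<noteq> 1 \<longrightarrow> M' a = M a)"

definition stable :: "nat \<Rightarrow> 'e rep \<Rightarrow> bool" where
  "stable d rep \<longleftrightarrow> 0 < d \<and> (\<forall>e M M'. rep e M \<longrightarrow> agree d M M' \<longrightarrow> rep e M')"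

abbreviation leaves :: "prog \<Rightarrow> (nat \<Rightarrow> nat) \<Rightarrow> nat \<Rightarrow> memory \<Rightarrow> int list \<Rightarrow> int \<Rightarrow> bool" where
  "leaves c g d M out v \<equiv>
     \<exists>M'. runs c (M, out) (g (nat (M 1 0))) (M', out) \<and> agree d M M' \<and> M' 1 (int d) = v"

definition comp_at :: "nat \<Rightarrow> 'e rep \<Rightarrow> ('e \<Rightarrow> int) \<Rightarrow> bool" where
  "comp_at d rep F \<longleftrightarrow> (\<exists>c g. pb g \<and> (\<forall>e M out. rep e M \<longrightarrow>
     leaves c g d M out (F e)))"

text \<open>Every admissible depth is covered because the same function gets evaluated at different
  depths, depending on the expression around it.\<close>

definition comp :: "'e rep \<Rightarrow> ('e \<Rightarrow> int) \<Rightarrow> bool" where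
  "comp rep F \<longleftrightarrow> (\<forall>d. stable d rep \<longrightarrow> comp_at d rep F)"

text \<open>Binds a loop variable: the environment grows by an integer read from slot
  \<open>d\<close>, as in a de Bruijn context.\<close>

definition ext :: "nat \<Rightarrow> 'e rep \<Rightarrow> 'e \<times> int \<Rightarrow> memory \<Rightarrow> bool" where
  "ext d rep e M \<longleftrightarrow> rep (fst e) M \<and> M 1 (int d) = snd e"

definition scal :: "'e rep \<Rightarrow> ('e \<Rightarrow> int) \<Rightarrow> bool" where
  "scal rep f \<longleftrightarrow> (\<exists>i. \<forall>e M. rep e M \<longrightarrow> M 1 i = f e)"

definition tabl :: "'e rep \<Rightarrow> ('e \<Rightarrow> int \<Rightarrow> int) \<Rightarrow> bool" where
  "tabl rep T \<longleftrightarrow> (\<exists>a. a \<noteq> 1 \<and> (\<forall>e M. rep e M \<longrightarrow> M a = T e))"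

definition lim :: "'e rep \<Rightarrow> ('e \<Rightarrow> int) \<Rightarrow> bool" where
  "lim rep N \<longleftrightarrow> (\<forall>e M. rep e M \<longrightarrow> M 1 0 = N e)"

text \<open>Table lookup is a constant of its own so that unification can find the table.\<close>

definition look :: "table \<Rightarrow> int \<Rightarrow> int" where
  "look t u = t u"

lemma agree_trans: "agree d M M' \<Longrightarrow> agree d M' M'' \<Longrightarrow> agree d M M''"
  by (simp add: agree_def)

lemma agree_less: "agree d M M' \<Longrightarrow> d' \<le> d \<Longrightarrow> agree d' M M'"
  by (simp add: agree_def)

lemma agree_slot: "agree d M M' \<Longrightarrow> d' < d \<Longrightarrow> M' 1 (int d') = M 1 (int d')"
  by (simp add: agree_def)

lemma agree_upd: "d \<le> d' \<Longrightarrow> agree d M (M(1 := (M 1)(int d' := v)))"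
  by (simp add: agree_def)

lemma stable_agree: "stable d rep \<Longrightarrow> rep e M \<Longrightarrow> agree d M M' \<Longrightarrow> rep e M'"
  unfolding stable_def by blast

lemma stable_agree0: "stable d rep \<Longrightarrow> agree d M M' \<Longrightarrow> M' 1 0 = M 1 0"
  by (simp add: stable_def agree_def)

lemma stable_less:
  assumes st: "stable d rep" and d: "d \<le> d'"
  shows "stable d' rep"
  unfolding stable_def
proof (intro conjI allI impI)
  fix e M M' assume "rep e M" "agree d' M M'"
  then show "rep e M'" using stable_agree[OF st] agree_less[OF _ d] by blast
qed (use st d in \<open>simp add: stable_def\<close>)

lemma stable_ext:
  assumes st: "stable d rep"
  shows "stable (Suc d) (ext d rep)"
  unfolding stable_def
proof (intro conjI allI impI)
  fix e M M' assume e: "ext d rep e M" and a: "agree (Suc d) M M'"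
  have "agree d M M'" by (rule agree_less[OF a]) simp
  with e have "rep (fst e) M'" unfolding ext_def using stable_agree[OF st] by blast
  moreover have "M' 1 (int d) = snd e" using agree_slot[OF a, of d] e by (simp add: ext_def)
  ultimately show "ext d rep e M'" by (simp add: ext_def)
qed simp

lemma scal_ext: "scal rep f \<Longrightarrow> scal (ext d rep) (\<lambda>e. f (fst e))"
  by (auto simp: scal_def ext_def)

lemma scal_snd: "scal (ext d rep) snd"
  by (auto simp: scal_def ext_def)

lemma tabl_ext:
  assumes "tabl rep T"
  shows "tabl (ext d rep) (\<lambda>e. T (fst e))"
proof -
  from assms obtain a where "a \<noteq> 1" "\<And>e M. rep e M \<Longrightarrow> M a = T e" unfolding tabl_def by blast
  then show ?thesis unfolding tabl_def by (intro exI[of _ a]) (simp add: ext_def)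
qed

lemma lim_ext: "lim rep N \<Longrightarrow> lim (ext d rep) (\<lambda>e. N (fst e))"
  by (auto simp: lim_def ext_def)

lemma scal_lim: "lim rep N \<Longrightarrow> scal rep N"
  by (auto simp: lim_def scal_def)

lemma comp_atE:
  assumes "comp rep F" "stable d rep"
  obtains c g where "pb g" and "\<And>e M out. rep e M \<Longrightarrow>
    leaves c g d M out (F e)"
  using assms unfolding comp_def comp_at_def by blast

lemma comp_atI:
  assumes "pb g" and "\<And>e M out. rep e M \<Longrightarrow>
    leaves c g d M out (F e)"
  shows "comp_at d rep F"
  unfolding comp_at_def using assms by blast

lemma runs_slot:
  assumes "lin E"
  shows "runs (Put 1 (Lit (int d)) E) (M, out) (int_size (int d) + weight E + 1)
    (M(1 := (M 1)(int d := eval E M)), out)"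
  using runs_Put[of "Lit (int d)" E 1 M out] assms by simp

section \<open>Closure of computable functions under arithmetic, lookup, case distinction and
  bounded sums\<close>

lemma comp_expr:
  assumes "lin E" "\<And>e M. rep e M \<Longrightarrow> eval E M = F e"
  shows "comp rep F"
  unfolding comp_def
proof (intro allI impI)
  fix d assume "stable d rep"
  show "comp_at d rep F"
  proof (rule comp_atI)
    show "pb (\<lambda>_. int_size (int d) + weight E + 1)" by (rule pb_const)
  next
    fix e M out assume M: "rep e M"
    let ?M = "M(1 := (M 1)(int d := eval E M))"
    have "?M 1 (int d) = F e" using assms(2)[OF M] by simp
    then show "\<exists>M'. runs (Put 1 (Lit (int d)) E) (M, out) (int_size (int d) + weight E + 1) (M', out) \<and>
        agree d M M' \<and> M' 1 (int d) = F e"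
      using runs_slot[OF assms(1)] agree_upd[OF order_refl] by (intro exI[of _ ?M] conjI)
  qed
qed

lemma comp_const: "comp rep (\<lambda>e. k)"
  by (rule comp_expr[of "Lit k"]) simp_all

lemma comp_scal:
  assumes "scal rep f"
  shows "comp rep f"
proof -
  from assms obtain i where "\<And>e M. rep e M \<Longrightarrow> M 1 i = f e" unfolding scal_def by blast
  then show ?thesis by (rule_tac comp_expr[of "Get 1 (Lit i)"]) simp_all
qed

text \<open>
  Combining two values by one command: \<open>E d\<close> computes \<open>H\<close> from slots \<open>d\<close> and \<open>d + 1\<close> and the arrays
  other than the stack.
\<close>

lemma comp_comb:
  assumes F: "comp rep F" and G: "comp rep G" and lin: "\<And>d. lin (E d)"
    and eval: "\<And>e M d. rep e M \<Longrightarrow> M 1 (int d) = F e \<Longrightarrow> M 1 (int (Suc d)) = G e \<Longrightarrow>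
      eval (E d) M = H e"
  shows "comp rep H"
  unfolding comp_def
proof (intro allI impI)
  fix d assume st: "stable d rep"
  obtain cF gF where pF: "pb gF" and rF: "\<And>e M out. rep e M \<Longrightarrow>
    leaves cF gF d M out (F e)"
    by (rule comp_atE[OF F st]) (rule that)
  have st': "stable (Suc d) rep" using stable_less[OF st] by simp
  obtain cG gG where pG: "pb gG" and rG: "\<And>e M out. rep e M \<Longrightarrow>
    leaves cG gG (Suc d) M out (G e)"
    by (rule comp_atE[OF G st']) (rule that)
  let ?k = "int_size (int d) + weight (E d) + 1"
  show "comp_at d rep H"
  proof (rule comp_atI)
    show "pb (\<lambda>x. gF x + (gG x + ?k))" using pF pG by (intro pb_intros)
  next
    fix e M out assume M: "rep e M"
    obtain M1 where 1: "runs cF (M, out) (gF (nat (M 1 0))) (M1, out)" "agree d M M1"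
      "M1 1 (int d) = F e" using rF[OF M] by blast
    have M1: "rep e M1" by (rule stable_agree[OF st M 1(2)])
    obtain M2 where 2: "runs cG (M1, out) (gG (nat (M 1 0))) (M2, out)" "agree (Suc d) M1 M2"
      "M2 1 (int (Suc d)) = G e" using rG[OF M1, of out] stable_agree0[OF st 1(2)] by auto
    have M2: "rep e M2" by (rule stable_agree[OF st' M1 2(2)])
    have "M2 1 (int d) = F e" using agree_slot[OF 2(2)] 1(3) by simp
    then have "eval (E d) M2 = H e" using eval M2 2(3) by blast
    moreover have "agree d M M2"
      using agree_trans[OF 1(2)] agree_less[OF 2(2)] by simp
    moreover define M3 where "M3 = M2(1 := (M2 1)(int d := eval (E d) M2))"
    ultimately have 3: "agree d M M3" "M3 1 (int d) = H e"
      using agree_trans[OF _ agree_upd[OF order_refl]] by simp_all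
    have "runs (Put 1 (Lit (int d)) (E d)) (M2, out) ?k (M3, out)"
      unfolding M3_def by (rule runs_slot[OF lin])
    from runs_Seq[OF 1(1) runs_Seq[OF 2(1) this]] 3
    show "\<exists>M'. runs (Seq cF (Seq cG (Put 1 (Lit (int d)) (E d)))) (M, out)
        (gF (nat (M 1 0)) + (gG (nat (M 1 0)) + ?k)) (M', out) \<and> agree d M M' \<and> M' 1 (int d) = H e"
      by (intro exI[of _ M3] conjI)
  qed
qed

lemma comp_add:
  assumes "comp rep F" "comp rep G"
  shows "comp rep (\<lambda>e. F e + G e)"
  using assms by (rule comp_comb[where E = "\<lambda>d. Plus (Get 1 (Lit (int d))) (Get 1 (Lit (int (Suc d))))"]) simp_all

lemma comp_diff:
  assumes "comp rep F" "comp rep G"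
  shows "comp rep (\<lambda>e. F e - G e)"
  using assms by (rule comp_comb[where E = "\<lambda>d. Minus (Get 1 (Lit (int d))) (Get 1 (Lit (int (Suc d))))"]) simp_all

lemma comp_look:
  assumes T: "tabl rep T" and F: "comp rep F"
  shows "comp rep (\<lambda>e. look (T e) (F e))"
proof -
  from T obtain a where "\<And>e M. rep e M \<Longrightarrow> M a = T e" unfolding tabl_def by blast
  note a = this
  show ?thesis
  proof (rule comp_comb[OF F F, where E = "\<lambda>d. Get a (Get 1 (Lit (int d)))"])
    fix e M d assume "rep e M" "M 1 (int d) = F e"
    then show "eval (Get a (Get 1 (Lit (int d)))) M = look (T e) (F e)"
      using a[of e M] unfolding look_def eval.simps by metis
  qed simp
qed

lemma comp_ifpos:
  assumes P: "comp rep P" and F: "comp rep F" and G: "comp rep G"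
  shows "comp rep (\<lambda>e. if P e > 0 then F e else G e)"
  unfolding comp_def
proof (intro allI impI)
  fix d assume st: "stable d rep"
  obtain cP gP where pP: "pb gP" and rP: "\<And>e M out. rep e M \<Longrightarrow>
    leaves cP gP d M out (P e)"
    by (rule comp_atE[OF P st]) (rule that)
  obtain cF gF where pF: "pb gF" and rF: "\<And>e M out. rep e M \<Longrightarrow>
    leaves cF gF d M out (F e)"
    by (rule comp_atE[OF F st]) (rule that)
  obtain cG gG where pG: "pb gG" and rG: "\<And>e M out. rep e M \<Longrightarrow>
    leaves cG gG d M out (G e)"
    by (rule comp_atE[OF G st]) (rule that)
  let ?E = "Get 1 (Lit (int d))"
  show "comp_at d rep (\<lambda>e. if P e > 0 then F e else G e)"
  proof (rule comp_atI)
    show "pb (\<lambda>x. gP x + (weight ?E + 1 + (gF x + gG x)))" using pP pF pG by (intro pb_intros)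
  next
    fix e M out assume M: "rep e M"
    let ?x = "nat (M 1 0)"
    obtain M1 where 1: "runs cP (M, out) (gP ?x) (M1, out)" "agree d M M1" "M1 1 (int d) = P e"
      using rP[OF M] by blast
    have M1: "rep e M1" by (rule stable_agree[OF st M 1(2)])
    \<comment> \<open>Only one branch runs, but the bound must not depend on which one, so both are
      charged.\<close>
    obtain M2 where 2: "runs (if eval ?E M1 > 0 then cF else cG) (M1, out) (gF ?x + gG ?x) (M2, out)"
      "agree d M1 M2" "M2 1 (int d) = (if P e > 0 then F e else G e)"
    proof (cases "P e > 0")
      case True
      obtain M2 where "runs cF (M1, out) (gF ?x) (M2, out)" "agree d M1 M2" "M2 1 (int d) = F e"
        using rF[OF M1, of out] stable_agree0[OF st 1(2)] by auto
      moreover from this(1) have "runs cF (M1, out) (gF ?x + gG ?x) (M2, out)"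
        by (rule runs_mono) simp
      ultimately show ?thesis using True 1(3) that by simp
    next
      case False
      obtain M2 where "runs cG (M1, out) (gG ?x) (M2, out)" "agree d M1 M2" "M2 1 (int d) = G e"
        using rG[OF M1, of out] stable_agree0[OF st 1(2)] by auto
      moreover from this(1) have "runs cG (M1, out) (gF ?x + gG ?x) (M2, out)"
        by (rule runs_mono) simp
      ultimately show ?thesis using False 1(3) that by simp
    qed
    have "runs (Seq cP (Cond ?E cF cG)) (M, out) (gP ?x + (weight ?E + 1 + (gF ?x + gG ?x))) (M2, out)"
      by (rule runs_Seq[OF 1(1) runs_Cond[OF _ 2(1)]]) simp
    then show "\<exists>M'. runs (Seq cP (Cond ?E cF cG)) (M, out)
        (gP ?x + (weight ?E + 1 + (gF ?x + gG ?x))) (M', out) \<and> agree d M M' \<and>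
        M' 1 (int d) = (if P e > 0 then F e else G e)"
      using agree_trans[OF 1(2) 2(2)] 2(3) by (intro exI[of _ M2] conjI)
  qed
qed

text \<open>Slot \<open>d\<close> holds the partial sum, \<open>d + 1\<close> the index,
  \<open>d + 2\<close> the bound evaluated once in advance, and \<open>d + 3\<close> receives the
  summand. The number of rounds is at most slot 0 because \<open>B e \<le> N e\<close>.\<close>

lemma comp_sum:
  assumes lim: "lim rep N" and B: "comp rep B" and BN: "\<And>e. B e \<le> N e"
    and g: "\<And>d. stable d rep \<Longrightarrow> comp (ext d rep) (\<lambda>e. g (fst e) (snd e))"
  shows "comp rep (\<lambda>e. \<Sum>i\<in>{0..<B e}. g e i)"
  unfolding comp_def
proof (intro allI impI)
  fix d assume st: "stable d rep"
  have st1: "stable (Suc d) rep" and st2: "stable (Suc (Suc d)) rep"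
    using stable_less[OF st] by simp_all
  have st3: "stable (Suc (Suc (Suc d))) (ext (Suc d) rep)"
    by (rule stable_less[OF stable_ext[OF st1]]) simp
  obtain cB gB where pB: "pb gB" and rB: "\<And>e M out. rep e M \<Longrightarrow>
    leaves cB gB (Suc (Suc d)) M out (B e)"
    by (rule comp_atE[OF B st2]) (rule that)
  obtain cg gg where pg: "pb gg" and rg: "\<And>e M out. ext (Suc d) rep e M \<Longrightarrow>
    leaves cg gg (Suc (Suc (Suc d))) M out (g (fst e) (snd e))"
    by (rule comp_atE[OF g[OF st1] st3]) (rule that)
  define S where "S k = Lit (int k)" for k
  define body where "body = Seq cg (Seq (Put 1 (S d) (Plus (Get 1 (S d)) (Get 1 (S (d + 3)))))
      (Put 1 (S (Suc d)) (Plus (Get 1 (S (Suc d))) (Lit 1))))"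
  define test where "test = Minus (Get 1 (S (Suc (Suc d)))) (Get 1 (S (Suc d)))"
  define ka where "ka = int_size (int d) + weight (Plus (Get 1 (S d)) (Get 1 (S (d + 3)))) + 1"
  define kb where "kb = int_size (int (Suc d)) + weight (Plus (Get 1 (S (Suc d))) (Lit 1)) + 1"
  define k0 where "k0 = int_size (int d) + weight (Lit 0) + 1"
  define k1 where "k1 = int_size (int (Suc d)) + weight (Lit 0) + 1"
  show "comp_at d rep (\<lambda>e. \<Sum>i\<in>{0..<B e}. g e i)"
  proof (rule comp_atI)
    show "pb (\<lambda>x. gB x + (k0 + (k1 +
        (loop_cost test (gg x + (ka + kb)) x))))"
      using pB pg by (intro pb_intros)
  next
    fix e M out assume M: "rep e M"
    let ?x = "nat (M 1 0)"
    obtain M1 where 1: "runs cB (M, out) (gB ?x) (M1, out)" "agree (Suc (Suc d)) M M1"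
      "M1 1 (int (Suc (Suc d))) = B e" using rB[OF M] by blast
    define M2 where "M2 = M1(1 := (M1 1)(int d := 0))"
    define M3 where "M3 = M2(1 := (M2 1)(int (Suc d) := 0))"
    have r2: "runs (Put 1 (S d) (Lit 0)) (M1, out) k0 (M2, out)"
      using runs_slot[of "Lit 0" d M1 out] by (simp add: S_def k0_def M2_def)
    have r3: "runs (Put 1 (S (Suc d)) (Lit 0)) (M2, out) k1 (M3, out)"
      using runs_slot[of "Lit 0" "Suc d" M2 out] by (simp add: S_def k1_def M3_def)
    define J where "J i M' out' \<longleftrightarrow> out' = out \<and> agree d M M' \<and> M' 1 (int (Suc (Suc d))) = B e \<and>
      M' 1 (int (Suc d)) = int i \<and> M' 1 (int d) = (\<Sum>j\<in>{0..<int i}. g e j)" for i M' out'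
    let ?n = "nat (B e)"
    have "\<exists>M' out'. runs (While test body) (M3, out)
        (loop_cost test (gg ?x + (ka + kb)) ?n) (M', out') \<and> J ?n M' out'"
    proof (rule runs_for[where J = J and n = ?n])
      show "lin test" by (simp add: test_def S_def)
      show "eval test M' > 0 \<longleftrightarrow> i < ?n" if "J i M' out'" "i \<le> ?n" for i M' out'
        using that by (auto simp: J_def test_def S_def)
      have "agree d M M3"
        using agree_less[OF 1(2), of d] by (auto simp: M2_def M3_def agree_def)
      then show "J 0 M3 out" using 1(3) by (simp add: J_def M2_def M3_def)
    next
      fix i M' out' assume J: "J i M' out'" and i: "i < ?n"
      have ag: "agree d M M'" using J by (simp add: J_def)
      have "rep e M'" using stable_agree[OF st M ag] .
      then have "ext (Suc d) rep (e, int i) M'" using J by (simp add: J_def ext_def)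
      from rg[OF this, of out'] obtain Ma where a: "runs cg (M', out') (gg ?x) (Ma, out')"
        "agree (Suc (Suc (Suc d))) M' Ma" "Ma 1 (int (Suc (Suc (Suc d)))) = g e (int i)"
        using stable_agree0[OF st ag] by auto
      define Mb where "Mb = Ma(1 := (Ma 1)(int d := Ma 1 (int d) + g e (int i)))"
      define Mc where "Mc = Mb(1 := (Mb 1)(int (Suc d) := int (Suc i)))"
      have "Ma 1 (int d) = M' 1 (int d)" "Ma 1 (int (Suc d)) = M' 1 (int (Suc d))"
        "Ma 1 (int (Suc (Suc d))) = M' 1 (int (Suc (Suc d)))"
        using agree_slot[OF a(2), of d] agree_slot[OF a(2), of "Suc d"]
          agree_slot[OF a(2), of "Suc (Suc d)"] by simp_all
      then have Ma: "Ma 1 (int d) = (\<Sum>j\<in>{0..<int i}. g e j)" "Ma 1 (int (Suc d)) = int i"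
        "Ma 1 (int (Suc (Suc d))) = B e"
        using J unfolding J_def by simp_all
      have rb: "runs (Put 1 (S d) (Plus (Get 1 (S d)) (Get 1 (S (d + 3))))) (Ma, out') ka (Mb, out')"
        using runs_slot[of "Plus (Get 1 (S d)) (Get 1 (S (d + 3)))" d Ma out'] a(3)
        by (simp add: S_def ka_def Mb_def numeral_3_eq_3)
      have rc: "runs (Put 1 (S (Suc d)) (Plus (Get 1 (S (Suc d))) (Lit 1))) (Mb, out') kb (Mc, out')"
        using runs_slot[of "Plus (Get 1 (S (Suc d))) (Lit 1)" "Suc d" Mb out'] Ma
        by (simp add: S_def kb_def Mc_def Mb_def add.commute)
      have "agree d M Mc"
        using agree_trans[OF ag agree_less[OF a(2), of d]] by (auto simp: Mb_def Mc_def agree_def)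
      moreover have "(\<Sum>j\<in>{0..<int (Suc i)}. g e j) = (\<Sum>j\<in>{0..<int i}. g e j) + g e (int i)"
      proof -
        have "{0..<int (Suc i)} = insert (int i) {0..<int i}" by auto
        then show ?thesis by simp
      qed
      ultimately have "J (Suc i) Mc out'"
        using J Ma by (simp add: J_def Mc_def Mb_def)
      moreover have "runs body (M', out') (gg ?x + (ka + kb)) (Mc, out')"
        unfolding body_def by (rule runs_Seq[OF a(1) runs_Seq[OF rb rc]])
      ultimately show "\<exists>M'' out''. runs body (M', out') (gg ?x + (ka + kb)) (M'', out'') \<and> J (Suc i) M'' out''"
        by (intro exI conjI)
    qed
    then obtain M4 out' where 4: "runs (While test body) (M3, out)
        (loop_cost test (gg ?x + (ka + kb)) ?n) (M4, out')" "J ?n M4 out'"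
      by blast
    have "out' = out" using 4(2) by (simp add: J_def)
    note 4 = 4[unfolded this]
    have "?n \<le> ?x" using lim BN[of e] M by (auto simp: lim_def intro: nat_mono)
    then have n: "loop_cost test (gg ?x + (ka + kb)) ?n
        \<le> loop_cost test (gg ?x + (ka + kb)) ?x"
      by (intro add_le_mono mult_le_mono order_refl)
    have "{0..<int ?n} = {0..<B e}" by auto
    then have "agree d M M4" "M4 1 (int d) = (\<Sum>i\<in>{0..<B e}. g e i)"
      using 4(2) by (simp_all add: J_def)
    moreover note runs_Seq[OF 1(1) runs_Seq[OF r2 runs_Seq[OF r3 runs_mono[OF 4(1) n]]]]
    ultimately show "\<exists>M'. runs (Seq cB (Seq (Put 1 (S d) (Lit 0)) (Seq (Put 1 (S (Suc d)) (Lit 0)) (While test body))))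
        (M, out) (gB ?x + (k0 + (k1 + (loop_cost test (gg ?x + (ka + kb)) ?x))))
        (M', out) \<and> agree d M M' \<and> M' 1 (int d) = (\<Sum>i\<in>{0..<B e}. g e i)"
      by (intro exI[of _ M4] conjI)
  qed
qed

text \<open>A memory that represents \<open>e\<close> also represents \<open>e\<close> extended by
  whatever slot \<open>d\<close> contains. Hence stability of the extended representation passes to
  \<open>rep\<close>, and the same program works.\<close>

lemma comp_weak:
  assumes "comp rep F"
  shows "comp (ext d rep) (\<lambda>e. F (fst e))"
  unfolding comp_def
proof (intro allI impI)
  fix d' assume st: "stable d' (ext d rep)"
  have "stable d' rep"
    unfolding stable_def
  proof (intro conjI allI impI)
    show "0 < d'" using st by (simp add: stable_def)
  next
    fix e M M' assume "rep e M" "agree d' M M'"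
    then have "ext d rep (e, M 1 (int d)) M'"
      using stable_agree[OF st, of "(e, M 1 (int d))" M M'] by (simp add: ext_def)
    then show "rep e M'" by (simp add: ext_def)
  qed
  then obtain c g where "pb g" and c: "\<And>e M out. rep e M \<Longrightarrow>
    leaves c g d' M out (F e)"
    by (rule comp_atE[OF assms]) (rule that)
  from \<open>pb g\<close> show "comp_at d' (ext d rep) (\<lambda>e. F (fst e))"
  proof (rule comp_atI)
    fix e M out assume "ext d rep e M"
    then have "rep (fst e) M" by (simp add: ext_def)
    then show "leaves c g d' M out (F (fst e))" by (rule c)
  qed
qed

section \<open>Decidable predicates and bounded quantifiers\<close>

definition compb :: "'e rep \<Rightarrow> ('e \<Rightarrow> bool) \<Rightarrow> bool" where
  "compb rep P \<longleftrightarrow> comp rep (\<lambda>e. of_bool (P e))"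

lemma comp_of_bool: "compb rep P \<Longrightarrow> comp rep (\<lambda>e. of_bool (P e))"
  by (simp add: compb_def)

lemma compb_pos:
  assumes "comp rep F" "\<And>e. P e \<longleftrightarrow> F e > 0"
  shows "compb rep P"
proof -
  have "comp rep (\<lambda>e. if F e > 0 then 1 else 0)"
    by (intro comp_ifpos comp_const assms)
  then show ?thesis by (simp add: compb_def of_bool_def assms(2))
qed

lemma comp_if:
  assumes "compb rep P" "comp rep F" "comp rep G"
  shows "comp rep (\<lambda>e. if P e then F e else G e)"
  using comp_ifpos[OF assms(1)[unfolded compb_def] assms(2,3)] by simp

lemma compb_less: "comp rep F \<Longrightarrow> comp rep G \<Longrightarrow> compb rep (\<lambda>e. F e < G e)"
  by (rule compb_pos[OF comp_diff[of rep G F]]) auto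

lemma compb_le: "comp rep F \<Longrightarrow> comp rep G \<Longrightarrow> compb rep (\<lambda>e. F e \<le> G e)"
  by (rule compb_pos[OF comp_add[OF comp_diff[of rep G F] comp_const[of rep 1]]]) auto

lemma compb_conj: "compb rep P \<Longrightarrow> compb rep Q \<Longrightarrow> compb rep (\<lambda>e. P e \<and> Q e)"
  by (rule compb_pos[OF comp_if[OF _ comp_of_bool comp_const[of rep 0], of P Q]]) auto

lemma compb_disj: "compb rep P \<Longrightarrow> compb rep Q \<Longrightarrow> compb rep (\<lambda>e. P e \<or> Q e)"
  by (rule compb_pos[OF comp_if[OF _ comp_const[of rep 1] comp_of_bool, of P Q]]) auto

lemma compb_not: "compb rep P \<Longrightarrow> compb rep (\<lambda>e. \<not> P e)"
  by (rule compb_pos[OF comp_if[OF _ comp_const[of rep 0] comp_const[of rep 1], of P]]) auto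

lemma compb_imp: "compb rep P \<Longrightarrow> compb rep Q \<Longrightarrow> compb rep (\<lambda>e. P e \<longrightarrow> Q e)"
  by (rule compb_pos[OF comp_if[OF _ comp_of_bool comp_const[of rep 1], of P Q]]) auto

lemma compb_eq: "comp rep F \<Longrightarrow> comp rep G \<Longrightarrow> compb rep (\<lambda>e. F e = G e)"
  using compb_conj[OF compb_le compb_le, of rep F G G F] by (simp add: eq_iff)

lemma comp_min: "comp rep F \<Longrightarrow> comp rep G \<Longrightarrow> comp rep (\<lambda>e. min (F e) (G e))"
  using comp_if[OF compb_le, of rep F G F G] by (simp add: min_def)

lemma compb_bex:
  assumes "lim rep N" "comp rep B" "\<And>e. B e \<le> N e"
    and "\<And>d. stable d rep \<Longrightarrow> compb (ext d rep) (\<lambda>e. P (fst e) (snd e))"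
  shows "compb rep (\<lambda>e. \<exists>i\<in>{0..<B e}. P e i)"
proof (rule compb_pos)
  show "comp rep (\<lambda>e. \<Sum>i\<in>{0..<B e}. of_bool (P e i))"
    using assms by (intro comp_sum comp_of_bool) (assumption | blast)+
  show "(\<exists>i\<in>{0..<B e}. P e i) \<longleftrightarrow> 0 < (\<Sum>i\<in>{0..<B e}. of_bool (P e i) :: int)" for e
  proof
    assume "\<exists>i\<in>{0..<B e}. P e i"
    then obtain i where "i \<in> {0..<B e}" "P e i" by blast
    then show "0 < (\<Sum>i\<in>{0..<B e}. of_bool (P e i) :: int)" by (intro sum_pos2[of _ i]) simp_all
  next
    assume "0 < (\<Sum>i\<in>{0..<B e}. of_bool (P e i) :: int)"
    then show "\<exists>i\<in>{0..<B e}. P e i" by (rule contrapos_pp) simp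
  qed
qed

lemma compb_ball:
  assumes "lim rep N" "comp rep B" "\<And>e. B e \<le> N e"
    and "\<And>d. stable d rep \<Longrightarrow> compb (ext d rep) (\<lambda>e. P (fst e) (snd e))"
  shows "compb rep (\<lambda>e. \<forall>i\<in>{0..<B e}. P e i)"
  using compb_not[OF compb_bex[OF assms(1-3), of "\<lambda>e i. \<not> P e i", OF compb_not[OF assms(4)]]] by simp

text \<open>
  Products and quotients as sums; the identities below need the operands to lie within the bound \<open>N\<close>.
\<close>

definition tms :: "int \<Rightarrow> int \<Rightarrow> int \<Rightarrow> int" where
  "tms N x y = (\<Sum>i\<in>{0..<N}. if i < x then y else 0)"

definition tdiv :: "int \<Rightarrow> int \<Rightarrow> int \<Rightarrow> int" where
  "tdiv N u g = (\<Sum>i\<in>{0..<N}. of_bool (tms N g (i + 1) \<le> u))"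

lemma tms_eq:
  assumes "0 \<le> x" "x \<le> N"
  shows "tms N x y = x * y"
proof -
  have "tms N x y = (\<Sum>i\<in>{0..<x}. y)"
    unfolding tms_def by (rule sum.mono_neutral_cong_right) (use assms in auto)
  then show ?thesis using assms by simp
qed

lemma tdiv_eq:
  assumes "0 \<le> u" "u \<le> N" "0 < g" "g \<le> N"
  shows "tdiv N u g = u div g"
proof -
  \<comment> \<open>The quotient is the number of positive multiples of \<open>g\<close> up to
    \<open>u\<close>; with \<open>i\<close> from 0, the factor is \<open>i + 1\<close>.\<close>
  have le: "g * (i + 1) \<le> u \<longleftrightarrow> i < u div g" for i
  proof
    assume "g * (i + 1) \<le> u"
    from zdiv_mono1[OF this assms(3)] assms(3) show "i < u div g" by simp
  next
    assume "i < u div g"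
    then have "g * (i + 1) \<le> g * (u div g)" using assms(3) by (intro mult_left_mono) auto
    also have "\<dots> \<le> u" using assms(3) by (simp add: minus_mod_eq_mult_div[symmetric])
    finally show "g * (i + 1) \<le> u" .
  qed
  have N: "u div g \<le> N"
    using assms div_by_1[of u] zdiv_mono2[of u 1 g] by simp
  have "tdiv N u g = (\<Sum>i\<in>{0..<N}. of_bool (i < u div g))"
    unfolding tdiv_def using assms(3,4) by (simp add: tms_eq le)
  also have "\<dots> = (\<Sum>i\<in>{0..<u div g}. 1)"
    by (rule sum.mono_neutral_cong_right) (use N in auto)
  also have "\<dots> = u div g" using assms by (simp add: pos_imp_zdiv_nonneg_iff)
  finally show ?thesis .
qed

lemma comp_tms:
  assumes lim: "lim rep N" and X: "comp rep X" and Y: "comp rep Y"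
  shows "comp rep (\<lambda>e. tms (N e) (X e) (Y e))"
  unfolding tms_def
  by (rule comp_sum[OF lim comp_scal[OF scal_lim[OF lim]] order_refl])
    (intro comp_if compb_less comp_weak[OF X] comp_weak[OF Y] comp_const comp_scal scal_snd)

lemma comp_tdiv:
  assumes lim: "lim rep N" and X: "comp rep X" and Y: "comp rep Y"
  shows "comp rep (\<lambda>e. tdiv (N e) (X e) (Y e))"
  unfolding tdiv_def
  by (rule comp_sum[OF lim comp_scal[OF scal_lim[OF lim]] order_refl])
    (intro comp_of_bool compb_le comp_tms[OF lim_ext[OF lim]] comp_add comp_weak[OF X] comp_weak[OF Y]
      comp_const comp_scal scal_snd)

lemma comp_mult:
  assumes lim: "lim rep N" and X: "comp rep X" and Y: "comp rep Y" and "\<And>e. 0 \<le> X e \<and> X e \<le> N e"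
  shows "comp rep (\<lambda>e. X e * Y e)"
  using comp_tms[OF lim X Y] assms(4) by (simp add: tms_eq)

text \<open>The exponent is a constant of the program, so the power unrolls into \<open>k\<close>
  products. \<open>X\<close> is always the left factor, the one that must stay within
  \<open>N\<close>.\<close>

lemma comp_power:
  assumes lim: "lim rep N" and X: "comp rep X" and "\<And>e. 0 \<le> X e \<and> X e \<le> N e"
  shows "comp rep (\<lambda>e. X e ^ k)"
  by (induction k) (use comp_const[of rep 1] comp_mult[OF lim X _ assms(3)] in simp_all)

section \<open>Computing tables\<close>

primrec fill :: "(table \<Rightarrow> int \<Rightarrow> int) \<Rightarrow> nat \<Rightarrow> int \<Rightarrow> int" where
  "fill G 0 = (\<lambda>_. 0)"
| "fill G (Suc k) = (fill G k)(int k := G (fill G k) (int k))"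

text \<open>The table of length \<open>N\<close> computed by course-of-values recursion; it is 0 outside.\<close>

definition memo :: "int \<Rightarrow> (table \<Rightarrow> int \<Rightarrow> int) \<Rightarrow> int \<Rightarrow> int" where
  "memo N G = fill G (nat N)"

lemma fill_outside: "\<not> (0 \<le> u \<and> u < int k) \<Longrightarrow> fill G k u = 0"
  by (induction k) auto

lemma fill_stable: "u < int k \<Longrightarrow> k \<le> k' \<Longrightarrow> fill G k' u = fill G k u"
  by (induction k') (auto simp: le_Suc_eq)

lemma memo_outside: "\<not> (0 \<le> u \<and> u < N) \<Longrightarrow> memo N G u = 0"
  unfolding memo_def by (rule fill_outside) auto

text \<open>When entry \<open>u\<close> is computed, exactly the entries below \<open>u\<close> have
  been written and all others are still 0; a written entry never changes.\<close>

lemma memo_rec: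
  assumes "0 \<le> u" "u < N"
  shows "memo N G u = G (\<lambda>v. if 0 \<le> v \<and> v < u then memo N G v else 0) u"
proof -
  have "fill G (nat u) = (\<lambda>v. if 0 \<le> v \<and> v < u then memo N G v else 0)"
    using assms fill_outside[of _ "nat u" G] fill_stable[of _ "nat u" "nat N" G]
    by (auto simp: memo_def fun_eq_iff)
  moreover have "memo N G u = fill G (Suc (nat u)) u"
    unfolding memo_def using assms by (intro fill_stable) auto
  ultimately show ?thesis using assms by simp
qed

lemma memo_nonrec: "0 \<le> u \<Longrightarrow> u < N \<Longrightarrow> memo N (\<lambda>t. g) u = g u"
  by (subst memo_rec) simp_all

text \<open>Table number \<open>a\<close> is kept in array \<open>arr a\<close>; this avoids the stack and puts the input first.\<close>

definition arr :: "nat \<Rightarrow> nat" where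
  "arr a = (if a = 0 then 0 else Suc a)"

text \<open>Arrays past the listed tables are required to be 0 because the next table is built in
  the first of them, and \<open>fill G 0\<close> is the zero table.\<close>

definition rp :: "('i \<Rightarrow> int) \<Rightarrow> ('i \<Rightarrow> int \<Rightarrow> int) list \<Rightarrow> 'i \<Rightarrow> memory \<Rightarrow> bool" where
  "rp N Ts x M \<longleftrightarrow> M 1 0 = N x \<and> (\<forall>a < length Ts. M (arr a) = (Ts ! a) x) \<and>
     (\<forall>a \<ge> length Ts. M (arr a) = (\<lambda>_. 0))"

lemma arr_neq: "arr a \<noteq> 1"
  by (simp add: arr_def)

lemma arr_eq_iff: "arr a = arr b \<longleftrightarrow> a = b"
  by (simp add: arr_def)

lemma stable_rp: "stable 1 (rp N Ts)"
  using arr_neq by (simp add: stable_def rp_def agree_def)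

lemma lim_rp: "lim (rp N Ts) N"
  by (simp add: lim_def rp_def)

lemma tabl_rp:
  assumes "T \<in> set Ts"
  shows "tabl (rp N Ts) T"
proof -
  from assms obtain a where "a < length Ts" "Ts ! a = T" by (auto simp: in_set_conv_nth)
  then show ?thesis
    unfolding tabl_def using arr_neq by (intro exI[of _ "arr a"]) (auto simp: rp_def)
qed

lemma rp_snoc:
  "rp N (Ts @ [\<lambda>_. t]) x M \<longleftrightarrow> M 1 0 = N x \<and> (\<forall>a < length Ts. M (arr a) = (Ts ! a) x) \<and>
     M (arr (length Ts)) = t \<and> (\<forall>a > length Ts. M (arr a) = (\<lambda>_. 0))"
proof -
  have "(\<forall>a < length (Ts @ [\<lambda>_. t]). M (arr a) = ((Ts @ [\<lambda>_. t]) ! a) x) \<longleftrightarrow>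
      (\<forall>a < length Ts. M (arr a) = (Ts ! a) x) \<and> M (arr (length Ts)) = t"
    by (auto simp: nth_append less_Suc_eq)
  then show ?thesis by (simp add: rp_def Suc_le_eq)
qed

lemma rp_snoc_cong: "T x = t \<Longrightarrow> rp N (Ts @ [T]) x = rp N (Ts @ [\<lambda>_. t]) x"
  by (auto simp: rp_def fun_eq_iff nth_append less_Suc_eq)

text \<open>While a table is being filled, its current contents are part of the instance.\<close>

definition under :: "('i \<Rightarrow> int) \<Rightarrow> ('i \<Rightarrow> int \<Rightarrow> int) list \<Rightarrow>
    ('i \<times> table) \<times> int \<Rightarrow> memory \<Rightarrow> bool" where
  "under N Ts = ext 1 (rp (\<lambda>y. N (fst y)) (map (\<lambda>T y. T (fst y)) Ts @ [snd]))"

lemma stable_under: "stable 2 (under N Ts)"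
  unfolding under_def using stable_ext[OF stable_rp] by (simp add: numeral_2_eq_2)

lemma lim_under: "lim (under N Ts) (\<lambda>e. N (fst (fst e)))"
  unfolding under_def by (rule lim_ext[OF lim_rp])

lemma tabl_under: "T \<in> set Ts \<Longrightarrow> tabl (under N Ts) (\<lambda>e. T (fst (fst e)))"
  unfolding under_def by (rule tabl_ext[OF tabl_rp]) auto

lemma tabl_under_self: "tabl (under N Ts) (\<lambda>e. snd (fst e))"
  unfolding under_def by (rule tabl_ext[OF tabl_rp]) auto

lemma scal_under: "scal (under N Ts) snd"
  unfolding under_def by (rule scal_snd)

section \<open>Programs that build a list of tables\<close>

abbreviation prepares :: "('i \<Rightarrow> int list) \<Rightarrow> prog \<Rightarrow> (nat \<Rightarrow> nat) \<Rightarrow> ('i \<Rightarrow> int) \<Rightarrow> ('i \<Rightarrow> table) list \<Rightarrow>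
    'i \<Rightarrow> bool" where
  "prepares enc c g N Ts x \<equiv>
     \<exists>M. runs c (input_memory (enc x), []) (g (nat (N x))) (M, []) \<and> rp N Ts x M"

definition ready :: "'i set \<Rightarrow> ('i \<Rightarrow> int list) \<Rightarrow> ('i \<Rightarrow> int) \<Rightarrow> ('i \<Rightarrow> int \<Rightarrow> int) list \<Rightarrow> bool" where
  "ready I enc N Ts \<longleftrightarrow> (\<exists>c g. pb g \<and> (\<forall>x\<in>I. prepares enc c g N Ts x))"

lemma readyE:
  assumes "ready I enc N Ts"
  obtains c g where "pb g" "\<And>x. x \<in> I \<Longrightarrow> prepares enc c g N Ts x"
  using assms unfolding ready_def by blast

lemma readyI:
  assumes "pb g" "\<And>x. x \<in> I \<Longrightarrow> prepares enc c g N Ts x"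
  shows "ready I enc N Ts"
  using assms unfolding ready_def by blast

lemma rp_slot: "rp N Ts x M \<Longrightarrow> i \<noteq> 0 \<Longrightarrow> rp N Ts x (M(1 := (M 1)(i := v)))"
  using arr_neq by (simp add: rp_def)

text \<open>A loop over the index in slot 1: the program for \<open>G\<close> runs at depth 2 on the
  unfinished table, and its value is stored at that index. After \<open>i\<close> rounds the new
  array is \<open>fill (G x) i\<close>.\<close>

lemma ready_table:
  assumes rdy: "ready I enc N Ts"
    and G: "comp (under N Ts) (\<lambda>e. G (fst (fst e)) (snd (fst e)) (snd e))"
  shows "ready I enc N (Ts @ [\<lambda>x. memo (N x) (G x)])"
proof -
  obtain c0 g0 where p0: "pb g0" and r0: "\<And>x. x \<in> I \<Longrightarrow> prepares enc c0 g0 N Ts x"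
    by (rule readyE[OF rdy]) (rule that)
  obtain cG gG where pG: "pb gG" and rG: "\<And>e M out. under N Ts e M \<Longrightarrow>
    leaves cG gG 2 M out (G (fst (fst e)) (snd (fst e)) (snd e))"
    by (rule comp_atE[OF G stable_under]) (rule that)
  let ?a = "arr (length Ts)"
  define slot where "slot k = Get 1 (Lit k)" for k
  define store where "store = Put ?a (slot 1) (slot 2)"
  define incr where "incr = Put 1 (Lit 1) (Plus (slot 1) (Lit 1))"
  define test where "test = Minus (slot 0) (slot 1)"
  define ks where "ks = weight (slot 1) + weight (slot 2) + 1"
  define ki where "ki = weight (Lit 1) + weight (Plus (slot 1) (Lit 1)) + 1"
  define k1 where "k1 = weight (Lit 1) + weight (Lit 0) + 1"
  show ?thesis
  proof (rule readyI)
    show "pb (\<lambda>n. g0 n + (k1 + (loop_cost test (gG n + (ks + ki)) n)))"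
      using p0 pG by (intro pb_intros)
  next
    fix x assume x: "x \<in> I"
    let ?n = "nat (N x)"
    obtain M0 where M0: "runs c0 (input_memory (enc x), []) (g0 ?n) (M0, [])" "rp N Ts x M0"
      using r0[OF x] by blast
    define M1 where "M1 = M0(1 := (M0 1)(1 := 0))"
    have r1: "runs (Put 1 (Lit 1) (Lit 0)) (M0, []) k1 (M1, [])"
      using runs_Put[of "Lit 1" "Lit 0" 1 M0 "[]"] by (simp add: k1_def M1_def)
    define J where "J i M out \<longleftrightarrow> out = [] \<and> rp N (Ts @ [\<lambda>_. fill (G x) i]) x M \<and> M 1 1 = int i"
      for i M and out :: "int list"
    have "\<exists>M out. runs (While test (Seq cG (Seq store incr))) (M1, [])
        (loop_cost test (gG ?n + (ks + ki)) ?n) (M, out) \<and> J ?n M out"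
    proof (rule runs_for[where J = J and n = ?n])
      show "lin test" by (simp add: test_def slot_def)
      show "eval test M > 0 \<longleftrightarrow> i < ?n" if "J i M out" for i M out
        using that by (auto simp: J_def test_def slot_def rp_def)
      have "rp N Ts x M1" unfolding M1_def by (rule rp_slot[OF M0(2)]) simp
      moreover have "M1 1 1 = 0" by (simp add: M1_def)
      ultimately show "J 0 M1 []" by (simp add: J_def rp_snoc) (simp add: rp_def)
    next
      fix i M out assume J: "J i M out" and "i < ?n"
      have [simp]: "out = []" using J by (simp add: J_def)
      let ?t = "fill (G x) i"
      have rpM: "rp N (Ts @ [\<lambda>_. ?t]) x M" using J by (simp add: J_def)
      then have "rp (\<lambda>y. N (fst y)) (map (\<lambda>T y. T (fst y)) Ts @ [snd]) (x, ?t) M"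
        by (simp add: rp_snoc_cong[of snd "(x, ?t)" ?t] rp_snoc)
      then have "under N Ts ((x, ?t), int i) M"
        using J by (simp add: under_def ext_def J_def)
      from rG[OF this, of "[]"] obtain Ma where "runs cG (M, []) (gG (nat (M 1 0))) (Ma, [])"
        and a: "agree 2 M Ma" "Ma 1 2 = G x ?t (int i)" by auto
      moreover have "M 1 0 = N x" using rpM by (simp add: rp_def)
      ultimately have ra: "runs cG (M, []) (gG ?n) (Ma, [])" by simp
      have Ma1: "Ma 1 1 = int i" using agree_slot[OF a(1), of 1] J by (simp add: J_def)
      have rpa: "rp N (Ts @ [\<lambda>_. ?t]) x Ma"
        using stable_agree[OF stable_less[OF stable_rp] rpM a(1)] by simp
      define Mb where "Mb = Ma(?a := fill (G x) (Suc i))"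
      have rb: "runs store (Ma, []) ks (Mb, [])"
        using runs_Put[of "slot 1" "slot 2" ?a Ma "[]"] a(2) Ma1 rpa
        by (simp add: store_def ks_def Mb_def slot_def rp_snoc)
      have rpb: "rp N (Ts @ [\<lambda>_. fill (G x) (Suc i)]) x Mb"
        using rpa arr_neq[of "length Ts"] arr_eq_iff unfolding rp_snoc Mb_def
        by (auto simp del: fill.simps)
      have "Mb 1 1 = int i" using Ma1 arr_neq[of "length Ts"] by (auto simp: Mb_def)
      define Mc where "Mc = Mb(1 := (Mb 1)(1 := int (Suc i)))"
      have rc: "runs incr (Mb, []) ki (Mc, [])"
        using runs_Put[of "Lit 1" "Plus (slot 1) (Lit 1)" 1 Mb "[]"] \<open>Mb 1 1 = int i\<close>
        by (simp add: incr_def ki_def Mc_def slot_def add.commute)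
      have "J (Suc i) Mc []"
        unfolding J_def Mc_def using rp_slot[OF rpb, of 1 "int (Suc i)"] by (simp del: fill.simps)
      with runs_Seq[OF ra runs_Seq[OF rb rc]]
      show "\<exists>M' out'. runs (Seq cG (Seq store incr)) (M, out) (gG ?n + (ks + ki)) (M', out') \<and>
          J (Suc i) M' out'"
        by (intro exI[of _ Mc] exI[of _ "[]"] conjI) simp_all
    qed
    then obtain M out where 2: "runs (While test (Seq cG (Seq store incr))) (M1, [])
        (loop_cost test (gG ?n + (ks + ki)) ?n) (M, out)"
      and J: "J ?n M out" by blast
    have [simp]: "out = []" using J by (simp add: J_def)
    have "rp N (Ts @ [\<lambda>x. memo (N x) (G x)]) x M"
      using J unfolding J_def memo_def by (subst rp_snoc_cong[where t = "fill (G x) ?n"]) simp_all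
    with runs_Seq[OF M0(1) runs_Seq[OF r1 2]]
    show "\<exists>M. runs (Seq c0 (Seq (Put 1 (Lit 1) (Lit 0)) (While test (Seq cG (Seq store incr)))))
        (input_memory (enc x), []) (g0 ?n + (k1 + (?n * ((gG ?n + (ks + ki)) + (weight test + 1)) +
        (weight test + 1)))) (M, []) \<and> rp N (Ts @ [\<lambda>x. memo (N x) (G x)]) x M"
      by (intro exI[of _ M] conjI) simp_all
  qed
qed

lemma poly_nat_mono: "x \<le> y \<Longrightarrow> poly p x \<le> poly p y" for p :: "nat poly"
  by (induction p) (auto intro!: add_mono mult_mono)

text \<open>Polynomials over \<open>nat\<close> are monotone, so raising slot 0 from
  \<open>N\<close> to a larger computable \<open>F\<close> keeps earlier costs polynomial in slot 0
  and makes longer loops and tables available.\<close>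

lemma ready_bound:
  assumes rdy: "ready I enc N Ts" and F: "comp (rp N Ts) F" and le: "\<And>x. x \<in> I \<Longrightarrow> N x \<le> F x"
  shows "ready I enc F Ts"
proof -
  obtain c0 g0 where p0: "pb g0" and r0: "\<And>x. x \<in> I \<Longrightarrow> prepares enc c0 g0 N Ts x"
    by (rule readyE[OF rdy]) (rule that)
  obtain c g where p: "pb g" and r: "\<And>e M out. rp N Ts e M \<Longrightarrow>
    leaves c g 1 M out (F e)"
    by (rule comp_atE[OF F stable_rp]) (rule that)
  let ?k = "weight (Lit 0) + weight (Get 1 (Lit 1)) + 1"
  have "pb (\<lambda>n. g0 n + (g n + ?k))" using p0 p by (intro pb_intros)
  then obtain q :: "nat poly" where q: "\<And>n. g0 n + (g n + ?k) \<le> poly q n" unfolding pb_def by blast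
  show ?thesis
  proof (rule readyI)
    show "pb (poly q)" by (rule pb_poly)
  next
    fix x assume x: "x \<in> I"
    obtain M0 where M0: "runs c0 (input_memory (enc x), []) (g0 (nat (N x))) (M0, [])" "rp N Ts x M0"
      using r0[OF x] by blast
    obtain M1 where "runs c (M0, []) (g (nat (M0 1 0))) (M1, [])" and 1: "agree 1 M0 M1" "M1 1 (int 1) = F x"
      using r[OF M0(2)] by blast
    moreover have "M0 1 0 = N x" using M0(2) by (simp add: rp_def)
    ultimately have r1: "runs c (M0, []) (g (nat (N x))) (M1, [])" by simp
    have rp1: "rp N Ts x M1" by (rule stable_agree[OF stable_rp M0(2) 1(1)])
    define M2 where "M2 = M1(1 := (M1 1)(0 := F x))"
    have r2: "runs (Put 1 (Lit 0) (Get 1 (Lit 1))) (M1, []) ?k (M2, [])"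
      using runs_Put[of "Lit 0" "Get 1 (Lit 1)" 1 M1 "[]"] 1(2) by (simp add: M2_def)
    have "g0 (nat (N x)) + (g (nat (N x)) + ?k) \<le> poly q (nat (F x))"
      using q[of "nat (N x)"] poly_nat_mono[OF nat_mono[OF le[OF x]], of q] by linarith
    from runs_mono[OF runs_Seq[OF M0(1) runs_Seq[OF r1 r2]] this]
    have "runs (Seq c0 (Seq c (Put 1 (Lit 0) (Get 1 (Lit 1))))) (input_memory (enc x), [])
        (poly q (nat (F x))) (M2, [])" .
    moreover have "rp F Ts x M2" using rp1 arr_neq by (simp add: rp_def M2_def)
    ultimately show "\<exists>M. runs (Seq c0 (Seq c (Put 1 (Lit 0) (Get 1 (Lit 1))))) (input_memory (enc x), [])
        (poly q (nat (F x))) (M, []) \<and> rp F Ts x M"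
      by (intro exI conjI)
  qed
qed

lemma ready_input:
  assumes "lin E" "\<And>x. x \<in> I \<Longrightarrow> eval E (input_memory (enc x)) = N x"
  shows "ready I enc N [\<lambda>x. input_memory (enc x) 0]"
proof (rule readyI)
  let ?k = "weight (Lit 0) + weight E + 1"
  show "pb (\<lambda>_. ?k)" by (rule pb_const)
  fix x assume x: "x \<in> I"
  let ?M = "input_memory (enc x)"
  have "rp N [\<lambda>x. input_memory (enc x) 0] x (?M(1 := (?M 1)(0 := N x)))"
    by (auto simp: rp_def arr_def input_memory_def fun_eq_iff)
  moreover have "runs (Put 1 (Lit 0) E) (?M, []) ?k (?M(1 := (?M 1)(0 := N x)), [])"
    using runs_Put[of "Lit 0" E 1 ?M "[]"] assms(1) assms(2)[OF x] by simp
  ultimately show "\<exists>M. runs (Put 1 (Lit 0) E) (?M, []) ?k (M, []) \<and>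
      rp N [\<lambda>x. input_memory (enc x) 0] x M"
    by (intro exI conjI)
qed

text \<open>A product can be computed once its left factor is within the current bound, so the bound
  is squared repeatedly; this is why exponents have the form \<open>2 ^ k\<close>.\<close>

lemma ready_power:
  assumes "ready I enc N Ts" "\<And>x. 1 \<le> N x"
  shows "ready I enc (\<lambda>x. N x ^ (2 ^ k)) Ts"
proof (induction k)
  case 0
  then show ?case using assms(1) by simp
next
  case (Suc k)
  let ?N = "\<lambda>x. N x ^ (2 ^ k)"
  have 1: "1 \<le> ?N x" for x using assms(2)[of x] by (rule one_le_power)
  have "comp (rp ?N Ts) (\<lambda>x. ?N x * ?N x)"
    using 1 by (intro comp_mult[OF lim_rp] comp_scal scal_lim[OF lim_rp]) (smt (verit))
  then have "ready I enc (\<lambda>x. ?N x * ?N x) Ts"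
    by (rule ready_bound[OF Suc]) (use 1 in \<open>simp add: mult_le_cancel_left1\<close>)
  then show ?case by (simp only: power_Suc mult_2 power_add)
qed

lemma poly_time_solvableI:
  fixes q :: "nat poly"
  assumes rdy: "ready I enc N Ts" and T: "T \<in> set Ts" and len: "comp (rp N Ts) len"
    and lenN: "\<And>x. x \<in> I \<Longrightarrow> len x \<le> N x"
    and q: "\<And>x. x \<in> I \<Longrightarrow> nat (N x) \<le> poly q (isize x)"
    and bd: "\<And>x. x \<in> I \<Longrightarrow> mem_bd (isize x) (input_memory (enc x))"
    and sol: "\<And>x. x \<in> I \<Longrightarrow> sol x (map (\<lambda>i. T x (int i)) [0..<nat (len x)])"
  shows "poly_time_solvable I enc isize sol"
proof -
  obtain c0 g0 where p0: "pb g0" and r0: "\<And>x. x \<in> I \<Longrightarrow> prepares enc c0 g0 N Ts x"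
    by (rule readyE[OF rdy]) (rule that)
  obtain c g where p: "pb g" and r: "\<And>e M out. rp N Ts e M \<Longrightarrow>
    leaves c g 1 M out (len e)"
    by (rule comp_atE[OF len stable_rp]) (rule that)
  obtain a where a: "a \<noteq> 1 \<and> (\<forall>e M. rp N Ts e M \<longrightarrow> M a = T e)"
    using tabl_rp[OF T] unfolding tabl_def by (rule exE)
  define slot where "slot k = Get 1 (Lit k)" for k
  define test where "test = Minus (slot 1) (slot 2)"
  define incr where "incr = Put 1 (Lit 2) (Plus (slot 2) (Lit 1))"
  define kw where "kw = weight (Get a (slot 2)) + 1"
  define ki where "ki = weight (Lit 2) + weight (Plus (slot 2) (Lit 1)) + 1"
  define k1 where "k1 = weight (Lit 2) + weight (Lit 0) + 1"
  define body where "body = Seq (Write (Get a (slot 2))) incr"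
  define C where "C = Seq c0 (Seq c (Seq (Put 1 (Lit 2) (Lit 0)) (While test body)))"
  define B where "B n = g0 n + (g n + (k1 + (loop_cost test (kw + ki) n)))" for n
  have "pb B" unfolding B_def using p0 p by (intro pb_intros)
  then obtain s :: "nat poly" where s: "\<And>n. B n \<le> poly s n" unfolding pb_def by blast
  have main: "\<exists>M. runs C (input_memory (enc x), []) (B (nat (N x))) (M, map (\<lambda>i. T x (int i)) [0..<nat (len x)])"
    if x: "x \<in> I" for x
  proof -
    let ?n = "nat (len x)"
    obtain M0 where M0: "runs c0 (input_memory (enc x), []) (g0 (nat (N x))) (M0, [])" "rp N Ts x M0"
      using r0[OF x] by blast
    obtain M1 where "runs c (M0, []) (g (nat (M0 1 0))) (M1, [])" and 1: "agree 1 M0 M1" "M1 1 (int 1) = len x"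
      using r[OF M0(2)] by blast
    moreover have "M0 1 0 = N x" using M0(2) by (simp add: rp_def)
    ultimately have r1: "runs c (M0, []) (g (nat (N x))) (M1, [])" by simp
    have rp1: "rp N Ts x M1" by (rule stable_agree[OF stable_rp M0(2) 1(1)])
    define M2 where "M2 = M1(1 := (M1 1)(2 := 0))"
    have r2: "runs (Put 1 (Lit 2) (Lit 0)) (M1, []) k1 (M2, [])"
      using runs_Put[of "Lit 2" "Lit 0" 1 M1 "[]"] by (simp add: M2_def k1_def)
    define J where "J i M out \<longleftrightarrow> rp N Ts x M \<and> M 1 1 = len x \<and> M 1 2 = int i \<and>
      out = map (\<lambda>i. T x (int i)) [0..<i]" for i M out
    have "\<exists>M out. runs (While test body) (M2, [])
        (loop_cost test (kw + ki) ?n) (M, out) \<and> J ?n M out"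
    proof (rule runs_for[where J = J and n = ?n])
      show "lin test" by (simp add: test_def slot_def)
      show "eval test M > 0 \<longleftrightarrow> i < ?n" if "J i M out" for i M out
        using that by (auto simp: J_def test_def slot_def)
      show "J 0 M2 []" using rp_slot[OF rp1, of 2 0] 1(2) by (simp add: J_def M2_def)
    next
      fix i M out assume J: "J i M out"
      have "rp N Ts x M" using J by (simp add: J_def)
      then have "M a = T x" by (rule a[THEN conjunct2, rule_format])
      then have e: "eval (Get a (slot 2)) M = T x (int i)" using J by (simp add: J_def slot_def)
      have rw: "runs (Write (Get a (slot 2))) (M, out) kw (M, out @ [T x (int i)])"
        using runs_Write[of "Get a (slot 2)" M out] unfolding e by (simp add: kw_def slot_def)
      define M' where "M' = M(1 := (M 1)(2 := int (Suc i)))"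
      have ri: "runs incr (M, out @ [T x (int i)]) ki (M', out @ [T x (int i)])"
        using runs_Put[of "Lit 2" "Plus (slot 2) (Lit 1)" 1 M "out @ [T x (int i)]"] J
        by (simp add: incr_def ki_def M'_def slot_def J_def add.commute)
      have "J (Suc i) M' (out @ [T x (int i)])"
        using J rp_slot[of N Ts x M 2 "int (Suc i)"] by (simp add: J_def M'_def)
      with runs_Seq[OF rw ri]
      show "\<exists>M' out'. runs body (M, out) (kw + ki) (M', out') \<and> J (Suc i) M' out'"
        unfolding body_def by (intro exI conjI)
    qed
    then obtain M out where 3: "runs (While test body) (M2, [])
        (loop_cost test (kw + ki) ?n) (M, out)" and J: "J ?n M out" by blast
    have out: "out = map (\<lambda>i. T x (int i)) [0..<?n]" using J by (simp add: J_def)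
    have "?n \<le> nat (N x)" using lenN[OF x] by (rule nat_mono)
    then have "loop_cost test (kw + ki) ?n
        \<le> loop_cost test (kw + ki) (nat (N x))"
      by (intro add_le_mono mult_le_mono order_refl)
    from runs_Seq[OF M0(1) runs_Seq[OF r1 runs_Seq[OF r2 runs_mono[OF 3 this]]]]
    show ?thesis unfolding C_def B_def out by (intro exI)
  qed
  \<comment> \<open>The time bound built into \<open>runs\<close>, with \<open>L\<close> the size
    and the weight bounded by \<open>s\<close> applied to \<open>N\<close>, which \<open>q\<close>
    bounds in terms of the size.\<close>
  define p where "p = [:3:] * (pcompose s q) * ([:0, 1:] + pcompose s q + [:1:])"
  show ?thesis
    unfolding poly_time_solvable_def
  proof (intro exI[of _ C] exI[of _ p] ballI)
    fix x assume x: "x \<in> I"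
    let ?out = "map (\<lambda>i. T x (int i)) [0..<nat (len x)]"
    obtain M where M: "runs C (input_memory (enc x), []) (B (nat (N x))) (M, ?out)"
      using main[OF x] by blast
    then obtain t where t: "exec C (input_memory (enc x), []) t (M, ?out)"
      "t \<le> 3 * B (nat (N x)) * (isize x + B (nat (N x)) + 1)"
      using bd[OF x] unfolding runs_def fst_conv by blast
    have "B (nat (N x)) \<le> poly s (poly q (isize x))"
      using s[of "nat (N x)"] poly_nat_mono[OF q[OF x], of s] by linarith
    then have "3 * B (nat (N x)) * (isize x + B (nat (N x)) + 1)
        \<le> 3 * poly s (poly q (isize x)) * (isize x + poly s (poly q (isize x)) + 1)"
      by (intro mult_le_mono add_le_mono order_refl)
    also have "\<dots> = poly p (isize x)" by (simp add: p_def poly_pcompose)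
    finally have "t \<le> poly p (isize x)" using t(2) by linarith
    with t(1) sol[OF x] show "\<exists>t M out. exec C (input_memory (enc x), []) t (M, out) \<and>
        t \<le> poly p (isize x) \<and> sol x out" by blast
  qed
qed

lemmas comp_rules = comp_of_bool compb_conj compb_disj compb_imp compb_not compb_eq compb_less compb_le
  comp_if comp_min comp_add comp_diff comp_look comp_const

section \<open>Cheapest paths\<close>

text \<open>
  Nodes are numbers below \<open>N\<close>. A node \<open>u\<close> is a goal if \<open>gl u = 1\<close>; otherwise one may move to \<open>s1 u\<close> at
  cost \<open>w1 u\<close> or to \<open>s2 u\<close> for free, a negative successor being forbidden. Both successors are
  smaller than \<open>u\<close>, so tables indexed by the nodes can be computed in increasing order: reachability
  of a goal, the least cost, the choice of the first move, and the resulting path from \<open>st 0\<close>.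
\<close>

definition okt :: "int \<Rightarrow> table \<Rightarrow> table \<Rightarrow> table \<Rightarrow> int \<Rightarrow> int" where
  "okt N gl s1 s2 = memo N (\<lambda>t u. of_bool (look gl u = 1 \<or> look t (look s1 u) = 1 \<or> look t (look s2 u) = 1))"

text \<open>Dead ends get no infinite value; instead the reachability table, which is 0 at negative
  numbers, is consulted before costs are compared. The value means something only at nodes from
  which a goal is reachable.\<close>

definition bestt :: "int \<Rightarrow> table \<Rightarrow> table \<Rightarrow> table \<Rightarrow> table \<Rightarrow> table \<Rightarrow>
    int \<Rightarrow> int" where
  "bestt N gl s1 w1 s2 ok = memo N (\<lambda>t u. if look gl u = 1 then 0
     else if look ok (look s1 u) = 1 \<and>
       (look ok (look s2 u) = 1 \<longrightarrow> look w1 u + look t (look s1 u) \<le> look t (look s2 u))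
     then look w1 u + look t (look s1 u) else look t (look s2 u))"

definition taket :: "int \<Rightarrow> table \<Rightarrow> table \<Rightarrow> table \<Rightarrow> table \<Rightarrow> table \<Rightarrow>
    table \<Rightarrow> int \<Rightarrow> int" where
  "taket N gl s1 w1 s2 ok best = memo N (\<lambda>t u. of_bool (\<not> look gl u = 1 \<and> look ok (look s1 u) = 1 \<and>
     (look ok (look s2 u) = 1 \<longrightarrow> look w1 u + look best (look s1 u) \<le> look best (look s2 u))))"

text \<open>Indexed by time. The path waits at a goal, so the entry at \<open>N - 1\<close> shows
  its end no matter when it was reached.\<close>

definition patht :: "int \<Rightarrow> table \<Rightarrow> table \<Rightarrow> table \<Rightarrow> table \<Rightarrow> table \<Rightarrow>
    int \<Rightarrow> int" where
  "patht N gl s1 s2 st tk = memo N (\<lambda>p t. if t = 0 then look st 0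
     else if look gl (look p (t - 1)) = 1 then look p (t - 1)
     else if look tk (look p (t - 1)) = 1 then look s1 (look p (t - 1)) else look s2 (look p (t - 1)))"

lemma ready_paths:
  fixes N GL S1 W1 S2 ST
  defines "OK \<equiv> \<lambda>x. okt (N x) (GL x) (S1 x) (S2 x)"
  defines "BS \<equiv> \<lambda>x. bestt (N x) (GL x) (S1 x) (W1 x) (S2 x) (OK x)"
  defines "TK \<equiv> \<lambda>x. taket (N x) (GL x) (S1 x) (W1 x) (S2 x) (OK x) (BS x)"
  assumes rdy: "ready I enc N Ts" and GL: "GL \<in> set Ts" and S1: "S1 \<in> set Ts" and W1: "W1 \<in> set Ts"
    and S2: "S2 \<in> set Ts" and ST: "ST \<in> set Ts"
  shows "ready I enc N (Ts @ [OK, BS, TK, \<lambda>x. patht (N x) (GL x) (S1 x) (S2 x) (ST x) (TK x)])"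
proof -
  note tabs = GL S1 W1 S2 ST
  have "ready I enc N (Ts @ [OK])"
    unfolding OK_def okt_def using rdy
    by (rule ready_table)
      (rule comp_rules tabl_under tabl_under_self tabs comp_scal scal_under)+
  then have "ready I enc N ((Ts @ [OK]) @ [BS])"
    unfolding BS_def bestt_def
    by (rule ready_table)
      (rule comp_rules tabl_under tabl_under_self comp_scal scal_under | simp add: tabs)+
  then have "ready I enc N (((Ts @ [OK]) @ [BS]) @ [TK])"
    unfolding TK_def taket_def
    by (rule ready_table)
      (rule comp_rules tabl_under tabl_under_self comp_scal scal_under | simp add: tabs)+
  then have "ready I enc N ((((Ts @ [OK]) @ [BS]) @ [TK]) @
      [\<lambda>x. patht (N x) (GL x) (S1 x) (S2 x) (ST x) (TK x)])"
    unfolding patht_def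
    by (rule ready_table)
      (rule comp_rules tabl_under tabl_under_self comp_scal scal_under | simp add: tabs)+
  then show ?thesis by simp
qed

text \<open>For negative \<open>v\<close> both sides are 0, so forbidden successors need no separate
  treatment in the recursions.\<close>

lemma memo_below:
  "v < u \<Longrightarrow> (if 0 \<le> v \<and> v < u then memo N G v else 0) = memo N G v"
  by (simp add: memo_outside)

locale paths =
  fixes N :: int and gl s1 w1 s2 st :: "int \<Rightarrow> int"
  assumes less: "0 \<le> u \<Longrightarrow> u < N \<Longrightarrow> s1 u < u" "0 \<le> u \<Longrightarrow> u < N \<Longrightarrow> s2 u < u"
    and goal: "0 \<le> u \<Longrightarrow> u < N \<Longrightarrow> gl u = 1 \<Longrightarrow> s1 u < 0 \<and> s2 u < 0"
    and start: "0 \<le> st 0" "st 0 < N"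
begin

definition "ok = okt N gl s1 s2"
definition "best = bestt N gl s1 w1 s2 ok"
definition "tk = taket N gl s1 w1 s2 ok best"
definition "path = patht N gl s1 s2 st tk"

definition next_node :: "int \<Rightarrow> int" where
  "next_node u = (if gl u = 1 then u else if tk u = 1 then s1 u else s2 u)"

text \<open>All routes to a goal with their costs: the yardstick for \<open>best\<close>.\<close>

inductive walk :: "int \<Rightarrow> int \<Rightarrow> bool" where
  walk_goal: "0 \<le> u \<Longrightarrow> u < N \<Longrightarrow> gl u = 1 \<Longrightarrow> walk u 0"
| walk_s1: "0 \<le> u \<Longrightarrow> u < N \<Longrightarrow> walk (s1 u) c \<Longrightarrow> walk u (w1 u + c)"
| walk_s2: "0 \<le> u \<Longrightarrow> u < N \<Longrightarrow> walk (s2 u) c \<Longrightarrow> walk u c"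

lemma ok_rec:
  assumes "0 \<le> u" "u < N"
  shows "ok u = of_bool (gl u = 1 \<or> ok (s1 u) = 1 \<or> ok (s2 u) = 1)"
  unfolding ok_def okt_def
  by (subst memo_rec[OF assms]) (simp only: look_def memo_below[OF less(1)[OF assms]] memo_below[OF less(2)[OF assms]])

lemma best_rec:
  assumes "0 \<le> u" "u < N"
  shows "best u = (if gl u = 1 then 0 else if ok (s1 u) = 1 \<and> (ok (s2 u) = 1 \<longrightarrow> w1 u + best (s1 u) \<le> best (s2 u))
    then w1 u + best (s1 u) else best (s2 u))"
  unfolding best_def bestt_def
  by (subst memo_rec[OF assms]) (simp only: look_def memo_below[OF less(1)[OF assms]] memo_below[OF less(2)[OF assms]])

lemma tk_eq:
  assumes "0 \<le> u" "u < N"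
  shows "tk u = of_bool (gl u \<noteq> 1 \<and> ok (s1 u) = 1 \<and> (ok (s2 u) = 1 \<longrightarrow> w1 u + best (s1 u) \<le> best (s2 u)))"
  unfolding tk_def taket_def by (subst memo_nonrec[OF assms]) (simp only: look_def)

lemma ok_outside: "ok u = 1 \<Longrightarrow> 0 \<le> u \<and> u < N"
  using memo_outside[of u N] by (fastforce simp: ok_def okt_def)

lemma walk_best: "walk u c \<Longrightarrow> ok u = 1 \<and> best u \<le> c"
proof (induction rule: walk.induct)
  case (walk_goal u)
  then show ?case by (simp add: ok_rec best_rec)
next
  case (walk_s1 u c)
  \<comment> \<open>A goal has only forbidden successors, so a node with a live successor is no goal
    and its \<open>best\<close> is not the value 0 reserved for goals.\<close>
  then have "gl u \<noteq> 1" using goal[of u] ok_outside[of "s1 u"] by auto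
  then show ?case using walk_s1 by (auto simp: ok_rec[of u] best_rec[of u])
next
  case (walk_s2 u c)
  then have "gl u \<noteq> 1" using goal[of u] ok_outside[of "s2 u"] by auto
  then show ?case using walk_s2 by (auto simp: ok_rec[of u] best_rec[of u])
qed

lemma next_node:
  assumes "ok u = 1" "gl u \<noteq> 1"
  shows "0 \<le> next_node u" "next_node u < u" "ok (next_node u) = 1"
    "best u = (if tk u = 1 then w1 u else 0) + best (next_node u)"
proof -
  have u: "0 \<le> u" "u < N" using ok_outside[OF assms(1)] by simp_all
  have or: "ok (s1 u) = 1 \<or> ok (s2 u) = 1" using assms ok_rec[OF u] by (auto split: if_splits)
  then have n: "ok (next_node u) = 1" using assms(2) by (auto simp: next_node_def tk_eq[OF u])
  then show "0 \<le> next_node u" "ok (next_node u) = 1" using ok_outside by simp_all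
  show "next_node u < u" using less[OF u] assms(2) by (simp add: next_node_def)
  show "best u = (if tk u = 1 then w1 u else 0) + best (next_node u)"
    using or assms(2) by (auto simp: next_node_def tk_eq[OF u] best_rec[OF u])
qed

lemma tk_goal: "gl u = 1 \<Longrightarrow> tk u \<noteq> 1"
  using memo_outside[of u N] memo_nonrec[of u N]
  by (cases "0 \<le> u \<and> u < N") (auto simp: tk_def taket_def look_def)

lemma path_0: "path 0 = st 0"
  using start unfolding path_def patht_def by (subst memo_rec) (simp_all add: look_def)

lemma path_Suc:
  assumes "int (Suc t) < N"
  shows "path (int (Suc t)) = next_node (path (int t))"
  unfolding path_def patht_def next_node_def using assms
  by (subst memo_rec) (simp_all add: look_def)

lemma path_ok: "ok (st 0) = 1 \<Longrightarrow> int t < N \<Longrightarrow> ok (path (int t)) = 1"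
proof (induction t)
  case (Suc t)
  then have "ok (path (int t)) = 1" by simp
  then show ?case
    using next_node(3) path_Suc[of t] Suc.prems by (cases "gl (path (int t)) = 1") (simp_all add: next_node_def)
qed (simp add: path_0)

lemma path_range: "ok (st 0) = 1 \<Longrightarrow> int t < N \<Longrightarrow> 0 \<le> path (int t) \<and> path (int t) < N"
  using path_ok ok_outside by blast

abbreviation spent :: "nat \<Rightarrow> int" where
  "spent t \<equiv> \<Sum>i<t. if tk (path (int i)) = 1 then w1 (path (int i)) else 0"

text \<open>Each move changes \<open>best\<close> by exactly the cost it spends; while the path
  rests at a goal, \<open>tk\<close> is off and nothing is spent.\<close>

lemma path_cost:
  "ok (st 0) = 1 \<Longrightarrow> int t < N \<Longrightarrow>
    best (path (int t)) + spent t = best (st 0)"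
proof (induction t)
  case (Suc t)
  then have IH: "best (path (int t)) + spent t = best (st 0)"
    and "ok (path (int t)) = 1" using path_ok by simp_all
  then show ?case
    using next_node(4)[of "path (int t)"] path_Suc[of t] Suc.prems tk_goal[of "path (int t)"]
    by (cases "gl (path (int t)) = 1") (simp_all add: next_node_def)
qed (simp add: path_0)

text \<open>Nodes drop by at least one per move and start below \<open>N\<close>, so at time
  \<open>N - 1\<close> the path is at a goal or at node 0. A live node 0 is a goal too, having no
  smaller nonnegative successor.\<close>

lemma path_goal:
  assumes "ok (st 0) = 1"
  shows "gl (path (N - 1)) = 1"
proof -
  have "int t < N \<Longrightarrow> gl (path (int t)) = 1 \<or> path (int t) \<le> st 0 - int t" for t
  proof (induction t)
    case (Suc t)
    show ?case
    proof (cases "gl (path (int t)) = 1")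
      case True
      then show ?thesis using path_Suc[of t] Suc.prems by (simp add: next_node_def)
    next
      case False
      then have "path (int t) \<le> st 0 - int t" using Suc by simp
      moreover have "next_node (path (int t)) < path (int t)"
        using next_node(2)[OF path_ok[OF assms] False] Suc.prems by simp
      ultimately show ?thesis using path_Suc[of t] Suc.prems by simp
    qed
  qed (simp add: path_0)
  from this[of "nat (N - 1)"]
  have "gl (path (N - 1)) = 1 \<or> path (N - 1) \<le> 0" using start by auto
  moreover have "0 \<le> path (N - 1)" using path_range[OF assms, of "nat (N - 1)"] start by simp
  ultimately have *: "gl (path (N - 1)) = 1 \<or> path (N - 1) = 0" by auto
  have "ok (path (N - 1)) = 1" using path_ok[OF assms, of "nat (N - 1)"] start by simp
  with * next_node(1,2)[of "path (N - 1)"] show ?thesis by fastforce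
qed

end

section \<open>The greedy construction of Gale and Ryser\<close>

text \<open>Ties are broken by the index, which makes this a strict total order and all ranks
  distinct.\<close>

definition beats :: "(nat \<Rightarrow> int) \<Rightarrow> nat \<Rightarrow> nat \<Rightarrow> bool" where
  "beats \<rho> i i' \<longleftrightarrow> \<rho> i' < \<rho> i \<or> \<rho> i = \<rho> i' \<and> i < i'"

definition tops :: "(nat \<Rightarrow> int) \<Rightarrow> nat \<Rightarrow> int \<Rightarrow> nat set" where
  "tops \<rho> m c = {i. i < m \<and> int (card {i'. i' < m \<and> beats \<rho> i' i}) < c}"

text \<open>The rank of a row, the number of rows beating it, is a bijection of
  \<open>{..<m}\<close>; hence exactly \<open>c\<close> rows have rank below
  \<open>c\<close>.\<close>

lemma card_tops:
  assumes "0 \<le> c" "c \<le> int m"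
  shows "int (card (tops \<rho> m c)) = c"
proof -
  define rank where "rank i = card {i'. i' < m \<and> beats \<rho> i' i}" for i
  have mono: "rank i < rank i'" if "beats \<rho> i i'" "i < m" for i i'
    unfolding rank_def using that by (intro psubset_card_mono) (auto simp: beats_def)
  have inj: "inj_on rank {..<m}"
  proof (rule inj_onI)
    fix i i' assume "i \<in> {..<m}" "i' \<in> {..<m}" "rank i = rank i'"
    moreover have "i \<noteq> i' \<Longrightarrow> beats \<rho> i i' \<or> beats \<rho> i' i" by (auto simp: beats_def)
    ultimately show "i = i'" using mono[of i i'] mono[of i' i] by force
  qed
  have "rank i < m" if "i < m" for i
  proof -
    have "{i'. i' < m \<and> beats \<rho> i' i} \<subset> {..<m}" using that by (auto simp: beats_def)
    from psubset_card_mono[OF _ this] show ?thesis by (simp add: rank_def)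
  qed
  then have "rank ` {..<m} \<subseteq> {..<m}" by auto
  then have img: "rank ` {..<m} = {..<m}"
    using inj by (intro card_subset_eq) (simp_all add: card_image)
  have "rank ` tops \<rho> m c = {..<nat c}"
  proof
    show "rank ` tops \<rho> m c \<subseteq> {..<nat c}" by (auto simp: tops_def rank_def)
    show "{..<nat c} \<subseteq> rank ` tops \<rho> m c"
    proof
      fix q assume q: "q \<in> {..<nat c}"
      then have "q \<in> rank ` {..<m}" using assms img by auto
      then show "q \<in> rank ` tops \<rho> m c" using q by (auto simp: tops_def rank_def)
    qed
  qed
  moreover have "inj_on rank (tops \<rho> m c)" by (rule inj_on_subset[OF inj]) (auto simp: tops_def)
  ultimately have "card (tops \<rho> m c) = nat c" using card_image by fastforce
  then show ?thesis using assms(1) by simp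
qed

lemma tops_le:
  assumes "i \<in> tops \<rho> m c" "i' < m" "i' \<notin> tops \<rho> m c"
  shows "\<rho> i' \<le> \<rho> i"
proof (rule ccontr)
  assume "\<not> \<rho> i' \<le> \<rho> i"
  then have "card {k. k < m \<and> beats \<rho> k i'} \<le> card {k. k < m \<and> beats \<rho> k i}"
    by (intro card_mono) (auto simp: beats_def)
  then show False using assms by (auto simp: tops_def)
qed

text \<open>
  \<open>P q\<close> is the sum of the \<open>q\<close> largest column sums. Filling the smallest of the remaining \<open>Suc k\<close>
  columns by the rows with the largest remaining sums preserves the inequalities of Gale and Ryser.
\<close>

lemma greedy_step:
  fixes \<rho> :: "nat \<Rightarrow> int" and P :: "nat \<Rightarrow> int"
  assumes P0: "P 0 = 0" and c: "c = P (Suc k) - P k" and c0: "0 \<le> c"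
    and small: "\<And>q. q \<le> k \<Longrightarrow> c \<le> P (Suc q) - P q"
    and GR: "\<And>q. q \<le> Suc k \<Longrightarrow> P q \<le> (\<Sum>i<m. min (\<rho> i) (int q))"
    and total: "P (Suc k) = (\<Sum>i<m. \<rho> i)"
  defines "\<rho>' \<equiv> \<lambda>i. \<rho> i - of_bool (i \<in> tops \<rho> m c)"
  assumes nonneg: "\<And>i. i < m \<Longrightarrow> 0 \<le> \<rho> i"
  shows "int (card (tops \<rho> m c)) = c" "\<And>i. i < m \<Longrightarrow> 0 \<le> \<rho>' i"
    "\<And>q. q \<le> k \<Longrightarrow> P q \<le> (\<Sum>i<m. min (\<rho>' i) (int q))" "P k = (\<Sum>i<m. \<rho>' i)"
proof -
  let ?X = "tops \<rho> m c"
  have X: "?X \<subseteq> {..<m}" "finite ?X" by (auto simp: tops_def)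
  \<comment> \<open>The inequality for a single column says that at least \<open>P 1\<close> rows
    are still positive, which suffices for the smallest column sum.\<close>
  have "c \<le> P (Suc 0)" using small[of 0] P0 by simp
  also have "P (Suc 0) \<le> (\<Sum>i<m. min (\<rho> i) (int (Suc 0)))" by (rule GR) simp
  also have "\<dots> = int (card {i. i < m \<and> 0 < \<rho> i})"
  proof -
    have "(\<Sum>i<m. min (\<rho> i) (int (Suc 0))) = (\<Sum>i<m. of_bool (0 < \<rho> i))"
    proof (intro sum.cong refl)
      fix i assume "i \<in> {..<m}"
      then show "min (\<rho> i) (int (Suc 0)) = of_bool (0 < \<rho> i)"
        using nonneg[of i] by (cases "0 < \<rho> i") auto
    qed
    then show ?thesis by (simp add: sum_of_bool_eq Int_def)
  qed
  finally have cpos: "c \<le> int (card {i. i < m \<and> 0 < \<rho> i})" .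
  also have "\<dots> \<le> int (card {..<m})" by (intro of_nat_mono card_mono) auto
  finally have "c \<le> int m" by simp
  then show cX: "int (card ?X) = c" using c0 by (intro card_tops)
  have sumX: "(\<Sum>i<m. of_bool (i \<in> ?X)) = c"
  proof -
    have "{..<m} \<inter> ?X = ?X" using X by auto
    then show ?thesis using cX by (simp add: sum_of_bool_eq Int_def)
  qed
  have many: "int q < \<rho> i" if "c \<le> int (card {i. i < m \<and> int q < \<rho> i})" "i \<in> ?X" for q i
  proof (rule ccontr)
    assume "\<not> int q < \<rho> i"
    then have "{i. i < m \<and> int q < \<rho> i} \<subset> ?X" using tops_le[OF that(2)] that(2) by fastforce
    from psubset_card_mono[OF X(2) this] that(1) cX show False by simp
  qed
  have few: "\<rho> i' \<le> int q" if "int (card {i. i < m \<and> int q < \<rho> i}) < c" "i' < m" "i' \<notin> ?X" for q i'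
  proof -
    have "\<not> ?X \<subseteq> {i. i < m \<and> int q < \<rho> i}"
    proof
      assume "?X \<subseteq> {i. i < m \<and> int q < \<rho> i}"
      then have "card ?X \<le> card {i. i < m \<and> int q < \<rho> i}" by (intro card_mono) auto
      then show False using that(1) cX by simp
    qed
    then obtain i where "i \<in> ?X" "\<rho> i \<le> int q" using X(1) by (auto simp: subset_iff not_less)
    then show ?thesis using tops_le[OF _ that(2,3)] by fastforce
  qed
  show "0 \<le> \<rho>' i" if "i < m" for i
    using nonneg[OF that] many[of 0 i] cpos by (auto simp: \<rho>'_def)
  show "P k = (\<Sum>i<m. \<rho>' i)" using total c sumX by (simp add: \<rho>'_def sum_subtractf)
  show "P q \<le> (\<Sum>i<m. min (\<rho>' i) (int q))" if q: "q \<le> k" for q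
  \<comment> \<open>Either all chosen rows exceed \<open>q\<close>, and decreasing them does not
    affect the minimum with \<open>q\<close>; or all rows exceeding \<open>q\<close> are chosen, and
    the inequality for \<open>Suc q\<close> loses \<open>c\<close> on the right and at least
    \<open>c\<close> on the left.\<close>
  proof (cases "c \<le> int (card {i. i < m \<and> int q < \<rho> i})")
    case True
    have "(\<Sum>i<m. min (\<rho>' i) (int q)) = (\<Sum>i<m. min (\<rho> i) (int q))"
      using many[OF True] by (intro sum.cong) (auto simp: \<rho>'_def)
    then show ?thesis using GR[of q] q by simp
  next
    case False
    have "(\<Sum>i<m. min (\<rho>' i) (int q)) = (\<Sum>i<m. min (\<rho> i) (int (Suc q)) - of_bool (i \<in> ?X))"
    proof (intro sum.cong refl)
      fix i assume "i \<in> {..<m}"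
      then show "min (\<rho>' i) (int q) = min (\<rho> i) (int (Suc q)) - of_bool (i \<in> ?X)"
        using few[of q i] False by (auto simp: \<rho>'_def min_def)
    qed
    also have "\<dots> = (\<Sum>i<m. min (\<rho> i) (int (Suc q))) - c" using sumX by (simp add: sum_subtractf)
    finally show ?thesis using GR[of "Suc q"] small[OF q] q by simp
  qed
qed

lemma sum_drop_first:
  fixes c :: "nat \<Rightarrow> int"
  assumes "q \<le> n"
  shows "(\<Sum>j<q. c (n - 1 - j)) = (\<Sum>j<n. c j) - (\<Sum>j<n - q. c j)"
  using assms
proof (induction q)
  case (Suc q)
  then have "n - q = Suc (n - Suc q)" by simp
  then have "(\<Sum>j<n - q. c j) = (\<Sum>j<n - Suc q. c j) + c (n - Suc q)" by simp
  moreover have "n - 1 - q = n - Suc q" by simp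
  ultimately show ?case using Suc by simp
qed simp

text \<open>The sufficiency half of Gale-Ryser: the greedy step is iterated over columns of
  non-decreasing sums, so the last \<open>q\<close> columns form \<open>P q\<close>. In the end the
  remaining row sums are nonnegative with total \<open>P 0 = 0\<close>, so all rows are used
  up.\<close>

theorem greedy_matrix:
  fixes \<mu> :: "nat \<Rightarrow> nat \<Rightarrow> int" and r c :: "nat \<Rightarrow> int"
  defines "rem \<equiv> \<lambda>j i. r i - (\<Sum>l<j. \<mu> l i)"
  assumes \<mu>: "\<And>j i. j < n \<Longrightarrow> i < m \<Longrightarrow> \<mu> j i = of_bool (i \<in> tops (rem j) m (c j))"
    and r: "\<And>i. i < m \<Longrightarrow> 0 \<le> r i" and c0: "\<And>j. j < n \<Longrightarrow> 0 \<le> c j"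
    and mono: "\<And>j j'. j \<le> j' \<Longrightarrow> j' < n \<Longrightarrow> c j \<le> c j'"
    and GR: "\<And>q. q \<le> n \<Longrightarrow> (\<Sum>j<n. c j) - (\<Sum>j<n - q. c j) \<le> (\<Sum>i<m. min (r i) (int q))"
    and total: "(\<Sum>j<n. c j) = (\<Sum>i<m. r i)"
  shows "\<And>i. i < m \<Longrightarrow> (\<Sum>j<n. \<mu> j i) = r i" "\<And>j. j < n \<Longrightarrow> (\<Sum>i<m. \<mu> j i) = c j"
proof -
  define P where "P q = (\<Sum>j<q. c (n - 1 - j))" for q
  have P_eq: "q \<le> n \<Longrightarrow> P q = (\<Sum>j<n. c j) - (\<Sum>j<n - q. c j)" for q
    unfolding P_def by (rule sum_drop_first)
  have inv: "j \<le> n \<Longrightarrow> (\<forall>i<m. 0 \<le> rem j i) \<and> (\<forall>q\<le>n - j. P q \<le> (\<Sum>i<m. min (rem j i) (int q))) \<and>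
      P (n - j) = (\<Sum>i<m. rem j i) \<and> (\<forall>j'<j. (\<Sum>i<m. \<mu> j' i) = c j')" for j
  proof (induction j)
    case 0
    then show ?case using r GR total by (simp add: rem_def P_eq)
  next
    case (Suc j)
    then have j: "j < n" "n - j = Suc (n - Suc j)" by simp_all
    have IH: "\<And>i. i < m \<Longrightarrow> 0 \<le> rem j i" "\<And>q. q \<le> n - j \<Longrightarrow> P q \<le> (\<Sum>i<m. min (rem j i) (int q))"
      "P (n - j) = (\<Sum>i<m. rem j i)" "\<forall>j'<j. (\<Sum>i<m. \<mu> j' i) = c j'"
      using Suc by simp_all
    have "n - 1 - (n - Suc j) = j" using j(1) by simp
    then have cj: "c j = P (Suc (n - Suc j)) - P (n - Suc j)" by (simp add: P_def)
    have small: "c j \<le> P (Suc q) - P q" if "q \<le> n - Suc j" for q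
    proof -
      have "j \<le> n - 1 - q" "n - 1 - q < n" using that j(1) by auto
      then show ?thesis using mono[of j "n - 1 - q"] by (simp add: P_def)
    qed
    have P0: "P 0 = 0" by (simp add: P_def)
    note st = greedy_step[OF P0 cj c0[OF j(1)] small, where \<rho> = "rem j" and m = m,
      unfolded j(2)[symmetric], OF _ IH(2,3,1)]
    have rem_Suc: "rem (Suc j) i = rem j i - of_bool (i \<in> tops (rem j) m (c j))" if "i < m" for i
      using \<mu>[OF j(1) that] by (simp add: rem_def)
    have "(\<Sum>i<m. \<mu> j i) = (\<Sum>i<m. of_bool (i \<in> tops (rem j) m (c j)))"
      using \<mu>[OF j(1)] by (intro sum.cong) auto
    also have "\<dots> = int (card ({..<m} \<inter> tops (rem j) m (c j)))" by (simp add: sum_of_bool_eq Int_def)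
    also have "{..<m} \<inter> tops (rem j) m (c j) = tops (rem j) m (c j)" by (auto simp: tops_def)
    also have "int (card \<dots>) = c j" by (rule st(1)) auto
    finally have "\<forall>j'<Suc j. (\<Sum>i<m. \<mu> j' i) = c j'" using IH(4) by (auto simp: less_Suc_eq)
    moreover have "\<forall>i<m. 0 \<le> rem (Suc j) i" using st(2) rem_Suc by auto
    moreover have "P q \<le> (\<Sum>i<m. min (rem (Suc j) i) (int q))" if "q \<le> n - Suc j" for q
      using st(3)[OF _ _ _ that] rem_Suc by simp
    moreover have "P (n - Suc j) = (\<Sum>i<m. rem (Suc j) i)"
      using st(4) rem_Suc by simp
    ultimately show ?case by blast
  qed
  show "(\<Sum>i<m. \<mu> j i) = c j" if "j < n" for j using inv[of n] that by simp
  have nonneg: "0 \<le> rem n i" if "i < m" for i using inv[of n] that by simp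
  have "(\<Sum>i<m. rem n i) = 0" using inv[of n] by (simp add: P_def)
  then have "\<forall>i\<in>{..<m}. rem n i = 0" using nonneg by (subst (asm) sum_nonneg_eq_0_iff) auto
  then show "(\<Sum>j<n. \<mu> j i) = r i" if "i < m" for i using that by (simp add: rem_def)
qed

section \<open>Identical functions\<close>

text \<open>
  Tables are determined by the bound \<open>N\<close>, the input and the table \<open>b\<close>, which stores at index 0 a base
  exceeding all digits of a node.
\<close>

definition divt :: "int \<Rightarrow> table \<Rightarrow> int \<Rightarrow> int" where
  "divt N b = memo N (\<lambda>t u. tdiv N u (look b 0))"

definition modt :: "int \<Rightarrow> table \<Rightarrow> int \<Rightarrow> int" where
  "modt N b = memo N (\<lambda>t u. u - look b 0 * look (divt N b) u)"

definition secondt :: "int \<Rightarrow> table \<Rightarrow> int \<Rightarrow> int" where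
  "secondt N b = memo N (\<lambda>t u. look (modt N b) (look (divt N b) u))"

definition highert :: "int \<Rightarrow> table \<Rightarrow> int \<Rightarrow> int" where
  "highert N b = memo N (\<lambda>t u. look (divt N b) (look (divt N b) u))"

text \<open>
  A node with digits \<open>w\<close>, \<open>k\<close>, \<open>s\<close> means: the columns are assigned non-decreasing sums, none below
  \<open>m - w\<close> from now on, \<open>k\<close> columns are left and \<open>s\<close> is the total of their sums.
\<close>

definition rowt :: "int \<Rightarrow> table \<Rightarrow> int \<Rightarrow> int" where
  "rowt N inp = memo N (\<lambda>t k. \<Sum>i\<in>{0..<look inp 0}. min (look inp (2 + i)) k)"

text \<open>All columns are chosen. On the computed path the total is then used up as well: taken
  columns keep \<open>s\<close> within the row bound for the columns left, which is 0 for
  none.\<close>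

definition goal1 :: "int \<Rightarrow> table \<Rightarrow> int \<Rightarrow> int" where
  "goal1 N b = memo N (\<lambda>t u. of_bool (look (secondt N b) u = 0))"

text \<open>Gives the next column the sum \<open>v = m - w\<close>. The columns left are the largest
  ones, so their total \<open>s - v\<close> has to obey the Gale-Ryser inequality for
  \<open>k - 1\<close>. The test \<open>w \<le> m\<close> keeps \<open>v\<close> nonnegative at
  numbers that are no proper nodes, so that moves always lead downwards.\<close>

definition take1 :: "int \<Rightarrow> table \<Rightarrow> table \<Rightarrow> int \<Rightarrow> int" where
  "take1 N inp b = memo N (\<lambda>t u.
     if 0 < look (secondt N b) u \<and> look (highert N b) u \<le> look inp 0 \<and>
       look inp 0 - look (highert N b) u \<le> look (modt N b) u \<and>
       look (modt N b) u - (look inp 0 - look (highert N b) u) \<le> look (rowt N inp) (look (secondt N b) u - 1)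
     then u - look b 0 - (look inp 0 - look (highert N b) u) else -1)"

definition cost1 :: "int \<Rightarrow> table \<Rightarrow> table \<Rightarrow> int \<Rightarrow> int" where
  "cost1 N inp b = memo N (\<lambda>t u. look inp (2 + look inp 0 + (look inp 0 - look (highert N b) u)))"

text \<open>Raises the lower bound \<open>m - w\<close> by one. Storing \<open>w\<close> instead of
  the bound itself makes this a move to a smaller number.\<close>

definition skip1 :: "int \<Rightarrow> table \<Rightarrow> int \<Rightarrow> int" where
  "skip1 N b = memo N (\<lambda>t u.
     if 0 < look (secondt N b) u \<and> 0 < look (highert N b) u then u - look b 0 * look b 0 else -1)"

definition start1 :: "int \<Rightarrow> table \<Rightarrow> table \<Rightarrow> int \<Rightarrow> int" where
  "start1 N inp b = memo N (\<lambda>t u.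
     look b 0 * (look b 0 * look inp 0 + look inp 1) + look (rowt N inp) (look inp 1))"

abbreviation ok1 :: "int \<Rightarrow> table \<Rightarrow> table \<Rightarrow> int \<Rightarrow> int" where
  "ok1 N inp b \<equiv> okt N (goal1 N b) (take1 N inp b) (skip1 N b)"

abbreviation best1 :: "int \<Rightarrow> table \<Rightarrow> table \<Rightarrow> int \<Rightarrow> int" where
  "best1 N inp b \<equiv> bestt N (goal1 N b) (take1 N inp b) (cost1 N inp b) (skip1 N b) (ok1 N inp b)"

abbreviation tk1 :: "int \<Rightarrow> table \<Rightarrow> table \<Rightarrow> int \<Rightarrow> int" where
  "tk1 N inp b \<equiv>
     taket N (goal1 N b) (take1 N inp b) (cost1 N inp b) (skip1 N b) (ok1 N inp b) (best1 N inp b)"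

abbreviation path1 :: "int \<Rightarrow> table \<Rightarrow> table \<Rightarrow> int \<Rightarrow> int" where
  "path1 N inp b \<equiv>
     patht N (goal1 N b) (take1 N inp b) (skip1 N b) (start1 N inp b) (tk1 N inp b)"

text \<open>The columns are filled from the last to the first, column \<open>n - 1 - j\<close> in round \<open>j\<close>.\<close>

definition col1 :: "int \<Rightarrow> table \<Rightarrow> table \<Rightarrow> int \<Rightarrow> int" where
  "col1 N inp b = memo N (\<lambda>t j. \<Sum>i\<in>{0..<N}.
     if look (tk1 N inp b) (look (path1 N inp b) i) = 1 \<and>
       look (secondt N b) (look (path1 N inp b) i) = look inp 1 - j
     then look inp 0 - look (highert N b) (look (path1 N inp b) i) else 0)"

abbreviation rem1 :: "table \<Rightarrow> table \<Rightarrow> table \<Rightarrow> int \<Rightarrow> int \<Rightarrow> int" where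
  "rem1 inp b t j i \<equiv>
     look inp (2 + i) - (\<Sum>l\<in>{0..<look inp 1}. if l < j then look t (look b 0 * l + i) else 0)"

text \<open>Index \<open>B * j + i\<close> belongs to row \<open>i\<close> in round
  \<open>j\<close>, with \<open>B\<close> the stored base: the rank of the row by remaining sum is
  compared with the column sum. As \<open>B\<close> exceeds \<open>m\<close>, bits of earlier rounds
  have smaller indices and are present in the unfinished table \<open>t\<close>.\<close>

definition mat1 :: "int \<Rightarrow> table \<Rightarrow> table \<Rightarrow> int \<Rightarrow> int" where
  "mat1 N inp b = memo N (\<lambda>t u. of_bool ((\<Sum>i\<in>{0..<look inp 0}. of_bool (
       rem1 inp b t (look (divt N b) u) (look (modt N b) u) < rem1 inp b t (look (divt N b) u) i \<or>
       rem1 inp b t (look (divt N b) u) i = rem1 inp b t (look (divt N b) u) (look (modt N b) u) \<and>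
         i < look (modt N b) u))
     < look (col1 N inp b) (look (divt N b) u)))"

text \<open>Position \<open>p\<close> of the row-by-row output is row \<open>p div n\<close> and
  column \<open>p mod n\<close>; the column is converted to its round.\<close>

definition out1 :: "int \<Rightarrow> table \<Rightarrow> table \<Rightarrow> int \<Rightarrow> int" where
  "out1 N inp b = memo N (\<lambda>t p. look (mat1 N inp b)
     (look b 0 * (look inp 1 - 1 - (p - look inp 1 * tdiv N p (look inp 1))) + tdiv N p (look inp 1)))"

lemmas under_rules = lim_ext lim_under tabl_ext tabl_under_self
  comp_scal scal_snd scal_under scal_ext scal_lim[OF lim_under] order_refl

text \<open>With a set in place of a list, positions do not matter and auxiliary tables can be
  forgotten.\<close>

definition avail :: "'i set \<Rightarrow> ('i \<Rightarrow> int list) \<Rightarrow> ('i \<Rightarrow> int) \<Rightarrow> ('i \<Rightarrow> int \<Rightarrow> int) set \<Rightarrow> bool" where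
  "avail I enc N S \<longleftrightarrow> (\<exists>Ts. ready I enc N Ts \<and> S \<subseteq> set Ts)"

lemma avail_table:
  assumes "avail I enc N S"
    and "\<And>Ts. S \<subseteq> set Ts \<Longrightarrow> comp (under N Ts) (\<lambda>e. G (fst (fst e)) (snd (fst e)) (snd e))"
  shows "avail I enc N (insert (\<lambda>x. memo (N x) (G x)) S)"
proof -
  from assms(1) obtain Ts where Ts: "ready I enc N Ts" "S \<subseteq> set Ts" unfolding avail_def by blast
  have "ready I enc N (Ts @ [\<lambda>x. memo (N x) (G x)])"
    using Ts(1) assms(2)[OF Ts(2)] by (rule ready_table)
  moreover have "insert (\<lambda>x. memo (N x) (G x)) S \<subseteq> set (Ts @ [\<lambda>x. memo (N x) (G x)])"
    using Ts(2) by auto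
  ultimately show ?thesis unfolding avail_def by (intro exI conjI)
qed

lemma avail_subset: "avail I enc N S \<Longrightarrow> S' \<subseteq> S \<Longrightarrow> avail I enc N S'"
  unfolding avail_def by (meson subset_trans)

lemma avail_paths:
  assumes "avail I enc N S" and "GL \<in> S" "S1 \<in> S" "W1 \<in> S" "S2 \<in> S" "ST \<in> S"
  defines "OK \<equiv> \<lambda>x. okt (N x) (GL x) (S1 x) (S2 x)"
  defines "BS \<equiv> \<lambda>x. bestt (N x) (GL x) (S1 x) (W1 x) (S2 x) (OK x)"
  defines "TK \<equiv> \<lambda>x. taket (N x) (GL x) (S1 x) (W1 x) (S2 x) (OK x) (BS x)"
  shows "avail I enc N (insert (\<lambda>x. patht (N x) (GL x) (S1 x) (S2 x) (ST x) (TK x)) (insert TK S))"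
proof -
  from assms(1) obtain Ts where Ts: "ready I enc N Ts" "S \<subseteq> set Ts" unfolding avail_def by blast
  have "ready I enc N (Ts @ [OK, BS, TK, \<lambda>x. patht (N x) (GL x) (S1 x) (S2 x) (ST x) (TK x)])"
    unfolding OK_def BS_def TK_def using assms(2-6) Ts(2) by (intro ready_paths[OF Ts(1)]) auto
  then show ?thesis unfolding avail_def using Ts(2) by (rule_tac exI conjI | assumption | auto)+
qed

lemma avail_digits:
  assumes "avail I enc N S" and BT: "BT \<in> S"
    and b: "\<And>x. 0 \<le> look (BT x) 0 \<and> look (BT x) 0 \<le> N x"
  shows "avail I enc N ({\<lambda>x. divt (N x) (BT x), \<lambda>x. modt (N x) (BT x),
    \<lambda>x. secondt (N x) (BT x), \<lambda>x. highert (N x) (BT x)} \<union> S)"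
proof -
  note rules = comp_mult comp_tdiv comp_rules under_rules b tabl_under
  let ?A1 = "insert (\<lambda>x. divt (N x) (BT x)) S"
  let ?A2 = "insert (\<lambda>x. modt (N x) (BT x)) ?A1"
  let ?A3 = "insert (\<lambda>x. secondt (N x) (BT x)) ?A2"
  let ?A4 = "insert (\<lambda>x. highert (N x) (BT x)) ?A3"
  note assms(1)
  then have "avail I enc N ?A1"
    unfolding divt_def by (rule avail_table) (rule rules | (erule subsetD, simp add: BT; fail))+
  then have "avail I enc N ?A2"
    unfolding modt_def by (rule avail_table) (rule rules | (erule subsetD, simp add: BT; fail))+
  then have "avail I enc N ?A3"
    unfolding secondt_def by (rule avail_table) (rule rules | (erule subsetD, simp add: BT; fail))+
  then have "avail I enc N ?A4"
    unfolding highert_def by (rule avail_table) (rule rules | (erule subsetD, simp add: BT; fail))+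
  then show ?thesis by (rule avail_subset) auto
qed

lemma avail_case1:
  assumes "avail I enc N {IN, BT}"
    and b: "\<And>x. 0 \<le> look (BT x) 0 \<and> look (BT x) 0 \<le> N x"
    and m: "\<And>x. look (IN x) 0 \<le> N x" and n: "\<And>x. 0 \<le> look (IN x) 1 \<and> look (IN x) 1 \<le> N x"
  shows "avail I enc N {IN, \<lambda>x. out1 (N x) (IN x) (BT x)}"
proof -
  have n': "look (IN x) 1 \<le> N x" for x using n by blast
  note rules = comp_sum comp_mult comp_tdiv comp_rules under_rules b m n n' tabl_under
  let ?S = "{\<lambda>x. divt (N x) (BT x), \<lambda>x. modt (N x) (BT x), \<lambda>x. secondt (N x) (BT x),
    \<lambda>x. highert (N x) (BT x)} \<union> {IN, BT}"
  let ?A1 = "insert (\<lambda>x. rowt (N x) (IN x)) ?S"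
  let ?A2 = "insert (\<lambda>x. goal1 (N x) (BT x)) ?A1"
  let ?A3 = "insert (\<lambda>x. take1 (N x) (IN x) (BT x)) ?A2"
  let ?A4 = "insert (\<lambda>x. cost1 (N x) (IN x) (BT x)) ?A3"
  let ?A5 = "insert (\<lambda>x. skip1 (N x) (BT x)) ?A4"
  let ?A6 = "insert (\<lambda>x. start1 (N x) (IN x) (BT x)) ?A5"
  let ?B = "insert (\<lambda>x. path1 (N x) (IN x) (BT x)) (insert (\<lambda>x. tk1 (N x) (IN x) (BT x)) ?A6)"
  let ?C1 = "insert (\<lambda>x. col1 (N x) (IN x) (BT x)) ?B"
  let ?C2 = "insert (\<lambda>x. mat1 (N x) (IN x) (BT x)) ?C1"
  let ?C3 = "insert (\<lambda>x. out1 (N x) (IN x) (BT x)) ?C2"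
  have "avail I enc N ?S"
    using assms(1) _ b by (rule avail_digits) simp
  then have "avail I enc N ?A1"
    unfolding rowt_def by (rule avail_table) (rule rules | (erule subsetD, simp; fail))+
  then have "avail I enc N ?A2"
    unfolding goal1_def by (rule avail_table) (rule rules | (erule subsetD, simp; fail))+
  then have "avail I enc N ?A3"
    unfolding take1_def by (rule avail_table) (rule rules | (erule subsetD, simp; fail))+
  then have "avail I enc N ?A4"
    unfolding cost1_def by (rule avail_table) (rule rules | (erule subsetD, simp; fail))+
  then have "avail I enc N ?A5"
    unfolding skip1_def by (rule avail_table) (rule rules | (erule subsetD, simp; fail))+
  then have "avail I enc N ?A6"
    unfolding start1_def by (rule avail_table) (rule rules | (erule subsetD, simp; fail))+
  then have "avail I enc N ?B"
    by (rule avail_paths) simp_all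
  then have "avail I enc N ?C1"
    unfolding col1_def by (rule avail_table) (rule rules | (erule subsetD, simp; fail))+
  then have "avail I enc N ?C2"
    unfolding mat1_def by (rule avail_table) (rule rules | (erule subsetD, simp; fail))+
  then have "avail I enc N ?C3"
    unfolding out1_def by (rule avail_table) (rule rules | (erule subsetD, simp; fail))+
  then show ?thesis by (rule avail_subset) auto
qed

lemma sum_int: "(\<Sum>i\<in>{0..<int k}. g i) = (\<Sum>i<k. g (int i))"
proof (induction k)
  case (Suc k)
  have "{0..<int (Suc k)} = insert (int k) {0..<int k}" by auto
  then show ?case using Suc by (simp add: add.commute)
qed simp

section \<open>Nodes as numbers in base \<open>B\<close>\<close>

locale base =
  fixes N B :: int and b :: "int \<Rightarrow> int"
  assumes b: "b 0 = B" and B: "1 < B" and BN: "B * B * B \<le> N"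
begin

lemma BN': "B < N" "B * B < N"
proof -
  have "B * 1 < B * B" "B * B * 1 < B * B * B" using B by (intro mult_strict_left_mono; simp)+
  then show "B < N" "B * B < N" using BN by linarith+
qed

lemma divt: "0 \<le> u \<Longrightarrow> u < N \<Longrightarrow> divt N b u = u div B"
  using BN' B unfolding divt_def by (subst memo_nonrec) (simp_all add: look_def b tdiv_eq)

lemma div_range: "0 \<le> u \<Longrightarrow> u < N \<Longrightarrow> 0 \<le> u div B \<and> u div B < N"
  using B zdiv_mono2[of u 1 B] by (auto simp: pos_imp_zdiv_nonneg_iff)

lemma modt: "0 \<le> u \<Longrightarrow> u < N \<Longrightarrow> modt N b u = u mod B"
  unfolding modt_def by (subst memo_nonrec) (simp_all add: look_def b divt minus_mult_div_eq_mod)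

lemma secondt: "0 \<le> u \<Longrightarrow> u < N \<Longrightarrow> secondt N b u = u div B mod B"
  unfolding secondt_def using div_range[of u] by (subst memo_nonrec) (simp_all add: look_def divt modt)

lemma highert: "0 \<le> u \<Longrightarrow> u < N \<Longrightarrow> highert N b u = u div B div B"
  unfolding highert_def using div_range[of u] by (subst memo_nonrec) (simp_all add: look_def divt)

definition node :: "int \<Rightarrow> int \<Rightarrow> int \<Rightarrow> int" where
  "node w k s = (w * B + k) * B + s"

lemma node_div: "0 \<le> s \<Longrightarrow> s < B \<Longrightarrow> node w k s div B = w * B + k"
  using B by (simp add: node_def)

lemma node_mod: "0 \<le> s \<Longrightarrow> s < B \<Longrightarrow> node w k s mod B = s"
  using B by (simp add: node_def)

lemma node_range:
  assumes "0 \<le> w" "w < B" "0 \<le> k" "k < B" "0 \<le> s" "s < B"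
  shows "0 \<le> node w k s \<and> node w k s < B * B * B"
proof -
  have "w * B + k < (w + 1) * B" using assms by (simp add: algebra_simps)
  also have "\<dots> \<le> B * B" using assms B by (intro mult_right_mono) auto
  finally have "w * B + k + 1 \<le> B * B" by simp
  then have "(w * B + k + 1) * B \<le> B * B * B" using B by (intro mult_right_mono) auto
  then have "node w k s < B * B * B" using assms by (simp add: node_def algebra_simps)
  moreover have "0 \<le> node w k s" using assms by (simp add: node_def)
  ultimately show ?thesis by simp
qed

end

lemma matrix_list_eq:
  assumes "A \<in> carrier_mat m n"
    and "\<And>i j. i < m \<Longrightarrow> j < n \<Longrightarrow> T (int (i * n + j)) = int (A $$ (i, j))"
  shows "map (\<lambda>i. T (int i)) [0..<m * n] = matrix_list A"
proof -
  have "concat (map (\<lambda>i. map (\<lambda>j. T (int (i * n + j))) [0..<n]) [0..<k]) = map (\<lambda>i. T (int i)) [0..<k * n]" for k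
  proof (induction k)
    case (Suc k)
    have "[0..<Suc k * n] = [0..<k * n] @ [k * n..<k * n + n]"
      using upt_add_eq_append[of 0 "k * n" n] by (simp add: add.commute)
    moreover have "[k * n..<k * n + n] = map (\<lambda>j. k * n + j) [0..<n]"
      by (simp add: map_add_upt add.commute)
    ultimately show ?case using Suc by (simp add: comp_def)
  qed simp
  moreover have "matrix_list A = concat (map (\<lambda>i. map (\<lambda>j. T (int (i * n + j))) [0..<n]) [0..<m])"
    using assms unfolding matrix_list_def by (intro arg_cong[where f = concat] map_cong) auto
  ultimately show ?thesis by simp
qed

section \<open>Feasible matrices and the necessity of the Gale-Ryser inequalities\<close>

lemma feasible_entry:
  assumes "feasible m n r A" "i < m" "j < n"
  shows "A $$ (i, j) = 0 \<or> A $$ (i, j) = 1"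
  using assms unfolding feasible_def elements_mat_def by force

text \<open>Ensures in both cases that the start node is live, so that the computed path ends in a
  goal.\<close>

lemma feasible_exists:
  assumes "\<And>i. i < m \<Longrightarrow> r i \<le> n"
  shows "\<exists>A. feasible m n r A"
proof
  let ?A = "mat m n (\<lambda>(i, j). if j < r i then 1 else 0) :: nat mat"
  have "row_sum ?A i = r i" if "i < m" for i
  proof -
    have "row_sum ?A i = (\<Sum>j<n. if j < r i then 1 else 0)"
      unfolding row_sum_def using that by (intro sum.cong) auto
    also have "\<dots> = card ({..<n} \<inter> {..<r i})" by (simp add: sum.If_cases Int_def)
    also have "{..<n} \<inter> {..<r i} = {..<r i}" using assms[OF that] by auto
    finally show ?thesis by simp
  qed
  then show "feasible m n r ?A" by (auto simp: feasible_def elements_mat_def)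
qed

text \<open>Within the columns \<open>J\<close> a row has at most \<open>r i\<close> and at most
  \<open>card J\<close> ones.\<close>

lemma col_sums_le:
  assumes A: "feasible m n r A" and J: "J \<subseteq> {..<n}"
  shows "int (\<Sum>j\<in>J. col_sum A j) \<le> (\<Sum>i<m. min (int (r i)) (int (card J)))"
proof -
  have dim: "dim_row A = m" "dim_col A = n" using A by (auto simp: feasible_def)
  have "(\<Sum>j\<in>J. col_sum A j) = (\<Sum>i<m. \<Sum>j\<in>J. A $$ (i, j))"
    unfolding col_sum_def dim by (rule sum.swap)
  also have "int \<dots> \<le> (\<Sum>i<m. min (int (r i)) (int (card J)))"
    unfolding of_nat_sum
  proof (intro sum_mono)
    fix i assume "i \<in> {..<m}"
    then have i: "i < m" by simp
    have "(\<Sum>j\<in>J. A $$ (i, j)) \<le> (\<Sum>j\<in>J. 1)"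
      using feasible_entry[OF A i] J by (intro sum_mono) fastforce
    moreover have "(\<Sum>j\<in>J. A $$ (i, j)) \<le> (\<Sum>j<n. A $$ (i, j))"
      using J by (intro sum_mono2) auto
    moreover have "(\<Sum>j<n. A $$ (i, j)) = r i" using A i dim by (auto simp: feasible_def row_sum_def)
    ultimately show "(\<Sum>j\<in>J. int (A $$ (i, j))) \<le> min (int (r i)) (int (card J))"
      unfolding of_nat_sum[symmetric] by (simp del: of_nat_sum)
  qed
  finally show ?thesis .
qed

section \<open>Correctness for identical functions\<close>

locale case1 = base +
  fixes m n :: nat and r :: "nat \<Rightarrow> nat" and f :: "nat \<Rightarrow> int" and inp :: "int \<Rightarrow> int"
  assumes inp_m: "inp 0 = int m" and inp_n: "inp 1 = int n"
    and inp_r: "\<And>i. i < m \<Longrightarrow> inp (2 + int i) = int (r i)"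
    and inp_f: "\<And>v. v \<le> m \<Longrightarrow> inp (2 + int m + int v) = f v"
    and pos: "0 < m" "0 < n" and r_le: "\<And>i. i < m \<Longrightarrow> r i \<le> n"
    and mnB: "int (m * n) < B"
begin

text \<open>The right-hand side of the Gale-Ryser inequalities.\<close>

definition R :: "int \<Rightarrow> int" where
  "R k = (\<Sum>i<m. min (int (r i)) k)"

lemma m_less: "int m < B" and n_less: "int n < B"
proof -
  have "m * 1 \<le> m * n" "1 * n \<le> m * n" using pos by (intro mult_le_mono; simp)+
  then show "int m < B" "int n < B" using mnB by linarith+
qed

lemma rowt: "0 \<le> k \<Longrightarrow> k < N \<Longrightarrow> rowt N inp k = R k"
  unfolding rowt_def R_def by (subst memo_nonrec) (simp_all add: look_def inp_m sum_int inp_r)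

lemma R_le: "R k \<le> int (m * n)"
proof -
  have "R k \<le> (\<Sum>i<m. int n)" unfolding R_def using r_le
    by (intro sum_mono) (metis lessThan_iff min.coboundedI1 of_nat_mono)
  then show ?thesis by simp
qed

lemma R_n: "R (int n) = (\<Sum>i<m. int (r i))"
  unfolding R_def using r_le by (intro sum.cong) auto

definition nd :: "nat \<Rightarrow> nat \<Rightarrow> nat \<Rightarrow> int" where
  "nd v k s = node (int (m - v)) (int k) (int s)"

lemma nd:
  assumes "v \<le> m" "k \<le> n" "s \<le> m * n"
  shows "0 \<le> nd v k s" "nd v k s < N" "goal1 N b (nd v k s) = of_bool (k = 0)"
    "take1 N inp b (nd v k s) =
      (if 0 < k \<and> v \<le> s \<and> int (s - v) \<le> R (int (k - 1)) then nd v (k - 1) (s - v) else -1)"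
    "cost1 N inp b (nd v k s) = f v"
    "skip1 N b (nd v k s) = (if 0 < k \<and> v < m then nd (Suc v) k s else -1)"
    "secondt N b (nd v k s) = int k" "int m - highert N b (nd v k s) = int v"
proof -
  let ?u = "nd v k s"
  have s: "int s < B" using assms(3) mnB by linarith
  have k: "int k < B" using assms(2) n_less by linarith
  have "int (m - v) < B" using m_less by linarith
  then have "0 \<le> ?u \<and> ?u < B * B * B" unfolding nd_def using s k by (intro node_range) auto
  then show u: "0 \<le> ?u" "?u < N" using BN by auto
  have d: "?u div B = int (m - v) * B + int k" unfolding nd_def using s by (intro node_div) auto
  have digits: "?u div B mod B = int k" "?u div B div B = int (m - v)" "?u mod B = int s"
    unfolding d using s k B node_mod[of "int s"] by (simp_all add: nd_def)
  show second: "secondt N b ?u = int k" using secondt[OF u] digits by simp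
  have higher: "highert N b ?u = int (m - v)" using highert[OF u] digits by simp
  then show v: "int m - highert N b ?u = int v" using assms(1) by simp
  have md: "modt N b ?u = int s" using modt[OF u] digits by simp
  show "goal1 N b ?u = of_bool (k = 0)"
    unfolding goal1_def using u by (subst memo_nonrec) (simp_all add: look_def second)
  show "cost1 N inp b ?u = f v"
    unfolding cost1_def using u inp_f[OF assms(1)] by (subst memo_nonrec) (simp_all add: look_def inp_m v)
  show "take1 N inp b ?u =
      (if 0 < k \<and> v \<le> s \<and> int (s - v) \<le> R (int (k - 1)) then nd v (k - 1) (s - v) else -1)"
  proof -
    have "rowt N inp (int k - 1) = R (int (k - 1))" if "0 < k"
      using rowt[of "int (k - 1)"] that k BN' by (auto simp: of_nat_diff)
    moreover have "?u - B - int v = nd v (k - 1) (s - v)" if "0 < k" "v \<le> s"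
      using that by (simp add: nd_def node_def of_nat_diff algebra_simps)
    ultimately show ?thesis
      unfolding take1_def using u v
      by (subst memo_nonrec) (auto simp: look_def second higher md inp_m b of_nat_diff)
  qed
  show "skip1 N b ?u = (if 0 < k \<and> v < m then nd (Suc v) k s else -1)"
  proof -
    have "?u - B * B = nd (Suc v) k s" if "v < m"
    proof -
      have "int (m - v) = int (m - Suc v) + 1" using that by simp
      then show ?thesis unfolding nd_def node_def by (simp add: algebra_simps)
    qed
    then show ?thesis
      unfolding skip1_def using u by (subst memo_nonrec) (auto simp: look_def second higher b)
  qed
qed

lemma R_nonneg: "0 \<le> k \<Longrightarrow> 0 \<le> R k"
  unfolding R_def by (intro sum_nonneg) auto

abbreviation origin :: int where "origin \<equiv> start1 N inp b 0"

lemma start_node: "origin = nd 0 n (nat (R (int n)))"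
  using rowt[of "int n"] n_less BN' B R_nonneg[of "int n"] unfolding start1_def
  by (subst memo_nonrec) (auto simp: look_def b inp_m inp_n nd_def node_def algebra_simps)

sublocale paths N "goal1 N b" "take1 N inp b" "cost1 N inp b" "skip1 N b" "start1 N inp b"
proof
  fix u :: int assume u: "0 \<le> u" "u < N"
  show "take1 N inp b u < u" "skip1 N b u < u"
    unfolding take1_def skip1_def using u B
    by (subst memo_nonrec; auto simp: look_def b mult_pos_pos inp_m)+
  assume "goal1 N b u = 1"
  then have "secondt N b u = 0"
    using u unfolding goal1_def by (subst (asm) memo_nonrec) (auto simp: look_def)
  then show "take1 N inp b u < 0 \<and> skip1 N b u < 0"
    unfolding take1_def skip1_def using u by (subst memo_nonrec; simp add: look_def)+
next
  have "nat (R (int n)) \<le> m * n" using R_le[of "int n"] by linarith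
  then show "0 \<le> origin" "origin < N"
    unfolding start_node using nd(1,2)[of 0 n "nat (R (int n))"] by simp_all
qed

text \<open>Induction over the moves to come: a smallest sum equal to the bound \<open>v\<close> is
  taken, otherwise the bound is raised. Suffixes of a sorted list are its largest members, so the
  hypothesis on them is what \<open>take1\<close> tests.\<close>

lemma walk_sorted:
  assumes "sorted cs" "length cs \<le> n" "\<And>c. c \<in> set cs \<Longrightarrow> v \<le> c \<and> c \<le> m" "v \<le> m"
    and "\<And>j. j \<le> length cs \<Longrightarrow> int (sum_list (drop j cs)) \<le> R (int (length cs - j))"
  shows "walk (nd v (length cs) (sum_list cs)) (\<Sum>c\<leftarrow>cs. f c)"
  using assms
proof (induction "length cs + (m - v)" arbitrary: cs v rule: less_induct)
  case less
  have "int (sum_list cs) \<le> R (int (length cs))" using less.prems(5)[of 0] by simp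
  then have s: "sum_list cs \<le> m * n" using R_le[of "int (length cs)"] by linarith
  note u = nd[OF less.prems(4,2) s]
  show ?case
  proof (cases cs)
    case Nil
    then show ?thesis using walk_goal[OF u(1,2)] u(3) by simp
  next
    case (Cons c cs')
    show ?thesis
    proof (cases "c = v")
      case True
      have tail: "int (sum_list (drop j cs')) \<le> R (int (length cs' - j))" if "j \<le> length cs'" for j
        using less.prems(5)[of "Suc j"] that Cons by simp
      have "walk (nd v (length cs') (sum_list cs')) (\<Sum>c\<leftarrow>cs'. f c)"
        using less.prems Cons tail by (intro less.hyps) auto
      moreover have "take1 N inp b (nd v (length cs) (sum_list cs)) = nd v (length cs') (sum_list cs')"
        using u(4) Cons True tail[of 0] by simp
      ultimately have "walk (nd v (length cs) (sum_list cs)) (f v + (\<Sum>c\<leftarrow>cs'. f c))"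
        using walk_s1[OF u(1,2)] u(5) by metis
      then show ?thesis using Cons True by simp
    next
      case False
      then have v: "v < c" "c \<le> m" using less.prems(3)[of c] Cons by auto
      then have "v < m" by simp
      have "Suc v \<le> c'" if "c' \<in> set cs" for c'
        using less.prems(1) v Cons that by auto
      then have "walk (nd (Suc v) (length cs) (sum_list cs)) (\<Sum>c\<leftarrow>cs. f c)"
        using less.prems \<open>v < m\<close> by (intro less.hyps) auto
      moreover have "skip1 N b (nd v (length cs) (sum_list cs)) = nd (Suc v) (length cs) (sum_list cs)"
        using u(6) Cons \<open>v < m\<close> by simp
      ultimately show ?thesis using walk_s2[OF u(1,2)] by simp
    qed
  qed
qed

lemma walk_feasible:
  assumes A: "feasible m n r A"
  shows "walk origin (objective (\<lambda>j. f) A)"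
proof -
  have dim: "dim_row A = m" "dim_col A = n" using A by (auto simp: feasible_def)
  \<comment> \<open>All columns share \<open>f\<close>, so the objective depends on the multiset of
    column sums only and sorting is harmless.\<close>
  define js where "js = sort_key (col_sum A) [0..<n]"
  define cs where "cs = map (col_sum A) js"
  have js: "set js = {..<n}" "distinct js" "length js = n" by (auto simp: js_def)
  have sum_js: "sum_list (map g (drop j js)) = (\<Sum>x\<in>set (drop j js). g x)" for g :: "nat \<Rightarrow> nat" and j
    using js(2) by (simp add: sum_list_distinct_conv_sum_set)
  have le: "int (sum_list (drop j cs)) \<le> R (int (length cs - j))" if "j \<le> length cs" for j
  proof -
    have "set (drop j js) \<subseteq> {..<n}" using js(1) set_drop_subset by metis
    moreover have "card (set (drop j js)) = length cs - j"
      using js(2) by (simp add: distinct_card cs_def)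
    ultimately show ?thesis
      using col_sums_le[OF A] unfolding R_def cs_def drop_map sum_js by metis
  qed
  have total: "int (sum_list cs) = R (int n)"
  proof -
    have "sum_list cs = (\<Sum>j<n. col_sum A j)" using sum_js[of _ 0] js(1) by (simp add: cs_def)
    also have "\<dots> = (\<Sum>i<m. row_sum A i)" unfolding col_sum_def row_sum_def dim by (rule sum.swap)
    also have "\<dots> = (\<Sum>i<m. r i)" using A by (intro sum.cong) (auto simp: feasible_def)
    finally show ?thesis by (simp add: R_n)
  qed
  have "col_sum A j \<le> m" if "j < n" for j
  proof -
    have "col_sum A j \<le> (\<Sum>i<m. 1)"
      unfolding col_sum_def dim using feasible_entry[OF A _ that] by (intro sum_mono) fastforce
    then show ?thesis by simp
  qed
  then have "walk (nd 0 (length cs) (sum_list cs)) (\<Sum>c\<leftarrow>cs. f c)"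
    using le js by (intro walk_sorted) (auto simp: cs_def js_def)
  moreover have "nd 0 (length cs) (sum_list cs) = origin"
    unfolding start_node total[symmetric] by (simp add: cs_def js(3))
  moreover have "(\<Sum>c\<leftarrow>cs. f c) = objective (\<lambda>j. f) A"
    unfolding cs_def objective_def dim using js
    by (simp add: sum_list_distinct_conv_sum_set comp_def)
  ultimately show ?thesis by simp
qed

lemma ok_start: "ok origin = 1"
  using walk_best[OF walk_feasible] feasible_exists[of m r n] r_le by blast

text \<open>The sum given to round \<open>j\<close> by the first \<open>t\<close> moves. Taking
  lowers the number of columns left, so at most one taken move starts with \<open>n - j\<close> of
  them and at most one term is nonzero.\<close>

definition C :: "nat \<Rightarrow> nat \<Rightarrow> int" where
  "C t j = (\<Sum>i<t. if tk (path (int i)) = 1 \<and> secondt N b (path (int i)) = int n - int j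
     then int m - highert N b (path (int i)) else 0)"

lemma C_Suc: "C (Suc t) j = C t j + (if tk (path (int t)) = 1 \<and> secondt N b (path (int t)) = int n - int j
     then int m - highert N b (path (int t)) else 0)"
  by (simp add: C_def)

text \<open>Rounds below \<open>n - k\<close> are settled with non-decreasing sums up to
  \<open>v\<close>, so taking \<open>v\<close> next preserves the order. The condition on
  \<open>q\<close> is the inequality for the columns after the first \<open>q\<close>.\<close>

definition inv1 :: "nat \<Rightarrow> nat \<Rightarrow> nat \<Rightarrow> nat \<Rightarrow> bool" where
  "inv1 t v k s \<longleftrightarrow> v \<le> m \<and> k \<le> n \<and> int s \<le> R (int k) \<and> path (int t) = nd v k s \<and>
    (\<forall>j<n - k. 0 \<le> C t j \<and> C t j \<le> int v) \<and>
    (\<forall>j j'. j \<le> j' \<longrightarrow> j' < n - k \<longrightarrow> C t j \<le> C t j') \<and>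
    (\<forall>j. n - k \<le> j \<longrightarrow> j < n \<longrightarrow> C t j = 0) \<and>
    (\<forall>q\<le>n - k. R (int n) - (\<Sum>j<q. C t j) \<le> R (int (n - q))) \<and>
    int s = R (int n) - (\<Sum>j<n - k. C t j) \<and>
    spent t = (\<Sum>j<n - k. f (nat (C t j)))"

lemma path_invariant: "int t < N \<Longrightarrow> \<exists>v k s. inv1 t v k s"
proof (induction t)
  case 0
  have "0 \<le> R (int n)" by (simp add: R_nonneg)
  then have "inv1 0 0 n (nat (R (int n)))"
    by (simp add: inv1_def path_0 start_node C_def)
  then show ?case by (intro exI)
next
  case (Suc t)
  then obtain v k s where i: "inv1 t v k s" by auto
  from i have v: "v \<le> m" and k: "k \<le> n" and s: "int s \<le> R (int k)"
    and p: "path (int t) = nd v k s"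
    and bd: "\<forall>j<n - k. 0 \<le> C t j \<and> C t j \<le> int v"
    and mono: "\<forall>j j'. j \<le> j' \<longrightarrow> j' < n - k \<longrightarrow> C t j \<le> C t j'"
    and zero: "\<forall>j. n - k \<le> j \<longrightarrow> j < n \<longrightarrow> C t j = 0"
    and GR: "\<forall>q\<le>n - k. R (int n) - (\<Sum>j<q. C t j) \<le> R (int (n - q))"
    and sum: "int s = R (int n) - (\<Sum>j<n - k. C t j)"
    and cost: "spent t =
      (\<Sum>j<n - k. f (nat (C t j)))"
    unfolding inv1_def by blast+
  have "s \<le> m * n" using s R_le[of "int k"] by linarith
  note u = nd[OF v k this]
  let ?u = "nd v k s"
  have next': "path (int (Suc t)) = next_node ?u" using path_Suc[of t] Suc.prems p by simp
  show ?case
  proof (cases "tk ?u = 1")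
    case False
    then have C: "C (Suc t) j = C t j" for j by (simp add: C_Suc p)
    have cost': "spent (Suc t) =
        (\<Sum>j<n - k. f (nat (C t j)))" using cost False by (simp add: p)
    show ?thesis
    proof (cases "goal1 N b ?u = 1")
      case True
      then have "path (int (Suc t)) = ?u" using next' by (simp add: next_node_def)
      then have "inv1 (Suc t) v k s"
        unfolding inv1_def C cost' using v k s bd mono zero GR sum by (intro conjI refl)
      then show ?thesis by (intro exI)
    next
      case g: False
      have "ok ?u = 1" using path_ok[OF ok_start, of t] Suc.prems p by simp
      then have "0 \<le> next_node ?u" using g by (rule next_node(1))
      then have skip: "Suc v \<le> m" "path (int (Suc t)) = nd (Suc v) k s"
        using False g u(6) next' by (auto simp: next_node_def split: if_splits)
      have "\<forall>j<n - k. 0 \<le> C t j \<and> C t j \<le> int (Suc v)" using bd by fastforce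
      then have "inv1 (Suc t) (Suc v) k s"
        unfolding inv1_def C cost' using skip k s mono zero GR sum by (intro conjI refl)
      then show ?thesis by (intro exI)
    qed
  next
    case True
    then have g: "goal1 N b ?u \<noteq> 1" using tk_goal by blast
    have "ok ?u = 1" using path_ok[OF ok_start, of t] Suc.prems p by simp
    then have "0 \<le> next_node ?u" using g by (rule next_node(1))
    then have take: "0 < k" "v \<le> s" "int (s - v) \<le> R (int (k - 1))" "next_node ?u = nd v (k - 1) (s - v)"
      using True g u(4) by (auto simp: next_node_def split: if_splits)
    have C: "C (Suc t) j = (if j = n - k then int v else C t j)" if "j < n" for j
    proof -
      have "int k = int n - int j \<longleftrightarrow> j = n - k" using that k by auto
      moreover have "C t j = 0" if "j = n - k" using that \<open>j < n\<close> zero by simp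
      ultimately show ?thesis using True by (simp add: C_Suc p u(7,8))
    qed
    have nk: "n - (k - 1) = Suc (n - k)" "n - k < n" using take(1) k by auto
    have S: "(\<Sum>j<q. C (Suc t) j) = (\<Sum>j<q. C t j)" if "q \<le> n - k" for q
      using that nk(2) by (intro sum.cong) (auto simp: C)
    have S': "(\<Sum>j<Suc (n - k). C (Suc t) j) = (\<Sum>j<n - k. C t j) + int v"
      using S[of "n - k"] C[OF nk(2)] by simp
    have "(\<Sum>j<n - k. f (nat (C (Suc t) j))) = (\<Sum>j<n - k. f (nat (C t j)))"
      using nk(2) by (intro sum.cong) (auto simp: C)
    then have cost': "spent (Suc t) =
        (\<Sum>j<Suc (n - k). f (nat (C (Suc t) j)))"
      using cost True C[OF nk(2)] by (simp add: p u(5))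
    have sum': "int (s - v) = R (int n) - (\<Sum>j<Suc (n - k). C (Suc t) j)"
      unfolding S' using sum take(2) by simp
    have GR': "R (int n) - (\<Sum>j<q. C (Suc t) j) \<le> R (int (n - q))" if "q \<le> Suc (n - k)" for q
    proof (cases "q = Suc (n - k)")
      case True
      then have "n - q = k - 1" using nk k take(1) by simp
      then show ?thesis using sum' take(3) True by simp
    next
      case False
      then show ?thesis using GR S[of q] that by simp
    qed
    have bd': "0 \<le> C (Suc t) j \<and> C (Suc t) j \<le> int v" if "j < Suc (n - k)" for j
      using bd that nk(2) C[of j] by auto
    have mono': "C (Suc t) j \<le> C (Suc t) j'" if "j \<le> j'" "j' < Suc (n - k)" for j j'
      using mono bd that nk(2) C[of j] C[of j'] by (cases "j' = n - k") auto
    have zero': "C (Suc t) j = 0" if "Suc (n - k) \<le> j" "j < n" for j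
      using zero that C[of j] by auto
    have p': "path (int (Suc t)) = nd v (k - 1) (s - v)" using next' take(4) by simp
    have "inv1 (Suc t) v (k - 1) (s - v)"
      unfolding inv1_def nk(1)
    proof (intro conjI allI impI)
      show "k - 1 \<le> n" using k by simp
    qed (fact v take(3) p' sum' cost' | rule bd'[THEN conjunct1] bd'[THEN conjunct2] mono' zero' GR', assumption+)+
    then show ?thesis by (intro exI)
  qed
qed

lemma col1:
  assumes "j < n"
  shows "col1 N inp b (int j) = C (nat (N - 1)) j"
proof -
  have N: "N = int (Suc (nat (N - 1)))" using BN' B by simp
  \<comment> \<open>\<open>col1\<close> sums over all times below \<open>N\<close>, \<open>C\<close>
    over those below \<open>N - 1\<close>; at the last time the path rests at a goal and takes
    nothing.\<close>
  have "tk (path (N - 1)) \<noteq> 1" using path_goal[OF ok_start] tk_goal by blast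
  then have last: "tk (path (int (nat (N - 1)))) \<noteq> 1" using BN' B by simp
  have "int j < N" using assms n_less BN' by linarith
  then have "col1 N inp b (int j) = (\<Sum>i\<in>{0..<N}. if tk (path i) = 1 \<and> secondt N b (path i) = int n - int j
     then int m - highert N b (path i) else 0)"
    unfolding col1_def
    by (subst memo_nonrec)
      (simp_all add: look_def inp_m inp_n ok_def tk_def best_def path_def cong: if_cong)
  also have "\<dots> = (\<Sum>i<Suc (nat (N - 1)). if tk (path (int i)) = 1 \<and> secondt N b (path (int i)) = int n - int j
     then int m - highert N b (path (int i)) else 0)"
  proof -
    have "{0..<N} = {0..<int (Suc (nat (N - 1)))}" using N by simp
    then show ?thesis by (simp only: sum_int)
  qed
  also have "\<dots> = C (nat (N - 1)) j" using last by (simp add: C_def)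
  finally show ?thesis .
qed

abbreviation csum :: "nat \<Rightarrow> int" where "csum j \<equiv> col1 N inp b (int j)"

lemma columns:
  shows "\<And>j. j < n \<Longrightarrow> 0 \<le> csum j"
    and "\<And>j j'. j \<le> j' \<Longrightarrow> j' < n \<Longrightarrow> csum j \<le> csum j'"
    and "\<And>q. q \<le> n \<Longrightarrow> (\<Sum>j<n. csum j) - (\<Sum>j<n - q. csum j) \<le> R (int q)"
    and "(\<Sum>j<n. csum j) = (\<Sum>i<m. int (r i))"
    and "(\<Sum>j<n. f (nat (csum j))) = best origin"
proof -
  let ?t = "nat (N - 1)"
  have t: "int ?t = N - 1" "int ?t < N" using BN' B by simp_all
  obtain v k s where i: "inv1 ?t v k s" using path_invariant[OF t(2)] by blast
  from i have v: "v \<le> m" and k: "k \<le> n" and s: "int s \<le> R (int k)"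
    and p: "path (int ?t) = nd v k s"
    and bd: "\<forall>j<n - k. 0 \<le> C ?t j \<and> C ?t j \<le> int v"
    and mono: "\<forall>j j'. j \<le> j' \<longrightarrow> j' < n - k \<longrightarrow> C ?t j \<le> C ?t j'"
    and GR: "\<forall>q\<le>n - k. R (int n) - (\<Sum>j<q. C ?t j) \<le> R (int (n - q))"
    and sum: "int s = R (int n) - (\<Sum>j<n - k. C ?t j)"
    and cost: "spent ?t =
      (\<Sum>j<n - k. f (nat (C ?t j)))"
    unfolding inv1_def by blast+
  have "s \<le> m * n" using s R_le[of "int k"] by linarith
  from nd(3)[OF v k this] path_goal[OF ok_start] p t(1) have k0: "k = 0" by (simp split: if_splits)
  have "R 0 = 0" unfolding R_def by (intro sum.neutral) auto
  then have s0: "s = 0" using s k0 by simp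
  have total: "(\<Sum>j<n. C ?t j) = R (int n)" using sum k0 s0 by simp
  have cs: "(\<Sum>j<q. csum j) = (\<Sum>j<q. C ?t j)" if "q \<le> n" for q
    using that by (intro sum.cong) (auto simp: col1)
  show "0 \<le> csum j" if "j < n" for j using bd that k0 by (simp add: col1)
  show "csum j \<le> csum j'" if "j \<le> j'" "j' < n" for j j'
    using mono that k0 by (simp add: col1)
  show "(\<Sum>j<n. csum j) - (\<Sum>j<n - q. csum j) \<le> R (int q)" if "q \<le> n" for q
    using GR[rule_format, of "n - q"] that k0 total by (simp add: cs)
  show "(\<Sum>j<n. csum j) = (\<Sum>i<m. int (r i))" by (simp add: cs total R_n)
  have "best (path (int ?t)) = 0"
  proof -
    have "goal1 N b (path (int ?t)) = 1" using path_goal[OF ok_start] t(1) by simp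
    then show ?thesis using best_rec[of "path (int ?t)"] path_range[OF ok_start t(2), unfolded t(1)] t(1) by simp
  qed
  then have "best origin = (\<Sum>j<n. f (nat (C ?t j)))"
    using path_cost[OF ok_start t(2)] cost k0 by simp
  also have "\<dots> = (\<Sum>j<n. f (nat (csum j)))" by (intro sum.cong) (auto simp: col1)
  finally show "(\<Sum>j<n. f (nat (csum j))) = best origin" by simp
qed

definition \<mu> :: "nat \<Rightarrow> nat \<Rightarrow> int" where
  "\<mu> j i = mat1 N inp b (B * int j + int i)"

text \<open>Turns the table into the recursion assumed by \<open>greedy_matrix\<close>: the count in
  \<open>mat1\<close> is the rank used in \<open>tops\<close>.\<close>

lemma \<mu>_eq:
  assumes j: "j < n" and i: "i < m"
  shows "\<mu> j i = of_bool (i \<in> tops (\<lambda>i. int (r i) - (\<Sum>l<j. \<mu> l i)) m (csum j))"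
proof -
  let ?u = "B * int j + int i"
  let ?rem = "\<lambda>i. int (r i) - (\<Sum>l<j. \<mu> l i)"
  have iB: "int i < B" using i m_less by linarith
  have "?u < B * int (Suc j)" using iB by (simp add: algebra_simps)
  also have "\<dots> \<le> B * B" using B j n_less by (intro mult_left_mono) auto
  finally have u: "0 \<le> ?u" "?u < N" using BN' B by auto
  have digits: "divt N b ?u = int j" "modt N b ?u = int i"
    using divt[OF u] modt[OF u] iB B by simp_all
  \<comment> \<open>The unfinished table seen by the recursion; it agrees with \<open>mat1\<close>
    on all earlier rounds.\<close>
  define t where "t = (\<lambda>v. if 0 \<le> v \<and> v < ?u then mat1 N inp b v else 0)"
  have t: "t (B * int l + int i') = \<mu> l i'" if "l < j" "i' < m" for l i'
  proof -
    have "int i' < B" using that m_less by linarith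
    then have "B * int l + int i' < B * int (Suc l)" by (simp add: algebra_simps)
    also have "\<dots> \<le> B * int j" using that B by (intro mult_left_mono) auto
    finally show ?thesis using B unfolding t_def \<mu>_def by simp
  qed
  have rem: "rem1 inp b t (int j) (int i') = ?rem i'" if "i' < m" for i'
  proof -
    have "(\<Sum>l<n. if int l < int j then t (B * int l + int i') else 0) = (\<Sum>l<j. \<mu> l i')"
      using j that by (intro sum.mono_neutral_cong_right) (auto simp: t)
    then show ?thesis using inp_r[OF that] by (simp add: look_def inp_n b sum_int cong: if_cong)
  qed
  have "\<mu> j i = of_bool ((\<Sum>i'<m. of_bool (?rem i < ?rem i' \<or> ?rem i' = ?rem i \<and> i' < i))
      < csum j)"
  proof -
    have "\<mu> j i = of_bool ((\<Sum>i'\<in>{0..<int m}. of_bool (rem1 inp b t (int j) (int i) < rem1 inp b t (int j) i' \<or>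
        rem1 inp b t (int j) i' = rem1 inp b t (int j) (int i) \<and> i' < int i)) < csum j)"
      unfolding \<mu>_def mat1_def
      by (subst memo_rec[OF u]) (simp only: look_def digits inp_m t_def mat1_def)
    also have "(\<Sum>i'\<in>{0..<int m}. of_bool (rem1 inp b t (int j) (int i) < rem1 inp b t (int j) i' \<or>
        rem1 inp b t (int j) i' = rem1 inp b t (int j) (int i) \<and> i' < int i) :: int) =
       (\<Sum>i'<m. of_bool (?rem i < ?rem i' \<or> ?rem i' = ?rem i \<and> i' < i))"
      unfolding sum_int using rem i by (intro sum.cong) auto
    finally show ?thesis .
  qed
  also have "(\<Sum>i'<m. of_bool (?rem i < ?rem i' \<or> ?rem i' = ?rem i \<and> i' < i) :: int) =
      int (card {i'. i' < m \<and> beats ?rem i' i})"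
    by (subst sum_of_bool_eq) (auto simp: beats_def intro!: arg_cong[where f = card])
  finally show ?thesis using i by (simp add: tops_def)
qed

lemma \<mu>_sums:
  shows "\<And>i. i < m \<Longrightarrow> (\<Sum>j<n. \<mu> j i) = int (r i)" "\<And>j. j < n \<Longrightarrow> (\<Sum>i<m. \<mu> j i) = csum j"
  using greedy_matrix[of n m \<mu> "\<lambda>i. int (r i)" csum, OF \<mu>_eq _ columns(1,2)]
    columns(3,4) unfolding R_def by simp_all

lemma out1:
  assumes "i < m" "j < n"
  shows "out1 N inp b (int (i * n + j)) = \<mu> (n - 1 - j) i"
proof -
  let ?p = "int (i * n + j)"
  have "i * n + j < Suc i * n" using assms(2) by simp
  also have "\<dots> \<le> m * n" using assms(1) by (intro mult_le_mono1) simp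
  finally have p: "?p < N" "0 \<le> ?p" using mnB BN' by linarith+
  have n: "0 < int n" "int n \<le> N" using pos n_less BN' by linarith+
  have "tdiv N ?p (int n) = int i"
    using tdiv_eq[OF p(2) _ n] p(1) assms(2) by (simp add: of_nat_add of_nat_mult zdiv_int[symmetric] del: of_nat_add of_nat_mult)
  moreover have "int n - 1 - int j = int (n - 1 - j)" using assms(2) by simp
  ultimately show ?thesis
    unfolding out1_def using p by (subst memo_nonrec) (simp_all add: look_def b inp_n \<mu>_def mult.commute)
qed

text \<open>The matrix attains \<open>best origin\<close>, and each feasible matrix is a walk from
  \<open>origin\<close>, hence costs no less. Reversing the columns keeps the objective because
  \<open>f\<close> is common to them.\<close>

theorem optimal_matrix:
  "\<exists>A. optimal m n r (\<lambda>j. f) A \<and> map (\<lambda>i. out1 N inp b (int i)) [0..<m * n] = matrix_list A"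
proof (intro exI conjI)
  let ?A = "mat m n (\<lambda>(i, j). nat (\<mu> (n - 1 - j) i)) :: nat mat"
  have \<mu>01: "\<mu> (n - 1 - j) i = 0 \<or> \<mu> (n - 1 - j) i = 1" if "i < m" "j < n" for i j
    using \<mu>_eq[of "n - 1 - j" i] that by auto
  have entry: "int (?A $$ (i, j)) = \<mu> (n - 1 - j) i" if "i < m" "j < n" for i j
    using \<mu>01[OF that] that by auto
  have "row_sum ?A i = r i" if "i < m" for i
  proof -
    have "int (row_sum ?A i) = (\<Sum>j<n. \<mu> (n - 1 - j) i)"
      unfolding row_sum_def of_nat_sum using entry[OF that] by (intro sum.cong) auto
    also have "\<dots> = (\<Sum>j<n. \<mu> j i)" using sum.nat_diff_reindex[of "\<lambda>j. \<mu> j i" n] by simp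
    also have "\<dots> = int (r i)" by (rule \<mu>_sums(1)[OF that])
    finally show ?thesis by simp
  qed
  moreover have "elements_mat ?A \<subseteq> {0, 1}"
  proof
    fix x assume "x \<in> elements_mat ?A"
    then obtain i j where ij: "i < m" "j < n" and x: "x = ?A $$ (i, j)" unfolding elements_mat_def by auto
    show "x \<in> {0, 1}" using entry[OF ij] \<mu>01[OF ij] unfolding x by auto
  qed
  ultimately have feas: "feasible m n r ?A" by (simp add: feasible_def)
  have col: "col_sum ?A j = nat (csum (n - 1 - j))" if "j < n" for j
  proof -
    have "int (col_sum ?A j) = (\<Sum>i<m. \<mu> (n - 1 - j) i)"
      unfolding col_sum_def of_nat_sum using entry[OF _ that] by (intro sum.cong) auto
    also have "\<dots> = csum (n - 1 - j)" using that by (intro \<mu>_sums(2)) simp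
    finally show ?thesis by simp
  qed
  have "objective (\<lambda>j. f) ?A = (\<Sum>j<n. f (nat (csum (n - 1 - j))))"
    unfolding objective_def using col by (intro sum.cong) auto
  also have "\<dots> = (\<Sum>j<n. f (nat (csum j)))"
    using sum.nat_diff_reindex[of "\<lambda>j. f (nat (csum j))" n] by simp
  also have "\<dots> = best origin" by (rule columns(5))
  finally have "objective (\<lambda>j. f) ?A \<le> objective (\<lambda>j. f) A" if "feasible m n r A" for A
    using walk_best[OF walk_feasible[OF that]] by simp
  with feas show "optimal m n r (\<lambda>j. f) ?A" by (simp add: optimal_def)
  show "map (\<lambda>i. out1 N inp b (int i)) [0..<m * n] = matrix_list ?A"
  proof (rule matrix_list_eq)
    show "out1 N inp b (int (i * n + j)) = int (?A $$ (i, j))" if "i < m" "j < n" for i j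
      using out1[OF that] entry[OF that] by (simp only:)
  qed simp
qed

end

section \<open>Bounded row sums\<close>

text \<open>
  The row sums are at most \<open>d\<close>. A node with digits \<open>j\<close>, \<open>l\<close>, \<open>s\<close>, \<open>x\<close> means: \<open>j\<close> columns are left,
  \<open>s\<close> is the sum of \<open>(m + 1) ^ \<rho>\<close> over the remaining row sums \<open>\<rho>\<close>, the column in work already has \<open>x\<close>
  ones, and it may only get further ones in rows with \<open>\<rho> \<ge> d + 1 - l\<close>. Rows with \<open>\<rho> = d + 1 - l\<close>
  are dealt with next, so a row cannot be used twice in a column.
\<close>

definition powt :: "int \<Rightarrow> table \<Rightarrow> int \<Rightarrow> int" where
  "powt N inp = memo N (\<lambda>t e. if e = 0 then 1 else (look inp 0 + 1) * look t (e - 1))"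

definition thirdt :: "int \<Rightarrow> table \<Rightarrow> int \<Rightarrow> int" where
  "thirdt N b = memo N (\<lambda>t u. look (modt N b) (look (highert N b) u))"

definition fourtht :: "int \<Rightarrow> table \<Rightarrow> int \<Rightarrow> int" where
  "fourtht N b = memo N (\<lambda>t u. look (divt N b) (look (highert N b) u))"

text \<open>A row without remaining sum contributes \<open>(m + 1) ^ 0 = 1\<close> and any other row
  more, so \<open>s = m\<close> says that all rows are used up.\<close>

definition goal2 :: "int \<Rightarrow> table \<Rightarrow> table \<Rightarrow> int \<Rightarrow> int" where
  "goal2 N inp b = memo N (\<lambda>t u.
     of_bool (look (fourtht N b) u = 0 \<and> look (secondt N b) u = look inp 0))"

text \<open>At level 0 the column is closed: one subtraction lowers \<open>j\<close> by one, resets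
  \<open>l\<close> from 0 to \<open>d\<close> and clears \<open>x\<close>.\<close>

definition adv2 :: "int \<Rightarrow> int \<Rightarrow> table \<Rightarrow> int \<Rightarrow> int" where
  "adv2 d N b = memo N (\<lambda>t u. if look (fourtht N b) u = 0 then -1
     else if 0 < look (thirdt N b) u then u - look b 0 * look b 0
     else u - look b 0 * (look b 0 * (look b 0 - d)) - look (modt N b) u)"

text \<open>With \<open>j\<close> columns left, column \<open>j - 1\<close> is in work, and its cost
  falls due when it is closed. Each function occupies \<open>m + 1\<close> consecutive
  inputs.\<close>

definition cost2 :: "int \<Rightarrow> table \<Rightarrow> table \<Rightarrow> int \<Rightarrow> int" where
  "cost2 N inp b = memo N (\<lambda>t u. if look (thirdt N b) u = 0
     then look inp (2 + look inp 0 + ((look inp 0 + 1) * (look (fourtht N b) u - 1) + look (modt N b) u))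
     else 0)"

text \<open>Digit \<open>e\<close> of \<open>s\<close> in base \<open>m + 1\<close>, which for a
  code is the number of rows with remaining sum \<open>e\<close>.\<close>

abbreviation digit2 :: "int \<Rightarrow> table \<Rightarrow> int \<Rightarrow> int \<Rightarrow> int" where
  "digit2 N inp s e \<equiv> tdiv N s (look (powt N inp) e) -
     (look inp 0 + 1) * tdiv N (tdiv N s (look (powt N inp) e)) (look inp 0 + 1)"

text \<open>Puts a one into a row with remaining sum \<open>d + 1 - l\<close>: in \<open>s\<close> a
  power gives way to the next lower one, and the final \<open>+ 1\<close> increases
  \<open>x\<close>.\<close>

definition drop2 :: "int \<Rightarrow> int \<Rightarrow> table \<Rightarrow> table \<Rightarrow> int \<Rightarrow> int" where
  "drop2 d N inp b = memo N (\<lambda>t u.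
     if 0 < look (fourtht N b) u \<and> 0 < look (thirdt N b) u \<and> look (thirdt N b) u \<le> d \<and>
       0 < digit2 N inp (look (secondt N b) u) (d + 1 - look (thirdt N b) u)
     then u - look b 0 * (look (powt N inp) (d + 1 - look (thirdt N b) u) -
       look (powt N inp) (d - look (thirdt N b) u)) + 1
     else -1)"

definition start2 :: "int \<Rightarrow> int \<Rightarrow> table \<Rightarrow> table \<Rightarrow> int \<Rightarrow> int" where
  "start2 d N inp b = memo N (\<lambda>t u. look b 0 * (look b 0 * (look b 0 * look inp 1 + d) +
     (\<Sum>i\<in>{0..<look inp 0}. look (powt N inp) (look inp (2 + i)))))"

abbreviation ok2 :: "int \<Rightarrow> int \<Rightarrow> table \<Rightarrow> table \<Rightarrow> int \<Rightarrow> int" where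
  "ok2 d N inp b \<equiv> okt N (goal2 N inp b) (adv2 d N b) (drop2 d N inp b)"

abbreviation best2 :: "int \<Rightarrow> int \<Rightarrow> table \<Rightarrow> table \<Rightarrow> int \<Rightarrow> int" where
  "best2 d N inp b \<equiv>
     bestt N (goal2 N inp b) (adv2 d N b) (cost2 N inp b) (drop2 d N inp b) (ok2 d N inp b)"

abbreviation tk2 :: "int \<Rightarrow> int \<Rightarrow> table \<Rightarrow> table \<Rightarrow> int \<Rightarrow> int" where
  "tk2 d N inp b \<equiv> taket N (goal2 N inp b) (adv2 d N b) (cost2 N inp b) (drop2 d N inp b)
     (ok2 d N inp b) (best2 d N inp b)"

abbreviation path2 :: "int \<Rightarrow> int \<Rightarrow> table \<Rightarrow> table \<Rightarrow> int \<Rightarrow> int" where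
  "path2 d N inp b \<equiv> patht N (goal2 N inp b) (adv2 d N b) (drop2 d N inp b)
     (start2 d N inp b) (tk2 d N inp b)"

text \<open>The first row whose remaining sum is \<open>d + 1 - l\<close>, counted as the rows before it.\<close>

definition pick2 :: "int \<Rightarrow> int \<Rightarrow> table \<Rightarrow> table \<Rightarrow> int \<Rightarrow> int" where
  "pick2 d N inp b = memo N (\<lambda>p t.
     if look (goal2 N inp b) (look (path2 d N inp b) t) = 1 \<or>
       look (tk2 d N inp b) (look (path2 d N inp b) t) = 1 then -1
     else \<Sum>i\<in>{0..<look inp 0}. of_bool (\<forall>i'\<in>{0..<look inp 0}. i' \<le> i \<longrightarrow>
       \<not> look inp (2 + i') - (\<Sum>t'\<in>{0..<N}. of_bool (t' < t \<and> look p t' = i')) =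
         d + 1 - look (thirdt N b) (look (path2 d N inp b) t)))"

definition out2 :: "int \<Rightarrow> int \<Rightarrow> table \<Rightarrow> table \<Rightarrow> int \<Rightarrow> int" where
  "out2 d N inp b = memo N (\<lambda>q p. of_bool (\<exists>t\<in>{0..<N}.
     look (pick2 d N inp b) t = tdiv N p (look inp 1) \<and>
     look (fourtht N b) (look (path2 d N inp b) t) = p - look inp 1 * tdiv N p (look inp 1) + 1))"

lemma avail_case2:
  assumes "avail I enc N {IN, BT}"
    and b: "\<And>x. 0 \<le> look (BT x) 0 \<and> look (BT x) 0 \<le> N x"
    and m: "\<And>x. look (IN x) 0 \<le> N x" and m1: "\<And>x. 0 \<le> look (IN x) 0 + 1 \<and> look (IN x) 0 + 1 \<le> N x"
    and n: "\<And>x. 0 \<le> look (IN x) 1 \<and> look (IN x) 1 \<le> N x"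
  shows "avail I enc N {IN, \<lambda>x. out2 d (N x) (IN x) (BT x)}"
proof -
  note rules = compb_ball compb_bex comp_sum comp_mult comp_tdiv comp_rules under_rules b m m1 n tabl_under
  let ?S = "{\<lambda>x. divt (N x) (BT x), \<lambda>x. modt (N x) (BT x), \<lambda>x. secondt (N x) (BT x),
    \<lambda>x. highert (N x) (BT x)} \<union> {IN, BT}"
  let ?A0 = "insert (\<lambda>x. powt (N x) (IN x)) ?S"
  let ?A1 = "insert (\<lambda>x. thirdt (N x) (BT x)) ?A0"
  let ?A2 = "insert (\<lambda>x. fourtht (N x) (BT x)) ?A1"
  let ?A3 = "insert (\<lambda>x. goal2 (N x) (IN x) (BT x)) ?A2"
  let ?A4 = "insert (\<lambda>x. adv2 d (N x) (BT x)) ?A3"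
  let ?A5 = "insert (\<lambda>x. cost2 (N x) (IN x) (BT x)) ?A4"
  let ?A6 = "insert (\<lambda>x. drop2 d (N x) (IN x) (BT x)) ?A5"
  let ?A7 = "insert (\<lambda>x. start2 d (N x) (IN x) (BT x)) ?A6"
  let ?B = "insert (\<lambda>x. path2 d (N x) (IN x) (BT x)) (insert (\<lambda>x. tk2 d (N x) (IN x) (BT x)) ?A7)"
  let ?C0 = "insert (\<lambda>x. pick2 d (N x) (IN x) (BT x)) ?B"
  let ?C1 = "insert (\<lambda>x. out2 d (N x) (IN x) (BT x)) ?C0"
  have "avail I enc N ?S"
    using assms(1) _ b by (rule avail_digits) simp
  then have "avail I enc N ?A0"
    unfolding powt_def by (rule avail_table) (rule rules | (erule subsetD, simp; fail))+
  then have "avail I enc N ?A1"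
    unfolding thirdt_def by (rule avail_table) (rule rules | (erule subsetD, simp; fail))+
  then have "avail I enc N ?A2"
    unfolding fourtht_def by (rule avail_table) (rule rules | (erule subsetD, simp; fail))+
  then have "avail I enc N ?A3"
    unfolding goal2_def by (rule avail_table) (rule rules | (erule subsetD, simp; fail))+
  then have "avail I enc N ?A4"
    unfolding adv2_def by (rule avail_table) (rule rules | (erule subsetD, simp; fail))+
  then have "avail I enc N ?A5"
    unfolding cost2_def by (rule avail_table) (rule rules | (erule subsetD, simp; fail))+
  then have "avail I enc N ?A6"
    unfolding drop2_def by (rule avail_table) (rule rules | (erule subsetD, simp; fail))+
  then have "avail I enc N ?A7"
    unfolding start2_def by (rule avail_table) (rule rules | (erule subsetD, simp; fail))+
  then have "avail I enc N ?B"
    by (rule avail_paths) simp_all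
  then have "avail I enc N ?C0"
    unfolding pick2_def by (rule avail_table) (rule rules | (erule subsetD, simp; fail))+
  then have "avail I enc N ?C1"
    unfolding out2_def by (rule avail_table) (rule rules | (erule subsetD, simp; fail))+
  then show ?thesis by (rule avail_subset) auto
qed

text \<open>There are no carries. Exponents below \<open>e\<close> give at most \<open>m < K\<close>
  terms, each at most \<open>K ^ (e - 1)\<close>; exponents above \<open>e\<close> give multiples of
  \<open>K ^ (e + 1)\<close>; and at most \<open>m\<close> terms equal \<open>K ^ e\<close>.\<close>

lemma digit_sum:
  fixes g :: "nat \<Rightarrow> nat"
  assumes "m < K"
  shows "(\<Sum>i<m. K ^ g i) div K ^ e mod K = card {i. i < m \<and> g i = e}"
proof -
  let ?L = "{i. i < m \<and> g i < e}" and ?E = "{i. i < m \<and> g i = e}" and ?H = "{i. i < m \<and> e < g i}"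
  have K: "0 < K" using assms by simp
  have "{..<m} = ?L \<union> (?E \<union> ?H)" by auto
  moreover have "(\<Sum>i\<in>?L \<union> (?E \<union> ?H). K ^ g i) = (\<Sum>i\<in>?L. K ^ g i) + (\<Sum>i\<in>?E \<union> ?H. K ^ g i)"
    by (rule sum.union_disjoint) auto
  moreover have "(\<Sum>i\<in>?E \<union> ?H. K ^ g i) = (\<Sum>i\<in>?E. K ^ g i) + (\<Sum>i\<in>?H. K ^ g i)"
    by (rule sum.union_disjoint) auto
  moreover have "(\<Sum>i\<in>?E. K ^ g i) = K ^ e * card ?E" by simp
  moreover have "K ^ e * K dvd (\<Sum>i\<in>?H. K ^ g i)"
  proof (rule dvd_sum)
    fix i assume "i \<in> ?H"
    then have "Suc e \<le> g i" by simp
    then have "K ^ Suc e dvd K ^ g i" by (rule le_imp_power_dvd)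
    then show "K ^ e * K dvd K ^ g i" by (simp add: mult.commute)
  qed
  then obtain h where "(\<Sum>i\<in>?H. K ^ g i) = K ^ e * K * h" by (auto simp: dvd_def)
  ultimately have eq: "(\<Sum>i<m. K ^ g i) = (\<Sum>i\<in>?L. K ^ g i) + K ^ e * (card ?E + K * h)"
    by (simp add: algebra_simps)
  have "(\<Sum>i\<in>?L. K ^ g i) < K ^ e"
  proof (cases e)
    case (Suc e')
    have "(\<Sum>i\<in>?L. K ^ g i) \<le> (\<Sum>i\<in>?L. K ^ e')"
      using K Suc by (intro sum_mono power_increasing) auto
    also have "\<dots> \<le> m * K ^ e'" using card_mono[of "{..<m}" ?L] by auto
    also have "\<dots> < K ^ e" using assms K Suc by simp
    finally show ?thesis .
  qed simp
  then have "(\<Sum>i<m. K ^ g i) div K ^ e = card ?E + K * h" unfolding eq using K by simp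
  moreover have "card ?E \<le> card {..<m}" by (rule card_mono) auto
  then have "card ?E < K" using assms by simp
  ultimately show ?thesis by simp
qed

text \<open>The least solution is expressed as a sum by counting the indices with no solution up to
  and including themselves.\<close>

lemma first_index:
  assumes "i < m" "Q i"
  obtains i0 where "i0 < m" "Q i0" "(\<Sum>i<m. of_bool (\<forall>i'<m. i' \<le> i \<longrightarrow> \<not> Q i') :: int) = int i0"
proof -
  define i0 where "i0 = (LEAST i. Q i)"
  have Q: "Q i0" unfolding i0_def using assms(2) by (rule LeastI)
  have le: "i0 \<le> i" if "Q i" for i unfolding i0_def using that by (rule Least_le)
  then have m: "i0 < m" using assms by fastforce
  have "(\<forall>i'<m. i' \<le> i \<longrightarrow> \<not> Q i') \<longleftrightarrow> i < i0" if "i < m" for i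
  proof
    assume "\<forall>i'<m. i' \<le> i \<longrightarrow> \<not> Q i'"
    then show "i < i0" using Q m by (meson not_less)
  next
    assume "i < i0"
    then show "\<forall>i'<m. i' \<le> i \<longrightarrow> \<not> Q i'" using le by (meson le_trans not_less)
  qed
  then have "(\<Sum>i<m. of_bool (\<forall>i'<m. i' \<le> i \<longrightarrow> \<not> Q i') :: int) = (\<Sum>i<m. of_bool (i < i0))"
    by (intro sum.cong) auto
  also have "\<dots> = int (card ({..<m} \<inter> {i. i < i0}))" by (subst sum_of_bool_eq) auto
  also have "{..<m} \<inter> {i. i < i0} = {..<i0}" using m by auto
  finally show ?thesis using that[OF m Q] by simp
qed

section \<open>Correctness for bounded row sums\<close>

locale case2 = base +
  fixes m n d :: nat and r :: "nat \<Rightarrow> nat" and f :: "nat \<Rightarrow> nat \<Rightarrow> int" and inp :: "int \<Rightarrow> int"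
  assumes inp_m: "inp 0 = int m" and inp_n: "inp 1 = int n"
    and inp_r: "\<And>i. i < m \<Longrightarrow> inp (2 + int i) = int (r i)"
    and inp_f: "\<And>j v. j < n \<Longrightarrow> v \<le> m \<Longrightarrow> inp (2 + int m + ((int m + 1) * int j + int v)) = f j v"
    and pos: "0 < m" "0 < n" and r_n: "\<And>i. i < m \<Longrightarrow> r i \<le> n" and r_d: "\<And>i. i < m \<Longrightarrow> r i \<le> d"
    and pow_B: "int ((m + 1) ^ (d + 1)) \<le> B" and n_B: "int n < B" and d_B: "int d < B"
    and BN4: "B * B * B * B \<le> N" and mn_N: "int (m * n) < N"
begin

abbreviation K :: nat where "K \<equiv> m + 1"

lemma pow_less: "e \<le> d + 1 \<Longrightarrow> int (K ^ e) \<le> B"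
proof -
  assume "e \<le> d + 1"
  then have "K ^ e \<le> K ^ (d + 1)" by (intro power_increasing) auto
  then show ?thesis using pow_B by linarith
qed

lemma K_B: "int K \<le> B" using pow_less[of 1] by simp

lemma powt: "e \<le> d + 1 \<Longrightarrow> powt N inp (int e) = int (K ^ e)"
proof (induction e)
  case 0
  then show ?case unfolding powt_def using BN' B by (subst memo_rec) simp_all
next
  case (Suc e)
  have "int (Suc e) < N" using Suc.prems d_B BN' by linarith
  then show ?case unfolding powt_def
    by (subst memo_rec) (use Suc in \<open>simp_all add: look_def inp_m powt_def algebra_simps\<close>)
qed

lemma digit2: "int s < B \<Longrightarrow> e \<le> d + 1 \<Longrightarrow> digit2 N inp (int s) (int e) = int (s div K ^ e mod K)"
proof -
  assume s: "int s < B" and e: "e \<le> d + 1"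
  have "0 < K ^ e" by simp
  then have p0: "0 < int (K ^ e)" by linarith
  have pN: "int (K ^ e) \<le> N" using pow_less[OF e] BN' by linarith
  have sN: "int s \<le> N" using s BN' by linarith
  have q: "tdiv N (int s) (int (K ^ e)) = int (s div K ^ e)"
    using tdiv_eq[OF of_nat_0_le_iff sN p0 pN] by (simp only: zdiv_int)
  have "s div K ^ e \<le> s" by simp
  then have qN: "int (s div K ^ e) \<le> N" using sN by linarith
  have K: "0 < int K" "int K \<le> N" using K_B BN' by linarith+
  have q': "tdiv N (int (s div K ^ e)) (int K) = int (s div K ^ e div K)"
    using tdiv_eq[OF of_nat_0_le_iff qN K] by (simp only: zdiv_int)
  have i: "inp 0 + 1 = int K" by (simp add: inp_m)
  have "int (s div K ^ e) = int K * int (s div K ^ e div K) + int (s div K ^ e mod K)"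
    by (metis mult_div_mod_eq of_nat_add of_nat_mult)
  then show ?thesis unfolding look_def powt[OF e] q i q' by linarith
qed

text \<open>Below \<open>(m + 1) ^ (d + 1)\<close> while remaining sums are at most
  \<open>d\<close>, hence a digit in a base that is polynomial for fixed \<open>d\<close>.\<close>

definition code :: "(nat \<Rightarrow> nat) \<Rightarrow> nat" where
  "code \<rho> = (\<Sum>i<m. K ^ \<rho> i)"

lemma code_less: "(\<And>i. i < m \<Longrightarrow> \<rho> i \<le> d) \<Longrightarrow> int (code \<rho>) < B"
proof -
  assume \<rho>: "\<And>i. i < m \<Longrightarrow> \<rho> i \<le> d"
  have "code \<rho> \<le> (\<Sum>i<m. K ^ d)" unfolding code_def using \<rho> by (intro sum_mono power_increasing) auto
  also have "\<dots> < K ^ (d + 1)" by simp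
  finally show ?thesis using pow_B by linarith
qed

lemma code_cong: "(\<And>i. i < m \<Longrightarrow> \<rho> i = \<rho>' i) \<Longrightarrow> code \<rho> = code \<rho>'"
  unfolding code_def by (intro sum.cong) auto

text \<open>Additions on both sides avoid truncated subtraction.\<close>

lemma code_dec:
  assumes "i < m" "\<rho> i = Suc q"
  shows "code (\<rho>(i := q)) + K ^ Suc q = code \<rho> + K ^ q"
proof -
  have "code \<rho>' = K ^ \<rho>' i + (\<Sum>i'\<in>{..<m} - {i}. K ^ \<rho>' i')" for \<rho>'
    unfolding code_def using assms(1) by (subst sum.remove[of _ i]) auto
  moreover have "(\<Sum>i'\<in>{..<m} - {i}. K ^ (\<rho>(i := q)) i') = (\<Sum>i'\<in>{..<m} - {i}. K ^ \<rho> i')"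
    by (intro sum.cong) auto
  ultimately show ?thesis using assms(2) by simp
qed

lemma code_digit: "code \<rho> div K ^ e mod K = card {i. i < m \<and> \<rho> i = e}"
  unfolding code_def by (rule digit_sum) simp

definition nd :: "nat \<Rightarrow> nat \<Rightarrow> nat \<Rightarrow> nat \<Rightarrow> int" where
  "nd j l s x = node (int j * B + int l) (int s) (int x)"

lemma nd:
  assumes "j \<le> n" "l \<le> d" "int s < B" "x \<le> m"
  shows "0 \<le> nd j l s x" "nd j l s x < N" "modt N b (nd j l s x) = int x"
    "secondt N b (nd j l s x) = int s" "thirdt N b (nd j l s x) = int l" "fourtht N b (nd j l s x) = int j"
    "goal2 N inp b (nd j l s x) = of_bool (j = 0 \<and> s = m)"
    "adv2 (int d) N b (nd j l s x) =
      (if j = 0 then -1 else if 0 < l then nd j (l - 1) s x else nd (j - 1) d s 0)"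
    "0 < j \<Longrightarrow> cost2 N inp b (nd j l s x) = (if l = 0 then f (j - 1) x else 0)"
    "drop2 (int d) N inp b (nd j l s x) = (if 0 < j \<and> 0 < l \<and> 0 < s div K ^ (d + 1 - l) mod K
      then nd j l (s + K ^ (d - l) - K ^ (d + 1 - l)) (Suc x) else -1)"
proof -
  let ?u = "nd j l s x"
  have x: "int x < B" using assms(4) K_B by simp
  have l: "int l < B" using assms(2) d_B by linarith
  have "0 \<le> ?u \<and> ?u < B * B * B * B"
  proof -
    have "int j < B" using assms(1) n_B by linarith
    then have "node (int j) (int l) (int s) < B * B * B \<and> 0 \<le> node (int j) (int l) (int s)"
      using node_range[of "int j" "int l" "int s"] l assms(3) by auto
    then have 1: "node (int j) (int l) (int s) + 1 \<le> B * B * B" "0 \<le> node (int j) (int l) (int s)" by auto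
    have "(node (int j) (int l) (int s) + 1) * B \<le> B * B * B * B"
      using 1 B by (intro mult_right_mono) auto
    moreover have "?u = node (int j) (int l) (int s) * B + int x" by (simp add: nd_def node_def)
    ultimately show ?thesis using 1 B x by (auto simp: algebra_simps)
  qed
  then show u: "0 \<le> ?u" "?u < N" using BN4 by auto
  have d1: "?u div B = node (int j) (int l) (int s)"
    unfolding nd_def node_def[of "int j" "int l"] using x by (intro node_div) auto
  then have d2: "?u div B div B = int j * B + int l" using assms(3) by (simp add: node_div)
  show md: "modt N b ?u = int x" using modt[OF u] x node_mod[of "int x"] by (simp add: nd_def)
  show second: "secondt N b ?u = int s" using secondt[OF u] assms(3) by (simp add: d1 node_mod)
  have higher: "highert N b ?u = int j * B + int l" using highert[OF u] d2 by simp
  have h: "0 \<le> int j * B + int l" "int j * B + int l < N"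
    using div_range[of ?u] div_range[of "?u div B"] u d2 B by auto
  show third: "thirdt N b ?u = int l"
    unfolding thirdt_def using u l B by (subst memo_nonrec) (simp_all add: look_def higher modt[OF h])
  show fourth: "fourtht N b ?u = int j"
    unfolding fourtht_def using u l B by (subst memo_nonrec) (simp_all add: look_def higher divt[OF h])
  show "goal2 N inp b ?u = of_bool (j = 0 \<and> s = m)"
    unfolding goal2_def using u by (subst memo_nonrec) (simp_all add: look_def second fourth inp_m)
  show "adv2 (int d) N b ?u =
      (if j = 0 then -1 else if 0 < l then nd j (l - 1) s x else nd (j - 1) d s 0)"
  proof -
    have "?u - B * B = nd j (l - 1) s x" if "0 < l"
      using that by (simp add: nd_def node_def of_nat_diff algebra_simps)
    moreover have "?u - B * (B * (B - int d)) - int x = nd (j - 1) d s 0" if "0 < j" "l = 0"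
      using that by (simp add: nd_def node_def of_nat_diff algebra_simps)
    moreover have "adv2 (int d) N b ?u = (if int j = 0 then -1 else if 0 < int l then ?u - B * B
        else ?u - B * (B * (B - int d)) - int x)"
      unfolding adv2_def
      by (subst memo_nonrec[OF u]) (simp only: look_def[of "fourtht N b"] look_def[of "thirdt N b"]
        look_def[of "modt N b"] look_def[of b] fourth third md b)
    ultimately show ?thesis by simp
  qed
  show "cost2 N inp b ?u = (if l = 0 then f (j - 1) x else 0)" if "0 < j"
  proof -
    have j: "j - 1 < n" "int j - 1 = int (j - 1)" using that assms(1) by auto
    have F: "inp (2 + int m + ((int m + 1) * (int j - 1) + int x)) = f (j - 1) x"
      unfolding j(2) by (rule inp_f[OF j(1) assms(4)])
    have "cost2 N inp b ?u = (if int l = 0 then f (j - 1) x else 0)"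
      unfolding cost2_def by (subst memo_nonrec[OF u]) (simp only: look_def third fourth md inp_m F)
    then show ?thesis by simp
  qed
  show "drop2 (int d) N inp b ?u = (if 0 < j \<and> 0 < l \<and> 0 < s div K ^ (d + 1 - l) mod K
      then nd j l (s + K ^ (d - l) - K ^ (d + 1 - l)) (Suc x) else -1)"
  proof -
    have e: "int d + 1 - int l = int (d + 1 - l)" "int d - int l = int (d - l)"
      using assms(2) by auto
    have dg: "digit2 N inp (int s) (int (d + 1 - l)) = int (s div K ^ (d + 1 - l) mod K)"
      using assms(3) by (intro digit2) auto
    have p: "powt N inp (int (d + 1 - l)) = int (K ^ (d + 1 - l))" "powt N inp (int (d - l)) = int (K ^ (d - l))"
      by (intro powt; simp)+
    have A: "?u - B * (int (K ^ (d + 1 - l)) - int (K ^ (d - l))) + 1 =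
        nd j l (s + K ^ (d - l) - K ^ (d + 1 - l)) (Suc x)" if "0 < s div K ^ (d + 1 - l) mod K"
    proof -
      \<comment> \<open>A positive digit at this exponent bounds the power by \<open>s\<close>, so
        the truncated difference is the integer one.\<close>
      have "K ^ (d + 1 - l) \<le> s"
      proof (rule ccontr)
        assume "\<not> K ^ (d + 1 - l) \<le> s"
        then have "s div K ^ (d + 1 - l) = 0" by (intro div_less) simp
        then show False using that by simp
      qed
      then have "int (s + K ^ (d - l) - K ^ (d + 1 - l)) = int s + int (K ^ (d - l)) - int (K ^ (d + 1 - l))"
        by linarith
      moreover have ring: "(q * B + z) * B + y - B * (p - p') + 1 = (q * B + (z + p' - p)) * B + (1 + y)"
        for q y z p p' :: int by (simp add: algebra_simps)
      ultimately show ?thesis unfolding nd_def node_def of_nat_Suc ring by presburger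
    qed
    have D: "drop2 (int d) N inp b ?u = (if 0 < int j \<and> 0 < int l \<and> int l \<le> int d \<and>
        0 < digit2 N inp (int s) (int (d + 1 - l))
        then ?u - B * (int (K ^ (d + 1 - l)) - int (K ^ (d - l))) + 1 else -1)"
      unfolding drop2_def
      by (subst memo_nonrec[OF u]) (simp only: look_def[of "fourtht N b"] look_def[of "thirdt N b"]
        look_def[of "secondt N b"] look_def[of b] second third fourth b e look_def[of "powt N inp"] p)
    show ?thesis
    proof (cases "0 < s div K ^ (d + 1 - l) mod K")
      case True
      then show ?thesis unfolding D A[OF True] dg of_nat_0_less_iff of_nat_le_iff
        using assms(2) by (simp only: simp_thms)
    next
      case False
      then show ?thesis unfolding D dg of_nat_0_less_iff by (simp only: simp_thms if_False)
    qed
  qed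
qed

abbreviation origin :: int where "origin \<equiv> start2 (int d) N inp b 0"

lemma start_node: "origin = nd n d (code r) 0"
proof -
  have "(\<Sum>i\<in>{0..<int m}. powt N inp (inp (2 + i))) = int (code r)"
    unfolding sum_int code_def of_nat_sum
  proof (intro sum.cong refl)
    fix i assume "i \<in> {..<m}"
    then show "powt N inp (inp (2 + int i)) = int (K ^ r i)" using r_d[of i] powt[of "r i"] inp_r[of i] by simp
  qed
  then show ?thesis
    using BN' B unfolding start2_def
    by (subst memo_nonrec) (auto simp: look_def b inp_m inp_n nd_def node_def algebra_simps)
qed

lemma code_r: "int (code r) < B"
  using r_d by (rule code_less)

sublocale paths N "goal2 N inp b" "adv2 (int d) N b" "cost2 N inp b" "drop2 (int d) N inp b" "start2 (int d) N inp b"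
proof
  fix u :: int assume u: "0 \<le> u" "u < N"
  have "0 < B * (B * (B - int d))" using B d_B by simp
  moreover have "0 \<le> modt N b u" using modt[OF u] B by simp
  ultimately show "adv2 (int d) N b u < u"
    unfolding adv2_def using u B by (subst memo_nonrec) (auto simp: look_def b)
  let ?l = "thirdt N b u"
  \<comment> \<open>A drop adds 1 for \<open>x\<close> but removes at least \<open>B > 1\<close>
    through \<open>s\<close>, so the node number still falls.\<close>
  have "B * (powt N inp (int d + 1 - ?l) - powt N inp (int d - ?l)) > 1" if "0 < ?l" "?l \<le> int d"
  proof -
    define e where "e = nat (int d - ?l)"
    have e: "int d - ?l = int e" "int d + 1 - ?l = int (Suc e)" "Suc e \<le> d + 1" using that by (auto simp: e_def)
    have "int (K ^ Suc e) - int (K ^ e) = int m * int (K ^ e)" by (simp add: algebra_simps)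
    moreover have "1 * 1 \<le> int m * int (K ^ e)" using pos by (intro mult_mono) auto
    ultimately have "B * 1 \<le> B * (int (K ^ Suc e) - int (K ^ e))" using B by (intro mult_left_mono) auto
    then have "1 < B * (int (K ^ Suc e) - int (K ^ e))" using B by linarith
    moreover have "powt N inp (int e) = int (K ^ e)" "powt N inp (int (Suc e)) = int (K ^ Suc e)"
      using e(3) by (intro powt; simp)+
    ultimately show ?thesis unfolding e(1,2) by (simp only:)
  qed
  then show "drop2 (int d) N inp b u < u"
    unfolding drop2_def using u
    by (subst memo_nonrec) (simp_all add: look_def[of "fourtht N b"] look_def[of "thirdt N b"]
      look_def[of "powt N inp"] look_def[of b] b)
  assume "goal2 N inp b u = 1"
  then have "fourtht N b u = 0"
    using u unfolding goal2_def by (subst (asm) memo_nonrec) (auto simp: look_def)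
  then show "adv2 (int d) N b u < 0 \<and> drop2 (int d) N inp b u < 0"
    unfolding adv2_def drop2_def using u by (subst memo_nonrec; simp add: look_def)+
next
  show "0 \<le> origin" "origin < N"
    unfolding start_node using nd(1,2)[of n d "code r" 0] code_r by simp_all
qed

lemma drop_code:
  assumes j: "0 < j" "j \<le> n" and l: "0 < l" "l \<le> d" and \<rho>: "\<And>i. i < m \<Longrightarrow> \<rho> i \<le> d"
    and x: "x \<le> m" and i: "i < m" "\<rho> i = d + 1 - l"
  shows "drop2 (int d) N inp b (nd j l (code \<rho>) x) = nd j l (code (\<rho>(i := d - l))) (Suc x)"
proof -
  have "code \<rho> div K ^ (d + 1 - l) mod K > 0"
    unfolding code_digit card_gt_0_iff using i by auto
  moreover have "code \<rho> + K ^ (d - l) - K ^ (d + 1 - l) = code (\<rho>(i := d - l))"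
    using code_dec[OF i(1), of \<rho> "d - l"] i(2) l by (simp add: Suc_diff_le)
  ultimately show ?thesis using nd(10)[OF j(2) l(2) code_less[of \<rho>, OF \<rho>] x] j(1) l(1) by simp
qed

text \<open>The rows in \<open>Y\<close> share one remaining sum, so free moves at the same level
  can serve them one by one.\<close>

lemma walk_drop:
  assumes j: "0 < j" "j \<le> n" and l: "0 < l" "l \<le> d" and \<rho>: "\<And>i. i < m \<Longrightarrow> \<rho> i \<le> d"
    and "finite Y" "Y \<subseteq> {i. i < m \<and> \<rho> i = d + 1 - l}" "x + card Y \<le> m"
    "walk (nd j l (code (\<lambda>i. \<rho> i - of_bool (i \<in> Y))) (x + card Y)) c"
  shows "walk (nd j l (code \<rho>) x) c"
  using assms(6-)
proof (induction Y rule: finite_induct)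
  case empty
  then show ?case by simp
next
  case (insert i Y)
  let ?\<rho> = "\<lambda>i. \<rho> i - of_bool (i \<in> Y)"
  have i: "i < m" "\<rho> i = d + 1 - l" using insert.prems by auto
  have x: "x + card Y \<le> m" and cd: "x + card (insert i Y) = Suc (x + card Y)" using insert by auto
  have \<rho>': "?\<rho> i \<le> d" if "i < m" for i using \<rho>[OF that] by simp
  have i': "?\<rho> i = d + 1 - l" using i insert.hyps by simp
  have "code (?\<rho>(i := d - l)) = code (\<lambda>k. \<rho> k - of_bool (k \<in> insert i Y))"
    using i insert.hyps l by (intro code_cong) auto
  then have eq: "drop2 (int d) N inp b (nd j l (code ?\<rho>) (x + card Y)) =
      nd j l (code (\<lambda>k. \<rho> k - of_bool (k \<in> insert i Y))) (x + card (insert i Y))"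
    using drop_code[where \<rho> = ?\<rho>, OF j l \<rho>' x i(1) i'] cd by simp
  have u: "0 \<le> nd j l (code ?\<rho>) (x + card Y)" "nd j l (code ?\<rho>) (x + card Y) < N"
    using nd(1,2)[OF j(2) l(2) code_less[of ?\<rho>, OF \<rho>'] x] by simp_all
  have "walk (nd j l (code ?\<rho>) (x + card Y)) c"
    by (rule walk_s2[OF u]) (unfold eq, fact insert.prems(3))
  moreover have "Y \<subseteq> {i. i < m \<and> \<rho> i = d + 1 - l}" using insert.prems(1) by simp
  ultimately show ?case using x by (intro insert.IH)
qed

lemma walk_feasible:
  assumes A: "feasible m n r A"
  shows "walk origin (objective f A)"
proof -
  have dim: "dim_row A = m" "dim_col A = n" using A by (auto simp: feasible_def)
  \<comment> \<open>\<open>rem j\<close> is what the columns below \<open>j\<close> still give to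
    each row. \<open>part j l\<close> and \<open>cx j l\<close> describe the middle of column
    \<open>j\<close>: its rows with remaining sum below \<open>d + 1 - l\<close>, belonging to
    levels above \<open>l\<close>, have been served.\<close>
  define rem where "rem j i = (\<Sum>c<j. A $$ (i, c))" for j i
  define part where "part j l i = rem (Suc j) i - of_bool (A $$ (i, j) = 1 \<and> rem (Suc j) i < d + 1 - l)" for j l i
  define cx where "cx j l = card {i. i < m \<and> A $$ (i, j) = 1 \<and> rem (Suc j) i < d + 1 - l}" for j l
  have A01: "A $$ (i, j) = 0 \<or> A $$ (i, j) = 1" if "i < m" "j < n" for i j
    using feasible_entry[OF A that] .
  have rem_n: "rem n i = r i" if "i < m" for i
    using A that unfolding feasible_def row_sum_def rem_def dim by auto
  have rem_d: "rem j i \<le> d" if "i < m" "j \<le> n" for i j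
  proof -
    have "rem j i \<le> rem n i" unfolding rem_def using that by (intro sum_mono2) auto
    then show ?thesis using rem_n[OF that(1)] r_d[OF that(1)] by simp
  qed
  have cx_m: "cx j l \<le> m" for j l
  proof -
    have "cx j l \<le> card {..<m}" unfolding cx_def by (intro card_mono) auto
    then show ?thesis by simp
  qed
  \<comment> \<open>Levels fall along the walk, so induction on \<open>l\<close> extends the walk at
    its front: at level \<open>Suc l\<close> the rows \<open>?Y\<close> are served, then the walk
    advances to level \<open>l\<close>.\<close>
  have step: "l \<le> d \<Longrightarrow> walk (nd (Suc j) l (code (part j l)) (cx j l)) (f j (col_sum A j) + c)"
    if j: "j < n" and c: "walk (nd j d (code (rem j)) 0) c" for j l c
  proof (induction l)
    case 0
    have "code (part j 0) = code (rem j)"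
    proof (rule code_cong)
      fix i assume i: "i < m"
      show "part j 0 i = rem j i" using A01[OF i j] rem_d[OF i, of "Suc j"] j by (auto simp: part_def rem_def)
    qed
    moreover have "cx j 0 = col_sum A j"
    proof -
      have "col_sum A j = (\<Sum>i<m. of_bool (A $$ (i, j) = 1))"
        unfolding col_sum_def dim using A01[OF _ j] by (intro sum.cong) fastforce+
      also have "\<dots> = card {i. i < m \<and> A $$ (i, j) = 1}"
        by (subst sum_of_bool_eq) (auto intro!: arg_cong[where f = card])
      also have "{i. i < m \<and> A $$ (i, j) = 1} = {i. i < m \<and> A $$ (i, j) = 1 \<and> rem (Suc j) i < d + 1 - 0}"
        using rem_d[of _ "Suc j"] j by fastforce
      finally show ?thesis by (simp add: cx_def)
    qed
    moreover have "walk (nd (Suc j) 0 (code (rem j)) (cx j 0)) (f j (cx j 0) + c)"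
    proof -
      have "int (code (rem j)) < B" using rem_d[of _ j] j by (intro code_less) auto
      then have u: "0 \<le> nd (Suc j) 0 (code (rem j)) (cx j 0)" "nd (Suc j) 0 (code (rem j)) (cx j 0) < N"
        "adv2 (int d) N b (nd (Suc j) 0 (code (rem j)) (cx j 0)) = nd j d (code (rem j)) 0"
        "cost2 N inp b (nd (Suc j) 0 (code (rem j)) (cx j 0)) = f j (cx j 0)"
        using nd(1,2,8,9)[of "Suc j" 0 "code (rem j)" "cx j 0"] cx_m[of j 0] j by simp_all
      have "walk (adv2 (int d) N b (nd (Suc j) 0 (code (rem j)) (cx j 0))) c" unfolding u(3) by (rule c)
      from walk_s1[OF u(1,2) this] show ?thesis unfolding u(4) .
    qed
    ultimately show ?case by simp
  next
    case (Suc l)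
    let ?Y = "{i. i < m \<and> A $$ (i, j) = 1 \<and> rem (Suc j) i = d - l}"
    have part_d: "part j l i \<le> d" if "i < m" for l i
      using rem_d[OF that, of "Suc j"] j by (simp add: part_def)
    have code_eq: "code (part j l) = code (\<lambda>i. part j (Suc l) i - of_bool (i \<in> ?Y))"
      using Suc.prems by (intro code_cong) (auto simp: part_def)
    have "{i. i < m \<and> A $$ (i, j) = 1 \<and> rem (Suc j) i < d + 1 - l} =
        {i. i < m \<and> A $$ (i, j) = 1 \<and> rem (Suc j) i < d + 1 - Suc l} \<union> ?Y"
      using Suc.prems by auto
    moreover have "card ({i. i < m \<and> A $$ (i, j) = 1 \<and> rem (Suc j) i < d + 1 - Suc l} \<union> ?Y) =
        card {i. i < m \<and> A $$ (i, j) = 1 \<and> rem (Suc j) i < d + 1 - Suc l} + card ?Y"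
      by (rule card_Un_disjoint) auto
    ultimately have cx_eq: "cx j l = cx j (Suc l) + card ?Y" unfolding cx_def by (simp only:)
    have "walk (nd (Suc j) l (code (part j l)) (cx j l)) (f j (col_sum A j) + c)"
      using Suc by simp
    moreover have "int (code (part j l)) < B" using part_d by (rule code_less)
    then have u: "0 \<le> nd (Suc j) (Suc l) (code (part j l)) (cx j l)"
        "nd (Suc j) (Suc l) (code (part j l)) (cx j l) < N"
        "adv2 (int d) N b (nd (Suc j) (Suc l) (code (part j l)) (cx j l)) = nd (Suc j) l (code (part j l)) (cx j l)"
        "cost2 N inp b (nd (Suc j) (Suc l) (code (part j l)) (cx j l)) = 0"
      using nd(1,2,8,9)[of "Suc j" "Suc l" "code (part j l)" "cx j l"] Suc.prems j cx_m[of j l] by simp_all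
    ultimately have "walk (nd (Suc j) (Suc l) (code (part j l)) (cx j l)) (f j (col_sum A j) + c)"
      using walk_s1[OF u(1,2), unfolded u(3,4)] by simp
    then have w: "walk (nd (Suc j) (Suc l) (code (\<lambda>i. part j (Suc l) i - of_bool (i \<in> ?Y)))
        (cx j (Suc l) + card ?Y)) (f j (col_sum A j) + c)"
      unfolding code_eq cx_eq .
    show ?case
    proof (rule walk_drop[OF _ _ _ _ _ _ _ _ w])
      show "?Y \<subseteq> {i. i < m \<and> part j (Suc l) i = d + 1 - Suc l}" by (auto simp: part_def)
      show "cx j (Suc l) + card ?Y \<le> m" using cx_m[of j l] cx_eq by simp
      show "part j (Suc l) i \<le> d" if "i < m" for i using that by (rule part_d)
    qed (use Suc.prems j in simp_all)
  qed
  have "j \<le> n \<Longrightarrow> walk (nd j d (code (rem j)) 0) (\<Sum>c<j. f c (col_sum A c))" for j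
  proof (induction j)
    case 0
    have "code (rem 0) = m" by (simp add: code_def rem_def)
    moreover have "0 \<le> nd 0 d m 0" "nd 0 d m 0 < N" "goal2 N inp b (nd 0 d m 0) = 1"
      using nd(1,2,7)[of 0 d m 0] K_B by simp_all
    then have "walk (nd 0 d m 0) 0" by (rule walk_goal)
    ultimately show ?case by simp
  next
    case (Suc j)
    then have j: "j < n" and IH: "walk (nd j d (code (rem j)) 0) (\<Sum>c<j. f c (col_sum A c))" by simp_all
    \<comment> \<open>A one in column \<open>j\<close> makes \<open>rem (Suc j) i\<close> positive,
      so nothing has been served yet at level \<open>d\<close>.\<close>
    have no: "\<not> (A $$ (i, j) = 1 \<and> rem (Suc j) i < d + 1 - d)" for i by (auto simp: rem_def)
    have "code (part j d) = code (rem (Suc j))" using no by (intro code_cong) (auto simp: part_def)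
    moreover have "cx j d = 0" unfolding cx_def using no by simp
    ultimately show ?case using step[OF j IH, of d] by (simp add: add.commute)
  qed
  from this[of n] have "walk (nd n d (code (rem n)) 0) (\<Sum>c<n. f c (col_sum A c))" by simp
  moreover have "code (rem n) = code r" using rem_n by (rule code_cong)
  ultimately show ?thesis unfolding start_node objective_def dim by simp
qed

lemma ok_start: "ok origin = 1"
  using walk_best[OF walk_feasible] feasible_exists[of m r n] r_n by blast

section \<open>Reading a matrix off the computed path\<close>

definition pk :: "nat \<Rightarrow> int" where
  "pk t = pick2 (int d) N inp b (int t)"

definition picks :: "nat \<Rightarrow> nat \<Rightarrow> nat" where
  "picks t i = (\<Sum>t'<t. of_bool (pk t' = int i))"

text \<open>A count of picks; that it never exceeds 1 is part of the invariant.\<close>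

definition a :: "nat \<Rightarrow> nat \<Rightarrow> nat \<Rightarrow> nat" where
  "a t i c = (\<Sum>t'<t. of_bool (pk t' = int i \<and> fourtht N b (path (int t')) = int c + 1))"

lemma picks_Suc: "picks (Suc t) i = picks t i + of_bool (pk t = int i)"
  by (simp add: picks_def)

lemma a_Suc: "a (Suc t) i c = a t i c + of_bool (pk t = int i \<and> fourtht N b (path (int t)) = int c + 1)"
  by (simp add: a_def)

text \<open>Entries not yet written read as 0 and would pass for picks of row 0; the guard
  \<open>t' < int t\<close> discards them.\<close>

lemma sum_before:
  assumes "int t \<le> N"
  shows "(\<Sum>t'\<in>{0..<N}. of_bool (t' < int t \<and> (if 0 \<le> t' \<and> t' < int t then G t' else 0) = y) :: int) =
    (\<Sum>t'<t. of_bool (G (int t') = y))"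
proof -
  have "(\<Sum>t'\<in>{0..<N}. of_bool (t' < int t \<and> (if 0 \<le> t' \<and> t' < int t then G t' else 0) = y) :: int) =
      (\<Sum>t'\<in>{0..<int t}. of_bool (G t' = y))"
    by (rule sum.mono_neutral_cong_right) (use assms in auto)
  then show ?thesis by (simp only: sum_int)
qed

lemma ball_int: "(\<forall>i\<in>{0..<int k}. P i) \<longleftrightarrow> (\<forall>i<k. P (int i))"
proof
  assume R: "\<forall>i<k. P (int i)"
  show "\<forall>i\<in>{0..<int k}. P i"
  proof
    fix i assume "i \<in> {0..<int k}"
    then have "nat i < k" "int (nat i) = i" by auto
    then show "P i" using R by metis
  qed
qed auto

lemma pk_eq:
  assumes "int t < N"
  shows "pk t = (if goal2 N inp b (path (int t)) = 1 \<or> tk (path (int t)) = 1 then -1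
    else \<Sum>i<m. of_bool (\<forall>i'<m. i' \<le> i \<longrightarrow>
      \<not> inp (2 + int i') - int (picks t i') = int d + 1 - thirdt N b (path (int t))))"
proof -
  have N: "int t \<le> N" using assms by simp
  have t0: "0 \<le> int t" by simp
  have path_eq: "patht N (goal2 N inp b) (adv2 (int d) N b) (drop2 (int d) N inp b)
      (start2 (int d) N inp b) tk = path"
    and tk_eq': "tk2 (int d) N inp b = tk"
    by (simp_all add: path_def tk_def best_def ok_def)
  have "pk t = (if goal2 N inp b (path (int t)) = 1 \<or> tk (path (int t)) = 1 then -1
    else \<Sum>i\<in>{0..<int m}. of_bool (\<forall>i'\<in>{0..<int m}. i' \<le> i \<longrightarrow>
      \<not> inp (2 + i') - (\<Sum>t'<t. of_bool (pick2 (int d) N inp b (int t') = i')) =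
        int d + 1 - thirdt N b (path (int t))))"
    unfolding pk_def
    by (subst (1) pick2_def, subst memo_rec[OF t0 assms], subst pick2_def[symmetric])
      (simp only: look_def path_eq tk_eq' inp_m sum_before[OF N])
  then show ?thesis by (simp only: sum_int ball_int pk_def picks_def of_nat_sum of_nat_of_bool of_nat_le_iff)
qed

text \<open>\<open>\<rho>\<close> distributes the counts stored in the node over actual rows. A row
  already used in the column in work satisfies \<open>\<rho> i + l \<le> d\<close>, so it lies below
  the sum \<open>d + 1 - l\<close> served next and is not picked again.\<close>

definition inv2 :: "nat \<Rightarrow> nat \<Rightarrow> nat \<Rightarrow> (nat \<Rightarrow> nat) \<Rightarrow> nat \<Rightarrow> bool" where
  "inv2 t j l \<rho> x \<longleftrightarrow> j \<le> n \<and> l \<le> d \<and> x \<le> m \<and> (\<forall>i<m. \<rho> i \<le> d) \<and>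
    path (int t) = nd j l (code \<rho>) x \<and>
    (\<forall>i<m. \<rho> i + picks t i = r i) \<and>
    (\<forall>i<m. (\<Sum>c<n. a t i c) = picks t i) \<and>
    (\<forall>i<m. \<forall>c. Suc c < j \<longrightarrow> a t i c = 0) \<and>
    (\<forall>i<m. 0 < j \<longrightarrow> a t i (j - 1) \<noteq> 0 \<longrightarrow> \<rho> i + l \<le> d) \<and>
    (\<forall>i<m. \<forall>c<n. a t i c \<le> 1) \<and>
    (0 < j \<longrightarrow> x = (\<Sum>i<m. a t i (j - 1))) \<and>
    spent t =
      (\<Sum>c\<in>{j..<n}. f c (\<Sum>i<m. a t i c))"

lemma path_invariant: "int t < N \<Longrightarrow> \<exists>j l \<rho> x. inv2 t j l \<rho> x"
proof (induction t)
  case 0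
  have "inv2 0 n d r 0"
    using r_d by (simp add: inv2_def path_0 start_node picks_def a_def)
  then show ?case by (intro exI)
next
  case (Suc t)
  then have tN: "int t < N" by simp
  from Suc obtain j l \<rho> x where i: "inv2 t j l \<rho> x" by auto
  from i have j: "j \<le> n" and l: "l \<le> d" and x: "x \<le> m" and \<rho>: "\<forall>i<m. \<rho> i \<le> d"
    and p: "path (int t) = nd j l (code \<rho>) x"
    and rem: "\<forall>i<m. \<rho> i + picks t i = r i"
    and row: "\<forall>i<m. (\<Sum>c<n. a t i c) = picks t i"
    and zero: "\<forall>i<m. \<forall>c. Suc c < j \<longrightarrow> a t i c = 0"
    and cur: "\<forall>i<m. 0 < j \<longrightarrow> a t i (j - 1) \<noteq> 0 \<longrightarrow> \<rho> i + l \<le> d"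
    and le1: "\<forall>i<m. \<forall>c<n. a t i c \<le> 1"
    and xs: "0 < j \<longrightarrow> x = (\<Sum>i<m. a t i (j - 1))"
    and cost: "spent t =
      (\<Sum>c\<in>{j..<n}. f c (\<Sum>i<m. a t i c))"
    unfolding inv2_def by blast+
  let ?u = "nd j l (code \<rho>) x"
  have "int (code \<rho>) < B" using \<rho> by (intro code_less) blast
  note u = nd[OF j l this x]
  have next': "path (int (Suc t)) = next_node ?u" using path_Suc[of t] Suc.prems p by simp
  have ok: "ok ?u = 1" using path_ok[OF ok_start tN] p by simp
  show ?case
  proof (cases "goal2 N inp b ?u = 1 \<or> tk ?u = 1")
    case True
    then have "pk t = -1" using pk_eq[OF tN] p by simp
    then have same: "picks (Suc t) = picks t" "a (Suc t) = a t"
      by (simp_all add: fun_eq_iff picks_Suc a_Suc)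
    show ?thesis
    proof (cases "goal2 N inp b ?u = 1")
      case True
      then have "tk ?u \<noteq> 1" by (rule tk_goal)
      then have cost': "spent (Suc t) =
        (\<Sum>c\<in>{j..<n}. f c (\<Sum>i<m. a t i c))" using cost by (simp add: p)
      have "path (int (Suc t)) = ?u" using next' True by (simp add: next_node_def)
      then have "inv2 (Suc t) j l \<rho> x"
        unfolding inv2_def same cost' using j l x \<rho> rem row zero cur le1 xs by (intro conjI refl)
      then show ?thesis by (intro exI)
    next
      case g: False
      with True have tk: "tk ?u = 1" by simp
      have "0 \<le> next_node ?u" using ok g by (rule next_node(1))
      then have nn: "0 < j" "next_node ?u = (if 0 < l then nd j (l - 1) (code \<rho>) x else nd (j - 1) d (code \<rho>) 0)"
        using tk g u(8) by (auto simp: next_node_def split: if_splits)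
      have c: "cost2 N inp b ?u = (if l = 0 then f (j - 1) x else 0)" using u(9)[OF nn(1)] .
      show ?thesis
      proof (cases "0 < l")
        case True
        have p': "path (int (Suc t)) = nd j (l - 1) (code \<rho>) x" using next' nn True by simp
        have cost': "spent (Suc t) =
          (\<Sum>c\<in>{j..<n}. f c (\<Sum>i<m. a t i c))" using cost True c by (simp add: p)
        have l': "l - 1 \<le> d" using l by simp
        have cur': "\<forall>i<m. 0 < j \<longrightarrow> a t i (j - 1) \<noteq> 0 \<longrightarrow> \<rho> i + (l - 1) \<le> d" using cur by fastforce
        have "inv2 (Suc t) j (l - 1) \<rho> x"
          unfolding inv2_def same cost' using j l' x \<rho> p' rem row zero cur' le1 xs by (intro conjI refl)
        then show ?thesis by (intro exI)
      next
        case False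
        have p': "path (int (Suc t)) = nd (j - 1) d (code \<rho>) 0" using next' nn False by simp
        have "{j - 1..<n} = insert (j - 1) {j..<n}" using nn(1) j by auto
        then have cost': "spent (Suc t) =
          (\<Sum>c\<in>{j - 1..<n}. f c (\<Sum>i<m. a t i c))"
          using cost False c tk xs nn(1) by (simp add: p)
        have j': "j - 1 \<le> n" using j by simp
        have zero': "\<forall>i<m. \<forall>c. Suc c < j - 1 \<longrightarrow> a t i c = 0" using zero by simp
        have 0: "a t i (j - 1 - 1) = 0" if "i < m" "0 < j - 1" for i using zero that by simp
        have cur': "\<forall>i<m. 0 < j - 1 \<longrightarrow> a t i (j - 1 - 1) \<noteq> 0 \<longrightarrow> \<rho> i + d \<le> d"
        proof (intro allI impI)
          fix i assume i: "i < m" "0 < j - 1" and "a t i (j - 1 - 1) \<noteq> 0"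
          from this(3) 0[OF i] show "\<rho> i + d \<le> d" by (rule notE)
        qed
        have xs': "0 < j - 1 \<longrightarrow> 0 = (\<Sum>i<m. a t i (j - 1 - 1))"
        proof
          assume "0 < j - 1"
          then have "\<forall>i\<in>{..<m}. a t i (j - 1 - 1) = 0" using 0[OF _ \<open>0 < j - 1\<close>] by simp
          then show "0 = (\<Sum>i<m. a t i (j - 1 - 1))" by (rule sum.neutral[symmetric])
        qed
        have "inv2 (Suc t) (j - 1) d \<rho> 0"
          unfolding inv2_def same cost' using j' order_refl[of d] le0[of m] \<rho> p' rem row zero' cur' le1 xs'
          by (intro conjI refl)
        then show ?thesis by (intro exI)
      qed
    qed
  next
    case False
    then have g: "goal2 N inp b ?u \<noteq> 1" and tk: "tk ?u \<noteq> 1" by simp_all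
    have "0 \<le> next_node ?u" using ok g by (rule next_node(1))
    then have nn: "0 < j" "0 < l" "0 < code \<rho> div K ^ (d + 1 - l) mod K" "next_node ?u = drop2 (int d) N inp b ?u"
      using tk g u(10) by (auto simp: next_node_def split: if_splits)
    \<comment> \<open>The positive digit guarantees a row with the required remaining sum. Every
      such row leads to the same code, so picking the first one is consistent with the path.\<close>
    from nn(3) have "card {i. i < m \<and> \<rho> i = d + 1 - l} > 0" unfolding code_digit .
    then obtain i1 where i1: "i1 < m" "\<rho> i1 = d + 1 - l" unfolding card_gt_0_iff by auto
    have Q: "inp (2 + int i') - int (picks t i') = int d + 1 - thirdt N b (path (int t)) \<longleftrightarrow> \<rho> i' = d + 1 - l"
      if "i' < m" for i'
    proof -
      have "\<rho> i' + picks t i' = r i'" using rem that by blast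
      then have "int (r i') = int (\<rho> i') + int (picks t i')" by linarith
      then show ?thesis unfolding inp_r[OF that] p u(5) using l by linarith
    qed
    have "pk t = (\<Sum>i<m. of_bool (\<forall>i'<m. i' \<le> i \<longrightarrow>
      \<not> inp (2 + int i') - int (picks t i') = int d + 1 - thirdt N b (path (int t))))"
      using pk_eq[OF tN] g tk p by simp
    also have "\<dots> = (\<Sum>i<m. of_bool (\<forall>i'<m. i' \<le> i \<longrightarrow> \<not> \<rho> i' = d + 1 - l))"
      by (intro sum.cong refl arg_cong[where f = of_bool] iff_allI imp_cong) (simp_all only: Q)
    finally have pk': "pk t = (\<Sum>i<m. of_bool (\<forall>i'<m. i' \<le> i \<longrightarrow> \<not> \<rho> i' = d + 1 - l))" .
    obtain i0 where i0: "i0 < m" "\<rho> i0 = d + 1 - l"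
      "(\<Sum>i<m. of_bool (\<forall>i'<m. i' \<le> i \<longrightarrow> \<not> \<rho> i' = d + 1 - l) :: int) = int i0"
      by (rule first_index[where Q = "\<lambda>i. \<rho> i = d + 1 - l", OF i1]) (rule that)
    have pk: "pk t = int i0" using pk' i0(3) by simp
    define \<rho>' where "\<rho>' = \<rho>(i0 := d - l)"
    have picks': "picks (Suc t) i = picks t i + of_bool (i = i0)" for i
      unfolding picks_Suc pk by auto
    have a': "a (Suc t) i c = a t i c + of_bool (i = i0 \<and> c = j - 1)" for i c
      unfolding a_Suc pk p u(6) using nn(1) by auto
    have a0: "a t i0 (j - 1) = 0" using cur i0 nn l by fastforce
    have p': "path (int (Suc t)) = nd j l (code \<rho>') (Suc x)"
      unfolding next' nn(4) \<rho>'_def using nn j l \<rho> x i0 by (intro drop_code) auto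
    have xs': "Suc x = (\<Sum>i<m. a (Suc t) i (j - 1))"
    proof -
      have "(\<Sum>i<m. a (Suc t) i (j - 1)) = (\<Sum>i<m. a t i (j - 1)) + (\<Sum>i<m. of_bool (i = i0))"
        unfolding a' by (simp add: sum.distrib)
      also have "(\<Sum>i<m. of_bool (i = i0)) = (1 :: nat)" using i0(1) by (simp add: of_bool_def)
      finally show ?thesis using xs nn(1) by simp
    qed
    have le1': "\<forall>i<m. \<forall>c<n. a (Suc t) i c \<le> 1" using le1 a0 unfolding a' by auto
    have jn: "j - 1 < n" using nn(1) j by simp
    \<comment> \<open>That \<open>x\<close> stays at most \<open>m\<close> is a consequence of each
      row being used at most once per column.\<close>
    have "Suc x \<le> (\<Sum>i<m. 1)" unfolding xs' using le1' jn by (intro sum_mono) auto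
    then have x': "Suc x \<le> m" by simp
    have row': "\<forall>i<m. (\<Sum>c<n. a (Suc t) i c) = picks (Suc t) i"
    proof (intro allI impI)
      fix i assume "i < m"
      have "(\<Sum>c<n. a (Suc t) i c) = (\<Sum>c<n. a t i c) + (\<Sum>c<n. of_bool (i = i0 \<and> c = j - 1))"
        unfolding a' by (simp add: sum.distrib)
      also have "(\<Sum>c<n. of_bool (i = i0 \<and> c = j - 1)) = (of_bool (i = i0) :: nat)"
        using jn by (simp add: of_bool_def)
      finally show "(\<Sum>c<n. a (Suc t) i c) = picks (Suc t) i" using row \<open>i < m\<close> picks' by simp
    qed
    have rem': "\<forall>i<m. \<rho>' i + picks (Suc t) i = r i"
    proof (intro allI impI)
      fix i assume "i < m"
      then have "\<rho> i + picks t i = r i" using rem by blast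
      then show "\<rho>' i + picks (Suc t) i = r i" using i0(2) l unfolding \<rho>'_def picks' by auto
    qed
    have \<rho>d: "\<forall>i<m. \<rho>' i \<le> d" using \<rho> by (simp add: \<rho>'_def)
    have zero': "\<forall>i<m. \<forall>c. Suc c < j \<longrightarrow> a (Suc t) i c = 0" using zero unfolding a' by auto
    have cur': "\<forall>i<m. 0 < j \<longrightarrow> a (Suc t) i (j - 1) \<noteq> 0 \<longrightarrow> \<rho>' i + l \<le> d"
      using cur l unfolding a' \<rho>'_def by auto
    have "(\<Sum>c\<in>{j..<n}. f c (\<Sum>i<m. a (Suc t) i c)) = (\<Sum>c\<in>{j..<n}. f c (\<Sum>i<m. a t i c))"
    proof (rule sum.cong[OF refl])
      fix c assume "c \<in> {j..<n}"
      then have "a (Suc t) i c = a t i c" for i unfolding a' using nn(1) by auto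
      then show "f c (\<Sum>i<m. a (Suc t) i c) = f c (\<Sum>i<m. a t i c)" by simp
    qed
    then have cost': "spent (Suc t) =
        (\<Sum>c\<in>{j..<n}. f c (\<Sum>i<m. a (Suc t) i c))" using cost tk by (simp add: p)
    have "inv2 (Suc t) j l \<rho>' (Suc x)"
      unfolding inv2_def using j l x' \<rho>d p' rem' row' zero' cur' le1' xs' cost' by (intro conjI impI)
    then show ?thesis by (intro exI)
  qed
qed

definition M :: "nat \<Rightarrow> nat \<Rightarrow> nat" where
  "M i c = a (nat (N - 1)) i c"

lemma M_props:
  shows "\<And>i c. i < m \<Longrightarrow> c < n \<Longrightarrow> M i c \<le> 1"
    and "\<And>i. i < m \<Longrightarrow> (\<Sum>c<n. M i c) = r i"
    and "(\<Sum>c<n. f c (\<Sum>i<m. M i c)) = best origin"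
proof -
  let ?t = "nat (N - 1)"
  have t: "int ?t = N - 1" "int ?t < N" using BN' B by simp_all
  from path_invariant[OF t(2)] obtain j l \<rho> x where i: "inv2 ?t j l \<rho> x" by blast
  from i have j: "j \<le> n" and l: "l \<le> d" and x: "x \<le> m" and \<rho>: "\<forall>i<m. \<rho> i \<le> d"
    and p: "path (int ?t) = nd j l (code \<rho>) x"
    and rem: "\<forall>i<m. \<rho> i + picks ?t i = r i"
    and row: "\<forall>i<m. (\<Sum>c<n. a ?t i c) = picks ?t i"
    and le1: "\<forall>i<m. \<forall>c<n. a ?t i c \<le> 1"
    and cost: "spent ?t =
      (\<Sum>c\<in>{j..<n}. f c (\<Sum>i<m. a ?t i c))"
    unfolding inv2_def by blast+
  have goal: "goal2 N inp b (path (int ?t)) = 1" using path_goal[OF ok_start] t(1) by simp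
  have "int (code \<rho>) < B" using \<rho> by (intro code_less) blast
  from nd(7)[OF j l this x] goal p have 0: "j = 0" "code \<rho> = m" by (simp_all split: if_splits)
  \<comment> \<open>The code is a sum of \<open>m\<close> powers, each at least 1, so the value
    \<open>m\<close> forces all exponents to be 0.\<close>
  have \<rho>0: "\<rho> i = 0" if "i < m" for i
  proof (rule ccontr)
    assume "\<rho> i \<noteq> 0"
    then obtain q where "\<rho> i = Suc q" using not0_implies_Suc by blast
    then have "1 < K ^ \<rho> i" using pos by (intro one_less_power) auto
    then have "(\<Sum>i<m. 1) < code \<rho>" unfolding code_def using that by (intro sum_strict_mono_ex1) auto
    then show False using 0(2) by simp
  qed
  show "M i c \<le> 1" if "i < m" "c < n" for i c using le1 that by (simp add: M_def)
  show "(\<Sum>c<n. M i c) = r i" if "i < m" for i using rem row \<rho>0 that by (simp add: M_def)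
  have "best (path (int ?t)) = 0"
    using best_rec[of "path (int ?t)"] path_range[OF ok_start t(2)] goal unfolding t(1) by simp
  then have "best origin = (\<Sum>c\<in>{j..<n}. f c (\<Sum>i<m. a ?t i c))"
    using path_cost[OF ok_start t(2)] cost by simp
  also have "{j..<n} = {..<n}" using 0(1) by auto
  finally show "(\<Sum>c<n. f c (\<Sum>i<m. M i c)) = best origin" by (simp add: M_def)
qed

lemma out2:
  assumes "i < m" "c < n"
  shows "out2 (int d) N inp b (int (i * n + c)) = int (M i c)"
proof -
  let ?p = "int (i * n + c)"
  let ?t = "nat (N - 1)"
  have N: "N = int (Suc ?t)" using BN' B by simp
  have "i * n + c < Suc i * n" using assms(2) by simp
  also have "\<dots> \<le> m * n" using assms(1) by (intro mult_le_mono1) simp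
  finally have p: "0 \<le> ?p" "?p < N" "?p \<le> N" using mn_N by linarith+
  have n: "0 < int n" "int n \<le> N" using pos n_B BN' by linarith+
  have "tdiv N ?p (int n) = int ((i * n + c) div n)"
    using tdiv_eq[OF p(1) p(3) n] by (simp only: zdiv_int)
  also have "(i * n + c) div n = i" using assms(2) by simp
  finally have row: "tdiv N ?p (int n) = int i" .
  have path_eq: "patht N (goal2 N inp b) (adv2 (int d) N b) (drop2 (int d) N inp b)
      (start2 (int d) N inp b) (tk2 (int d) N inp b) = path"
    by (simp add: path_def tk_def best_def ok_def)
  have col: "?p - int n * int i + 1 = int c + 1" by (simp add: mult.commute)
  have "goal2 N inp b (path (int ?t)) = 1" using path_goal[OF ok_start] BN' B by simp
  then have "pk ?t = -1" using pk_eq[of ?t] N by simp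
  then have last: "\<not> (pk ?t = int i \<and> fourtht N b (path (int ?t)) = int c + 1)" by simp
  have "out2 (int d) N inp b ?p = of_bool (\<exists>t\<in>{0..<N}. pick2 (int d) N inp b t = int i \<and>
      fourtht N b (path t) = int c + 1)"
    unfolding out2_def by (subst memo_nonrec[OF p(1,2)]) (simp only: look_def path_eq inp_n row col)
  also have "(\<exists>t\<in>{0..<N}. pick2 (int d) N inp b t = int i \<and> fourtht N b (path t) = int c + 1) \<longleftrightarrow>
      (\<exists>t<Suc ?t. pk t = int i \<and> fourtht N b (path (int t)) = int c + 1)"
    using ball_int[of "Suc ?t" "\<lambda>t. \<not> (pick2 (int d) N inp b t = int i \<and> fourtht N b (path t) = int c + 1)"]
    unfolding N[symmetric] pk_def by blast
  also have "\<dots> \<longleftrightarrow> (\<exists>t<?t. pk t = int i \<and> fourtht N b (path (int t)) = int c + 1)"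
    using last by (auto simp: less_Suc_eq)
  also have "\<dots> \<longleftrightarrow> M i c \<noteq> 0" unfolding M_def a_def by (auto simp: sum_eq_0_iff)
  also have "of_bool (M i c \<noteq> 0) = int (M i c)" using M_props(1)[OF assms] by (cases "M i c") auto
  finally show ?thesis .
qed

theorem optimal_matrix:
  "\<exists>A. optimal m n r f A \<and> map (\<lambda>i. out2 (int d) N inp b (int i)) [0..<m * n] = matrix_list A"
proof (intro exI conjI)
  let ?A = "mat m n (\<lambda>(i, c). M i c)"
  have "row_sum ?A i = r i" if "i < m" for i
  proof -
    have "row_sum ?A i = (\<Sum>c<n. M i c)" unfolding row_sum_def using that by (intro sum.cong) auto
    then show ?thesis using M_props(2)[OF that] by simp
  qed
  moreover have "elements_mat ?A \<subseteq> {0, 1}"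
  proof
    fix x assume "x \<in> elements_mat ?A"
    then obtain i c where ij: "i < m" "c < n" and x: "x = ?A $$ (i, c)" unfolding elements_mat_def by auto
    show "x \<in> {0, 1}" using M_props(1)[OF ij] ij unfolding x by auto
  qed
  ultimately have feas: "feasible m n r ?A" by (simp add: feasible_def)
  have col: "col_sum ?A c = (\<Sum>i<m. M i c)" if "c < n" for c
    unfolding col_sum_def using that by (intro sum.cong) auto
  have "objective f ?A = (\<Sum>c<n. f c (\<Sum>i<m. M i c))"
    unfolding objective_def using col by (intro sum.cong) auto
  also have "\<dots> = best origin" by (rule M_props(3))
  finally have "objective f ?A \<le> objective f A" if "feasible m n r A" for A
    using walk_best[OF walk_feasible[OF that]] by simp
  with feas show "optimal m n r f ?A" by (simp add: optimal_def)
  show "map (\<lambda>i. out2 (int d) N inp b (int i)) [0..<m * n] = matrix_list ?A"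
  proof (rule matrix_list_eq)
    show "out2 (int d) N inp b (int (i * n + j)) = int (?A $$ (i, j))" if "i < m" "j < n" for i j
      using out2[OF that] that by simp
  qed simp
qed

end

section \<open>The input\<close>

lemma concat_tables_nth:
  "j < length gs \<Longrightarrow> v \<le> m \<Longrightarrow>
    concat (map (\<lambda>g. map g [0..<Suc m]) gs) ! (Suc m * j + v) = (gs ! j) v"
proof (induction gs arbitrary: j)
  case (Cons g gs)
  show ?case
  proof (cases j)
    case 0
    then show ?thesis using Cons.prems by (simp add: nth_append del: upt_Suc)
  next
    case (Suc i)
    have "Suc m * j + v = Suc m + (Suc m * i + v)" by (simp add: Suc)
    then have "concat (map (\<lambda>g. map g [0..<Suc m]) (g # gs)) ! (Suc m * j + v) =
        concat (map (\<lambda>g. map g [0..<Suc m]) gs) ! (Suc m * i + v)"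
      by (simp only: list.map concat.simps nth_append length_map length_upt) (simp del: upt_Suc)
    then show ?thesis using Cons Suc by (simp del: upt_Suc)
  qed
qed simp

lemma length_concat_tables: "length (concat (map (\<lambda>g. map g [0..<Suc m]) gs)) = Suc m * length gs"
  by (induction gs) (simp_all del: upt_Suc)

abbreviation input :: "int list \<Rightarrow> int \<Rightarrow> int" where
  "input xs \<equiv> input_memory xs 0"

lemma input_nth: "k < length xs \<Longrightarrow> input xs (int k) = xs ! k"
  by (simp add: input_memory_def)

lemma input_dims:
  "input (instance_list m n r gs) 0 = int m" "input (instance_list m n r gs) 1 = int n"
  by (simp_all add: instance_list_def input_memory_def)

lemma input_row: "i < m \<Longrightarrow> input (instance_list m n r gs) (2 + int i) = int (r i)"
  using input_nth[of "Suc (Suc i)" "instance_list m n r gs"]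
  by (simp add: instance_list_def nth_append)

lemma input_value:
  assumes "j < length gs" "v \<le> m"
  shows "input (instance_list m n r gs) (2 + int m + ((int m + 1) * int j + int v)) = (gs ! j) v"
proof -
  let ?xs = "instance_list m n r gs"
  let ?k = "Suc (Suc (m + (Suc m * j + v)))"
  have "Suc m * j + v < Suc m * Suc j" using assms(2) by simp
  also have "\<dots> \<le> Suc m * length gs" using assms(1) by (intro mult_le_mono2) simp
  finally have "?k < length ?xs"
    by (simp add: instance_list_def length_concat_tables del: upt_Suc concat.simps)
  then have "input ?xs (int ?k) = ?xs ! ?k" by (rule input_nth)
  also have "?xs ! ?k = concat (map (\<lambda>g. map g [0..<Suc m]) gs) ! (Suc m * j + v)"
    by (simp add: instance_list_def nth_append del: upt_Suc mult_Suc)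
  also have "\<dots> = (gs ! j) v" using assms by (rule concat_tables_nth)
  also have "int ?k = 2 + int m + ((int m + 1) * int j + int v)" by (simp add: algebra_simps)
  finally show ?thesis .
qed

lemma mem_bd_input: "mem_bd (instance_size m n r gs) (input_memory (instance_list m n r gs))"
  unfolding mem_bd_def
proof (intro allI)
  fix a i
  let ?xs = "instance_list m n r gs"
  show "\<bar>input_memory ?xs a i\<bar> < 2 ^ instance_size m n r gs"
  proof (cases "a = 0 \<and> 0 \<le> i \<and> i < int (length ?xs)")
    case True
    then have "?xs ! nat i \<in> set ?xs" by (intro nth_mem) auto
    then have "int_size (?xs ! nat i) \<le> (\<Sum>x\<leftarrow>?xs. int_size x)" by (intro member_le_sum_list) auto
    then have "int_size (?xs ! nat i) \<le> instance_size m n r gs" by (simp add: instance_size_def)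
    then have "(2::int) ^ int_size (?xs ! nat i) \<le> 2 ^ instance_size m n r gs" by (intro power_increasing) auto
    then have "\<bar>?xs ! nat i\<bar> < 2 ^ instance_size m n r gs" using abs_less_int_size[of "?xs ! nat i"] by linarith
    then show ?thesis using True by (simp add: input_memory_def)
  next
    case False
    then show ?thesis by (auto simp: input_memory_def)
  qed
qed

text \<open>\<open>N0\<close> is a sum of two inputs and a constant, so it can be read off directly
  and then raised. The base of the digits becomes a constant table, read at index 0.\<close>

lemma avail_start:
  fixes enc :: "'i \<Rightarrow> int list" and nr nc :: "'i \<Rightarrow> nat" and q p :: nat
  assumes dims: "\<And>x. input (enc x) 0 = int (nr x)" "\<And>x. input (enc x) 1 = int (nc x)"
  defines "N0 \<equiv> \<lambda>x. int (nr x) + int (nc x) + 2"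
  shows "avail I enc (\<lambda>x. N0 x ^ (2 ^ p))
    {\<lambda>x. input (enc x), \<lambda>x. memo (N0 x ^ (2 ^ p)) (\<lambda>t u. N0 x ^ q)}"
proof -
  have N0: "1 \<le> N0 x" for x by (simp add: N0_def)
  have N0_eq: "N0 x = look (input (enc x)) 0 + look (input (enc x)) 1 + 2" for x
    by (simp add: N0_def look_def dims)
  have N0_le: "0 \<le> N0 x \<and> N0 x \<le> N0 x ^ (2 ^ p)" for x
    using N0[of x] self_le_power[of "N0 x" "2 ^ p"] by simp
  have "ready I enc N0 [\<lambda>x. input (enc x)]"
    by (rule ready_input[where E = "Plus (Plus (Get 0 (Lit 0)) (Get 0 (Lit 1))) (Lit 2)"])
      (simp_all add: dims N0_def)
  then have "ready I enc (\<lambda>x. N0 x ^ (2 ^ p)) [\<lambda>x. input (enc x)]" using N0 by (rule ready_power)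
  then have 1: "avail I enc (\<lambda>x. N0 x ^ (2 ^ p)) {\<lambda>x. input (enc x)}"
    unfolding avail_def by (intro exI conjI) auto
  have "comp (under (\<lambda>x. N0 x ^ (2 ^ p)) Ts) (\<lambda>e. N0 (fst (fst e)) ^ q)"
    if "{\<lambda>x. input (enc x)} \<subseteq> set Ts" for Ts
  proof (rule comp_power[OF lim_under])
    have "tabl (under (\<lambda>x. N0 x ^ (2 ^ p)) Ts) (\<lambda>e. input (enc (fst (fst e))))"
      using that by (intro tabl_under) simp
    then show "comp (under (\<lambda>x. N0 x ^ (2 ^ p)) Ts) (\<lambda>e. N0 (fst (fst e)))"
      unfolding N0_eq[abs_def] by (intro comp_add comp_look comp_const)
    show "0 \<le> N0 (fst (fst e)) \<and> N0 (fst (fst e)) \<le> N0 (fst (fst e)) ^ (2 ^ p)"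
      for e :: "('i \<times> table) \<times> int" by (rule N0_le)
  qed
  from avail_table[OF 1 this] show ?thesis by (simp add: insert_commute)
qed

lemma avail_solvable:
  fixes enc :: "'i \<Rightarrow> int list" and nr nc :: "'i \<Rightarrow> nat" and p :: nat
  assumes av: "avail I enc (\<lambda>x. (int (nr x) + int (nc x) + 2) ^ (2 ^ p)) {\<lambda>x. input (enc x), T}"
    and dims: "\<And>x. input (enc x) 0 = int (nr x)" "\<And>x. input (enc x) 1 = int (nc x)"
    and size: "\<And>x. nr x + nc x \<le> isize x"
    and len: "\<And>x. int (nr x * nc x) \<le> (int (nr x) + int (nc x) + 2) ^ (2 ^ p)"
    and bd: "\<And>x. mem_bd (isize x) (input_memory (enc x))"
    and sol: "\<And>x. x \<in> I \<Longrightarrow> sol x (map (\<lambda>i. T x (int i)) [0..<nr x * nc x])"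
  shows "poly_time_solvable I enc isize sol"
proof -
  let ?N = "\<lambda>x. (int (nr x) + int (nc x) + 2) ^ (2 ^ p)"
  from av obtain Ts where rdy: "ready I enc ?N Ts" and sub: "(\<lambda>x. input (enc x)) \<in> set Ts" "T \<in> set Ts"
    unfolding avail_def by auto
  have eq: "int (nr x * nc x) = look (input (enc x)) 0 * look (input (enc x)) 1" for x
    by (simp add: look_def dims)
  have "int (nr x) \<le> ?N x" for x
    using self_le_power[of "int (nr x) + int (nc x) + 2" "2 ^ p"] by simp
  then have "comp (rp ?N Ts) (\<lambda>x. int (nr x * nc x))"
    unfolding eq by (intro comp_mult[OF lim_rp] comp_look comp_const tabl_rp sub) (simp add: look_def dims)
  with rdy sub(2) show ?thesis
  proof (rule poly_time_solvableI[where q = "[:2, 1:] ^ (2 ^ p)"])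
    show "nat (?N x) \<le> poly ([:2, 1:] ^ (2 ^ p)) (isize x)" for x
    proof -
      have "nat (?N x) = (nr x + nc x + 2) ^ (2 ^ p)" by (simp add: nat_power_eq nat_add_distrib)
      also have "\<dots> \<le> (2 + isize x) ^ (2 ^ p)" using size[of x] by (intro power_mono) auto
      finally show ?thesis by (simp add: poly_power)
    qed
  qed (use len bd sol in \<open>simp_all add: nat_mult_distrib\<close>)
qed

lemma memo_const_0: "0 < N \<Longrightarrow> memo N (\<lambda>t u. c) 0 = c"
  by (rule memo_nonrec) simp_all

theorem theorem1p1:
  shows "poly_time_solvable
      {(m, n, r, f :: nat \<Rightarrow> int). row_data m n r}
      (\<lambda>(m, n, r, f). instance_list m n r [f])
      (\<lambda>(m, n, r, f). instance_size m n r [f])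
      (\<lambda>(m, n, r, f) out. \<exists>A. optimal m n r (\<lambda>j. f) A \<and> out = matrix_list A)
    \<and> (\<forall>b :: int. poly_time_solvable
      {(m, n, r, f :: nat \<Rightarrow> nat \<Rightarrow> int). row_data m n r \<and> (\<forall>i<m. int (r i) \<le> b)}
      (\<lambda>(m, n, r, f). instance_list m n r (map f [0..<n]))
      (\<lambda>(m, n, r, f). instance_size m n r (map f [0..<n]))
      (\<lambda>(m, n, r, f) out. \<exists>A. optimal m n r f A \<and> out = matrix_list A))"
proof (intro conjI allI)
  define nr :: "nat \<times> nat \<times> (nat \<Rightarrow> nat) \<times> (nat \<Rightarrow> int) \<Rightarrow> nat" where "nr x = fst x" for x
  define nc :: "nat \<times> nat \<times> (nat \<Rightarrow> nat) \<times> (nat \<Rightarrow> int) \<Rightarrow> nat" where "nc x = fst (snd x)" for x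
  let ?I = "{(m, n, r, f :: nat \<Rightarrow> int). row_data m n r}"
  let ?enc = "\<lambda>(m, n, r, f :: nat \<Rightarrow> int). instance_list m n r [f]"
  let ?S = "\<lambda>x. int (nr x) + int (nc x) + 2"
  \<comment> \<open>The base \<open>S ^ 2\<close> exceeds \<open>m * n\<close>, the largest possible
    total. Three digits need \<open>S ^ 6\<close>, and 8 is the next power of two.\<close>
  let ?N = "\<lambda>x. ?S x ^ (2 ^ 3)"
  let ?BT = "\<lambda>x. memo (?N x) (\<lambda>t u. ?S x ^ 2)"
  \<comment> \<open>True of every tuple, legal or not, as needed because bounds such as those in
    \<open>comp_sum\<close> are required of all environments.\<close>
  have dims: "input (?enc x) 0 = int (nr x)" "input (?enc x) 1 = int (nc x)" for x
    by (simp_all add: nr_def nc_def input_dims split: prod.split)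
  have N0: "2 \<le> ?S x" for x by simp
  have B: "?BT x 0 = ?S x ^ 2" for x by (rule memo_const_0) simp
  have le_N: "?S x ^ k \<le> ?N x" if "k \<le> 8" for x k using that by (intro power_increasing) auto
  have "avail ?I ?enc ?N {\<lambda>x. input (?enc x), ?BT}" using dims by (rule avail_start)
  then have av: "avail ?I ?enc ?N {\<lambda>x. input (?enc x), \<lambda>x. out1 (?N x) (input (?enc x)) (?BT x)}"
  proof (rule avail_case1)
    show "0 \<le> look (?BT x) 0 \<and> look (?BT x) 0 \<le> ?N x" for x
      unfolding look_def B using le_N[of 2 x] by simp
    show "look (input (?enc x)) 0 \<le> ?N x" "0 \<le> look (input (?enc x)) 1 \<and> look (input (?enc x)) 1 \<le> ?N x" for x
      unfolding look_def dims using le_N[of 1 x] by simp_all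
  qed
  have sq: "int (nr x * nc x) < ?S x ^ 2" for x
  proof -
    have "int (nr x) * int (nc x) < ?S x * ?S x" by (intro mult_strict_mono) auto
    then show ?thesis by (simp add: power2_eq_square)
  qed
  show "poly_time_solvable ?I ?enc (\<lambda>(m, n, r, f). instance_size m n r [f])
      (\<lambda>(m, n, r, f) out. \<exists>A. optimal m n r (\<lambda>j. f) A \<and> out = matrix_list A)"
  proof (rule avail_solvable[OF av dims])
    show "nr x + nc x \<le> (case x of (m, n, r, f) \<Rightarrow> instance_size m n r [f])" for x
      by (simp add: nr_def nc_def instance_size_def split: prod.split)
    show "int (nr x * nc x) \<le> ?N x" for x by (rule less_imp_le[OF less_le_trans[OF sq[of x] le_N[of 2 x]]]) simp
    show "mem_bd (case x of (m, n, r, f) \<Rightarrow> instance_size m n r [f]) (input_memory (?enc x))" for x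
      by (simp add: mem_bd_input split: prod.split)
  next
    fix x assume "x \<in> ?I"
    obtain m n r f where x: "x = (m, n, r, f)" by (cases x)
    with \<open>x \<in> ?I\<close> have rd: "row_data m n r" by simp
    have mn: "nr x = m" "nc x = n" by (simp_all add: x nr_def nc_def)
    interpret case1 "?N x" "?S x ^ 2" "?BT x" m n r f "input (?enc x)"
    proof
      show "?BT x 0 = ?S x ^ 2" by (rule B)
      have "2 ^ 2 \<le> ?S x ^ 2" using N0 by (rule power_mono) simp
      then show "1 < ?S x ^ 2" by simp
      show "?S x ^ 2 * ?S x ^ 2 * ?S x ^ 2 \<le> ?N x"
        unfolding power_add[symmetric] by (rule le_N) simp
      show "input (?enc x) 0 = int m" "input (?enc x) 1 = int n" using dims[of x] mn by simp_all
      show "input (?enc x) (2 + int i) = int (r i)" if "i < m" for i using that by (simp add: x input_row)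
      show "input (?enc x) (2 + int m + int v) = f v" if "v \<le> m" for v
        using input_value[of 0 "[f]" v m n r] that by (simp add: x)
      show "0 < m" "0 < n" "\<And>i. i < m \<Longrightarrow> r i \<le> n" using rd by (auto simp: row_data_def)
      show "int (m * n) < ?S x ^ 2" using sq[of x] mn by simp
    qed
    from optimal_matrix obtain A where A: "optimal m n r (\<lambda>j. f) A"
      "map (\<lambda>i. out1 (?N x) (input (?enc x)) (?BT x) (int i)) [0..<m * n] = matrix_list A"
      by (elim exE conjE) (rule that)
    have "[0..<nr x * nc x] = [0..<m * n]" by (simp only: mn)
    then show "(case x of (m, n, r, f) \<Rightarrow> \<lambda>out. \<exists>A. optimal m n r (\<lambda>j. f) A \<and> out = matrix_list A)
        (map (\<lambda>i. out1 (?N x) (input (?enc x)) (?BT x) (int i)) [0..<nr x * nc x])"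
      using A(1) by (simp only: A(2)) (auto simp: x)
  qed
next
  fix b :: int
  define nr :: "nat \<times> nat \<times> (nat \<Rightarrow> nat) \<times> (nat \<Rightarrow> nat \<Rightarrow> int) \<Rightarrow> nat" where "nr x = fst x" for x
  define nc :: "nat \<times> nat \<times> (nat \<Rightarrow> nat) \<times> (nat \<Rightarrow> nat \<Rightarrow> int) \<Rightarrow> nat" where "nc x = fst (snd x)" for x
  define d where "d = nat b"
  \<comment> \<open>\<open>S ^ q\<close> bounds \<open>(m + 1) ^ (d + 1)\<close> and exceeds
    \<open>n\<close> and \<open>d\<close>. Four digits need \<open>S ^ (4 * q)\<close>; the exponent
    \<open>2 ^ (4 * q)\<close> is a power of two above that and still a constant, as
    \<open>b\<close> is fixed.\<close>
  define q where "q = d + 2"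
  let ?I = "{(m, n, r, f :: nat \<Rightarrow> nat \<Rightarrow> int). row_data m n r \<and> (\<forall>i<m. int (r i) \<le> b)}"
  let ?enc = "\<lambda>(m, n, r, f :: nat \<Rightarrow> nat \<Rightarrow> int). instance_list m n r (map f [0..<n])"
  let ?S = "\<lambda>x. int (nr x) + int (nc x) + 2"
  let ?N = "\<lambda>x. ?S x ^ (2 ^ (4 * q))"
  let ?BT = "\<lambda>x. memo (?N x) (\<lambda>t u. ?S x ^ q)"
  have dims: "input (?enc x) 0 = int (nr x)" "input (?enc x) 1 = int (nc x)" for x
    by (simp_all add: nr_def nc_def input_dims split: prod.split)
  have N0: "2 \<le> ?S x" for x by simp
  have B: "?BT x 0 = ?S x ^ q" for x by (rule memo_const_0) simp
  have le_N: "?S x ^ k \<le> ?N x" if "k \<le> 4 * q" for x k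
  proof (rule power_increasing)
    have "4 * q < 2 ^ (4 * q)" by (rule less_exp)
    then show "k \<le> 2 ^ (4 * q)" using that by linarith
  qed simp
  have q2: "2 \<le> q" by (simp add: q_def)
  have "avail ?I ?enc ?N {\<lambda>x. input (?enc x), ?BT}" using dims by (rule avail_start)
  then have av: "avail ?I ?enc ?N {\<lambda>x. input (?enc x), \<lambda>x. out2 (int d) (?N x) (input (?enc x)) (?BT x)}"
  proof (rule avail_case2)
    show "0 \<le> look (?BT x) 0 \<and> look (?BT x) 0 \<le> ?N x" for x
      unfolding look_def B using le_N[of q x] by simp
    show "look (input (?enc x)) 0 \<le> ?N x" "0 \<le> look (input (?enc x)) 0 + 1 \<and> look (input (?enc x)) 0 + 1 \<le> ?N x"
      "0 \<le> look (input (?enc x)) 1 \<and> look (input (?enc x)) 1 \<le> ?N x" for x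
      unfolding look_def dims using le_N[of 1 x] q2 by simp_all
  qed
  have sq: "int (nr x * nc x) < ?S x ^ 2" for x
  proof -
    have "int (nr x) * int (nc x) < ?S x * ?S x" by (intro mult_strict_mono) auto
    then show ?thesis by (simp add: power2_eq_square)
  qed
  show "poly_time_solvable ?I ?enc (\<lambda>(m, n, r, f). instance_size m n r (map f [0..<n]))
      (\<lambda>(m, n, r, f) out. \<exists>A. optimal m n r f A \<and> out = matrix_list A)"
  proof (rule avail_solvable[OF av dims])
    show "nr x + nc x \<le> (case x of (m, n, r, f) \<Rightarrow> instance_size m n r (map f [0..<n]))" for x
      by (simp add: nr_def nc_def instance_size_def split: prod.split)
    show "int (nr x * nc x) \<le> ?N x" for x by (rule less_imp_le[OF less_le_trans[OF sq[of x] le_N[of 2 x]]]) (use q2 in simp)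
    show "mem_bd (case x of (m, n, r, f) \<Rightarrow> instance_size m n r (map f [0..<n])) (input_memory (?enc x))" for x
      by (simp add: mem_bd_input split: prod.split)
  next
    fix x assume "x \<in> ?I"
    obtain m n r f where x: "x = (m, n, r, f)" by (cases x)
    with \<open>x \<in> ?I\<close> have rd: "row_data m n r" and rb: "\<And>i. i < m \<Longrightarrow> int (r i) \<le> b" by auto
    have mn: "nr x = m" "nc x = n" by (simp_all add: x nr_def nc_def)
    interpret case2 "?N x" "?S x ^ q" "?BT x" m n d r f "input (?enc x)"
    proof
      show "?BT x 0 = ?S x ^ q" by (rule B)
      have "2 ^ q \<le> ?S x ^ q" using N0 by (rule power_mono) simp
      moreover have "int q < 2 ^ q" by (rule of_nat_less_two_power)
      ultimately show "1 < ?S x ^ q" "int d < ?S x ^ q" by (simp_all add: q_def)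
      show "?S x ^ q * ?S x ^ q * ?S x ^ q \<le> ?N x" "?S x ^ q * ?S x ^ q * ?S x ^ q * ?S x ^ q \<le> ?N x"
        unfolding power_add[symmetric] by (rule le_N; simp)+
      show "input (?enc x) 0 = int m" "input (?enc x) 1 = int n" using dims[of x] mn by simp_all
      show "input (?enc x) (2 + int i) = int (r i)" if "i < m" for i using that by (simp add: x input_row)
      show "input (?enc x) (2 + int m + ((int m + 1) * int j + int v)) = f j v" if "j < n" "v \<le> m" for j v
        using input_value[of j "map f [0..<n]" v m n r] that by (simp add: x)
      show "0 < m" "0 < n" "\<And>i. i < m \<Longrightarrow> r i \<le> n" using rd by (auto simp: row_data_def)
      show "r i \<le> d" if "i < m" for i using rb[OF that] by (simp add: d_def)
      have "int ((m + 1) ^ (d + 1)) \<le> ?S x ^ (d + 1)"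
        unfolding of_nat_power mn by (intro power_mono) auto
      also have "\<dots> \<le> ?S x ^ q" by (intro power_increasing) (auto simp: q_def)
      finally show "int ((m + 1) ^ (d + 1)) \<le> ?S x ^ q" .
      have "?S x ^ 1 \<le> ?S x ^ q" using q2 by (intro power_increasing) auto
      then show "int n < ?S x ^ q" using mn by simp
      have "?S x ^ 2 \<le> ?N x" by (rule le_N) (use q2 in simp)
      with sq[of x] have "int (nr x * nc x) < ?N x" by (rule less_le_trans)
      then show "int (m * n) < ?N x" by (simp only: mn)
    qed
    from optimal_matrix obtain A where A: "optimal m n r f A"
      "map (\<lambda>i. out2 (int d) (?N x) (input (?enc x)) (?BT x) (int i)) [0..<m * n] = matrix_list A"
      by (elim exE conjE) (rule that)
    have "[0..<nr x * nc x] = [0..<m * n]" by (simp only: mn)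
    then show "(case x of (m, n, r, f) \<Rightarrow> \<lambda>out. \<exists>A. optimal m n r f A \<and> out = matrix_list A)
        (map (\<lambda>i. out2 (int d) (?N x) (input (?enc x)) (?BT x) (int i)) [0..<nr x * nc x])"
      using A(1) by (simp only: A(2)) (auto simp: x)
  qed
qed

end
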